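(* Let $N\in\mathbb{N}$, let $u\in C^\infty(\mathbb{S}^N)$ be a spherical harmonic and let $v=\iota(u)$. Then there is $\lambda\in\mathbb{R}$ such that $$\mathscr{P}^{\log}_g u=\lambda u\quad\text{on }\mathbb{S}^N\qquad\text{and}\qquad L_\Delta v+v\ln\phi^{-2}=\lambda v\quad\text{in }\mathbb{R}^N.$$
   Context: $\mathbb{S}^N\subset\mathbb{R}^{N+1}$ is the unit sphere with round metric $g$ and volume element $dV_g$; $|z-\zeta|$ is the Euclidean distance in $\mathbb{R}^{N+1}$. A spherical harmonic is an eigenfunction of the Laplace-Beltrami operator: $-\Delta_gu=i(i+N-1)u$ on $\mathbb{S}^N$ for some integer $i\ge0$. Let $c_N=\pi^{-N/2}\Gamma(\tfrac N2)$, $A_N=2\psi(\tfrac N2)$, $\psi=\Gamma'/\Gamma$. The conformal logarithmic Laplacian is $$\mathscr{P}^{\log}_g u(z)=c_N\int_{\mathbb{S}^N}\frac{u(z)-u(\zeta)}{|z-\zeta|^N}\,dV_g(\zeta)+A_Nu(z).$$ The stereographic projection from the south pole $-e_{N+1}$ is $\sigma(z',z_{N+1})=\frac{z'}{1+z_{N+1}}$, with inverse $\sigma^{-1}(x)=\left(\frac{2x}{1+|x|^2},\frac{1-|x|^2}{1+|x|^2}\right)$. Set $\phi(x)=\frac{2}{1+|x|^2}$ and $\iota(u)(x):=\phi(x)^{N/2}u(\sigma^{-1}(x))$, $x\in\mathbb{R}^N$. The logarithmic Laplacian in $\mathbb{R}^N$ is $$L_\Delta v(x)=c_N\int_{B_1(x)}\frac{v(x)-v(y)}{|x-y|^N}\,dy-c_N\int_{\mathbb{R}^N\setminus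 B_1(x)}\frac{v(y)}{|x-y|^N}\,dy+\rho_Nv(x),$$ where $\rho_N=2\ln2+\psi(\tfrac N2)-\gamma$, $\gamma=-\Gamma'(1)$, and $B_1(x)$ is the open unit ball centered at $x$. *)

theory Defs
  imports "HOL-Analysis.Analysis"
begin

text \<open>
  Throughout, \<open>\<real>\<^sup>N\<close> is a Euclidean space \<open>'a\<close> with \<open>N = DIM('a)\<close>, and \<open>\<real>\<^sup>N\<^sup>+\<^sup>1\<close> is
  \<open>'a \<times> real\<close>, whose product norm is the Euclidean one; the sphere is \<open>sphere 0 1\<close> in that space.
  Functions on the sphere are total functions on the ambient space of which only the values on
  the sphere are used.
\<close>

section \<open>Calculus on the unit sphere\<close>

primrec Ck_on :: "nat \<Rightarrow> ('b::euclidean_space \<Rightarrow> 'c::real_normed_vector) \<Rightarrow> 'b set \<Rightarrow> bool" where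
  "Ck_on 0 f V \<longleftrightarrow> continuous_on V f"
| "Ck_on (Suc k) f V \<longleftrightarrow>
     (\<forall>x\<in>V. f differentiable (at x)) \<and> (\<forall>h. Ck_on k (\<lambda>x. frechet_derivative f (at x) h) V)"

definition smooth_on_sphere :: "('b::euclidean_space \<Rightarrow> real) \<Rightarrow> bool" where
  "smooth_on_sphere u \<longleftrightarrow>
     (\<exists>V F. open V \<and> sphere 0 1 \<subseteq> V \<and> (\<forall>k. Ck_on k F V) \<and> (\<forall>z\<in>sphere 0 1. F z = u z))"

text \<open>
  For \<open>z\<close> on the sphere, the derivative of \<open>x \<mapsto> f (x / |x|)\<close> at \<open>z\<close> is \<open>df\<^sub>z \<circ> P\<^sub>z\<close>, where
  \<open>df\<^sub>z\<close> is the differential of \<open>f\<close> on the tangent space and \<open>P\<^sub>z\<close> is the orthogonal projection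
  onto the tangent space.
\<close>
definition sphere_deriv ::
    "('b::euclidean_space \<Rightarrow> 'c::real_normed_vector) \<Rightarrow> 'b \<Rightarrow> 'b \<Rightarrow> 'c" where
  "sphere_deriv f z = frechet_derivative (\<lambda>x. f (sgn x)) (at z)"

text \<open>The tangent vector representing \<open>du\<^sub>z\<close> with respect to the round metric.\<close>
definition sphere_grad :: "('b::euclidean_space \<Rightarrow> real) \<Rightarrow> 'b \<Rightarrow> 'b" where
  "sphere_grad u z = (\<Sum>b\<in>Basis. sphere_deriv u z b *\<^sub>R b)"

text \<open>
  The Levi-Civita derivative of a tangent field \<open>X\<close> is \<open>P\<^sub>z \<circ> dX\<^sub>z\<close>. The trace of this map over
  the tangent space is the ambient trace of \<open>P\<^sub>z \<circ> dX\<^sub>z \<circ> P\<^sub>z\<close>, hence of \<open>dX\<^sub>z \<circ> P\<^sub>z\<close>.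
\<close>
definition sphere_div :: "('b::euclidean_space \<Rightarrow> 'b) \<Rightarrow> 'b \<Rightarrow> real" where
  "sphere_div X z = (\<Sum>b\<in>Basis. sphere_deriv X z b \<bullet> b)"

definition laplace_beltrami :: "('b::euclidean_space \<Rightarrow> real) \<Rightarrow> 'b \<Rightarrow> real" where
  "laplace_beltrami u z = sphere_div (sphere_grad u) z"

text \<open>As usual, the zero function is not excluded from the eigenspaces.\<close>
definition spherical_harmonic :: "('a::euclidean_space \<times> real \<Rightarrow> real) \<Rightarrow> bool" where
  "spherical_harmonic u \<longleftrightarrow> smooth_on_sphere u \<and>
     (\<exists>i::nat. \<forall>z\<in>sphere 0 1.
        - laplace_beltrami u z = real i * (real i + real DIM('a) - 1) * u z)"

text \<open>
  The volume measure of the unit sphere: the measure of \<open>A\<close> is the dimension of the ambient space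
  times the Lebesgue measure of the cone \<open>{t z | 0 < t \<le> 1, z \<in> A}\<close>.
\<close>
definition sphere_measure :: "'b::euclidean_space measure" where
  "sphere_measure =
     scale_measure (of_nat DIM('b))
       (distr (restrict_space lborel (cball 0 1 - {0})) (restrict_space borel (sphere 0 1)) sgn)"

lemma sgn_measurable_sphere:
  "sgn \<in> measurable (restrict_space lborel (cball 0 1 - {0::'b::euclidean_space}))
     (restrict_space borel (sphere 0 1))"
proof (rule measurable_restrict_space2)
  show "sgn \<in> space (restrict_space lborel (cball 0 1 - {0::'b})) \<rightarrow> sphere 0 1"
    by (auto simp: space_restrict_space norm_sgn)
  have "continuous_on (cball 0 1 - {0::'b}) sgn"
    unfolding sgn_div_norm by (intro continuous_intros) auto
  then have "sgn \<in> borel_measurable (restrict_space borel (cball 0 1 - {0::'b}))"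
    by (rule borel_measurable_continuous_on_restrict)
  then show "sgn \<in> borel_measurable (restrict_space lborel (cball 0 1 - {0::'b}))"
    by (simp add: measurable_def space_restrict_space sets_restrict_space)
qed

lemma emeasure_sphere_measure:
  fixes A :: "'b::euclidean_space set"
  assumes "A \<in> sets borel" "A \<subseteq> sphere 0 1"
  shows "emeasure sphere_measure A =
    of_nat DIM('b) * emeasure lborel {t *\<^sub>R z |t z. 0 < t \<and> t \<le> 1 \<and> z \<in> A}"
proof -
  have A: "A \<in> sets (restrict_space borel (sphere 0 1))"
    using assms by (auto simp: sets_restrict_space)
  have "sgn -` A \<inter> (cball 0 1 - {0}) = {t *\<^sub>R z |t z. 0 < t \<and> t \<le> 1 \<and> z \<in> A}"
  proof (intro set_eqI iffI)
    fix x assume "x \<in> sgn -` A \<inter> (cball 0 1 - {0})"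
    then have "x = norm x *\<^sub>R sgn x" "0 < norm x" "norm x \<le> 1" "sgn x \<in> A"
      by (auto simp: sgn_div_norm)
    then show "x \<in> {t *\<^sub>R z |t z. 0 < t \<and> t \<le> 1 \<and> z \<in> A}" by blast
  next
    fix x assume "x \<in> {t *\<^sub>R z |t z. 0 < t \<and> t \<le> 1 \<and> z \<in> A}"
    then obtain t z where x: "x = t *\<^sub>R z" "0 < t" "t \<le> 1" "z \<in> A" by blast
    then have "norm z = 1" using assms(2) by auto
    with x show "x \<in> sgn -` A \<inter> (cball 0 1 - {0})"
      by (auto simp: sgn_div_norm)
  qed
  moreover have "sgn -` A \<inter> (cball 0 1 - {0}) \<subseteq> cball 0 1 - {0}" by blast
  ultimately show ?thesis
    unfolding sphere_measure_def
    by (simp add: emeasure_distr[OF sgn_measurable_sphere A] emeasure_restrict_space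
        space_restrict_space)
qed

section \<open>The two logarithmic operators\<close>

definition c_const :: "nat \<Rightarrow> real" where
  "c_const N = pi powr (- (real N / 2)) * Gamma (real N / 2)"

definition A_const :: "nat \<Rightarrow> real" where
  "A_const N = 2 * Digamma (real N / 2)"

definition rho_const :: "nat \<Rightarrow> real" where
  "rho_const N = 2 * ln 2 + Digamma (real N / 2) - euler_mascheroni"

lemma Digamma_eq:
  fixes x :: real
  assumes "x > 0"
  shows "Digamma x = deriv Gamma x / Gamma x"
proof -
  have "x \<notin> \<int>\<^sub>\<le>\<^sub>0" using assms by (auto elim!: nonpos_Ints_cases)
  then show ?thesis
    using has_field_derivative_Gamma[of x UNIV, THEN DERIV_imp_deriv] Gamma_real_pos[OF assms]
    by (simp add: field_simps)
qed

lemma euler_mascheroni_eq: "euler_mascheroni = - deriv Gamma (1::real)"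
  using Digamma_eq[of 1] by simp

definition conf_log_laplacian :: "('a::euclidean_space \<times> real \<Rightarrow> real) \<Rightarrow> 'a \<times> real \<Rightarrow> real" where
  "conf_log_laplacian u z =
     c_const DIM('a) * (\<integral>\<zeta>. (u z - u \<zeta>) / norm (z - \<zeta>) ^ DIM('a) \<partial>sphere_measure)
     + A_const DIM('a) * u z"

definition log_laplacian :: "('a::euclidean_space \<Rightarrow> real) \<Rightarrow> 'a \<Rightarrow> real" where
  "log_laplacian v x =
     c_const DIM('a) * (LINT y:ball x 1|lborel. (v x - v y) / norm (x - y) ^ DIM('a))
     - c_const DIM('a) * (LINT y:- ball x 1|lborel. v y / norm (x - y) ^ DIM('a))
     + rho_const DIM('a) * v x"

section \<open>Stereographic projection from the south pole\<close>

definition stereo :: "'a::euclidean_space \<times> real \<Rightarrow> 'a" where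
  "stereo z = (1 / (1 + snd z)) *\<^sub>R fst z"

definition stereo_inv :: "'a::euclidean_space \<Rightarrow> 'a \<times> real" where
  "stereo_inv x =
     ((2 / (1 + (norm x)\<^sup>2)) *\<^sub>R x, (1 - (norm x)\<^sup>2) / (1 + (norm x)\<^sup>2))"

definition conf_factor :: "'a::euclidean_space \<Rightarrow> real" where
  "conf_factor x = 2 / (1 + (norm x)\<^sup>2)"

definition iota :: "('a::euclidean_space \<times> real \<Rightarrow> real) \<Rightarrow> 'a \<Rightarrow> real" where
  "iota u x = conf_factor x powr (real DIM('a) / 2) * u (stereo_inv x)"

lemma stereo_inv_in_sphere: "stereo_inv x \<in> sphere 0 1"
proof -
  have pos: "1 + (norm x)\<^sup>2 > 0" by (simp add: add_pos_nonneg)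
  have "(2 / (1 + (norm x)\<^sup>2) * norm x)\<^sup>2 + ((1 - (norm x)\<^sup>2) / (1 + (norm x)\<^sup>2))\<^sup>2 = 1"
    using pos unfolding power_divide power_mult_distrib
    by (simp add: divide_simps) (simp add: algebra_simps power2_eq_square)
  then show ?thesis
    using pos by (simp add: stereo_inv_def norm_Pair power_mult_distrib power_divide)
qed

lemma stereo_stereo_inv: "stereo (stereo_inv x) = x"
proof -
  have "1 + (norm x)\<^sup>2 > 0" by (simp add: add_pos_nonneg)
  then show ?thesis by (simp add: stereo_def stereo_inv_def field_simps)
qed

lemma stereo_inv_stereo:
  assumes "z \<in> sphere 0 1" "z \<noteq> (0, -1)"
  shows "stereo_inv (stereo z) = z"
proof -
  obtain a t where z: "z = (a, t)" by (cases z)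
  have nrm: "(norm a)\<^sup>2 = 1 - t\<^sup>2" using assms(1) by (simp add: z norm_Pair)
  have "t \<noteq> -1" using nrm assms(2) by (auto simp: z)
  then have t: "1 + t \<noteq> 0" by simp
  have "(norm (stereo z))\<^sup>2 = (1 - t\<^sup>2) / (1 + t)\<^sup>2"
    by (simp add: stereo_def z power_divide nrm)
  also have "\<dots> = (1 - t) / (1 + t)" using t
    by (simp add: divide_simps) (simp add: algebra_simps power2_eq_square)
  finally have n: "(norm (stereo z))\<^sup>2 = (1 - t) / (1 + t)" .
  have s: "1 + (norm (stereo z))\<^sup>2 = 2 / (1 + t)" unfolding n using t by (simp add: field_simps)
  show ?thesis
    unfolding stereo_inv_def s unfolding n using t by (simp add: z stereo_def field_simps)
qed

end

theory Submission
  imports Defs "HOL-Probability.Distributions"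
begin

text \<open>
  Eigenfunction property on the sphere. Put \<open>\<tau> = (1 + e \<bullet> \<zeta>) / 2\<close> for a point \<open>e\<close> of the sphere. Green's identity
  for \<open>u\<close> and \<open>\<tau>\<^sup>k\<close> yields a one-step recursion for the moments \<open>\<integral> u \<tau>\<^sup>k\<close>, hence \<open>\<integral> u \<tau>\<^sup>k = t\<^sub>k C(e)\<close>
  with \<open>t\<^sub>k\<close> independent of \<open>e\<close>; for \<open>u = 1\<close> the moments do not depend on \<open>e\<close> at all. Since \<open>|e - \<zeta>|\<^sup>2 = 4 (1 - \<tau>)\<close>,
  the kernel \<open>|e - \<zeta>|\<^sup>-\<^sup>N\<close> is a power series in \<open>\<tau>\<close> with nonnegative coefficients. Its partial sums, tested against
  \<open>u(e) - u(\<zeta>)\<close>, give \<open>u(e) a\<^sub>m - C(e) b\<^sub>m\<close>, which converges while \<open>a\<^sub>m\<close> diverges. This forces \<open>C\<close> to be a multiple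
  of \<open>u\<close>, and then the limit is a multiple of \<open>u\<close> as well.

  Transfer to the Euclidean space. Since \<open>|\<sigma>\<^sup>-\<^sup>1(x) - \<sigma>\<^sup>-\<^sup>1(y)|\<^sup>2 = \<phi>(x) \<phi>(y) |x - y|\<^sup>2\<close>, stereographic projection reduces the
  identity \<open>L v + v ln \<phi>\<^sup>-\<^sup>2 = \<phi>\<^sup>N\<^sup>/\<^sup>2 (P u) \<circ> \<sigma>\<^sup>-\<^sup>1\<close> to the case \<open>u = 1\<close>. There the kernel is regularized to
  \<open>|x - y|\<^sup>s\<^sup>-\<^sup>N\<close>, the integrals are Gamma quotients, and the constants come out as a derivative at \<open>s = 0\<close>.
\<close>

section \<open>Calculus of the classes \<open>C\<^sup>k\<close>\<close>

text \<open>The spherical half is the Funk-Hecke formula for this kernel, derived from the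
  eigenvalue equation alone. The variable \<tau> is chosen because |grad \<tau>|^2 = \<tau> (1 -
  \<tau>) and the Laplacian of \<tau> is affine in \<tau>: the Laplacian of \<tau>^(k+1) involves
  only \<tau>^k and \<tau>^(k+1), whereas powers of e \<bullet> \<zeta> couple orders two apart. The
  obstacle is that |e - \<zeta>|^(-N) is not integrable, so u(e) and u(\<zeta>) cannot be integrated
  separately; this very divergence is what makes C proportional to u.

  For the Euclidean half put w = \<phi>^(N/2), U(y) = u(\<sigma>^(-1)(y)) and let 1_B be the
  indicator of the unit ball about x. The reduction to u = 1 is the identity 1_B(y) w(x) U(x) - w(y)
  U(y) = (U(x) - U(y)) w(y) - U(x) (w(y) - w(x) 1_B(y)). Over |x - y|^N, the first term is a pulled
  back sphere integral, and the second contains u only through U(x). Up to c_N, the integral of its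
  last factor is w(x) (2 ln 2 - \<gamma> - \<psi>(N/2) - 2 ln \<phi>(x)); subtracting this bracket
  from \<rho>_N leaves A_N + 2 ln \<phi>(x).\<close>

lemma Ck_on_cong:
  assumes "open U" "\<And>x. x \<in> U \<Longrightarrow> f x = g x" "Ck_on k f U"
  shows "Ck_on k g U"
  using assms(2,3)
proof (induction k arbitrary: f g)
  case 0
  then show ?case by (auto cong: continuous_on_cong)
next
  case (Suc k)
  have *: "(g has_derivative frechet_derivative f (at x)) (at x)" if "x \<in> U" for x
  proof -
    have "(f has_derivative frechet_derivative f (at x)) (at x)"
      using Suc.prems(2) that by (auto simp: frechet_derivative_works)
    then show ?thesis
      using has_derivative_transform_within_open[OF _ assms(1) that] Suc.prems(1) by blast
  qed
  have eq: "frechet_derivative f (at x) = frechet_derivative g (at x)" if "x \<in> U" for x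
    using frechet_derivative_at[OF *[OF that]] .
  show ?case
    unfolding Ck_on.simps
  proof (intro conjI ballI allI)
    show "g differentiable at x" if "x \<in> U" for x
      using *[OF that] by (auto simp: differentiable_def)
    show "Ck_on k (\<lambda>x. frechet_derivative g (at x) h) U" for h
      using Suc.IH[of "\<lambda>x. frechet_derivative f (at x) h" "\<lambda>x. frechet_derivative g (at x) h"]
        eq Suc.prems(2) by simp
  qed
qed

text \<open>On an open set the derivative is unique, so any explicit formula for it may replace the
  abstract \<open>frechet_derivative\<close> in the recursion that defines
  \<open>Ck_on\<close>.\<close>

lemma Ck_on_SucI:
  assumes "open U" "\<And>x. x \<in> U \<Longrightarrow> (f has_derivative f' x) (at x)"
    and "\<And>h. Ck_on k (\<lambda>x. f' x h) U"
  shows "Ck_on (Suc k) f U"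
  unfolding Ck_on.simps
proof (intro conjI ballI allI)
  show "f differentiable at x" if "x \<in> U" for x
    using assms(2)[OF that] by (auto simp: differentiable_def)
  show "Ck_on k (\<lambda>x. frechet_derivative f (at x) h) U" for h
    using assms(3)[of h] by (rule Ck_on_cong[OF assms(1), rotated])
      (simp add: frechet_derivative_at[OF assms(2), symmetric])
qed

lemma Ck_on_Suc_has_derivative:
  "Ck_on (Suc k) f U \<Longrightarrow> x \<in> U \<Longrightarrow> (f has_derivative frechet_derivative f (at x)) (at x)"
  by (auto simp: frechet_derivative_works)

lemma Ck_on_Suc_imp: "Ck_on (Suc k) f U \<Longrightarrow> Ck_on k f U"
proof (induction k arbitrary: f)
  case 0
  then show ?case
    by (auto intro!: differentiable_imp_continuous_on
        simp: differentiable_on_def intro: differentiable_at_imp_differentiable_on differentiable_within_subset[OF _ subset_UNIV])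
next
  case (Suc k)
  then show ?case by (metis Ck_on.simps(2))
qed

lemma Ck_on_const: "Ck_on k (\<lambda>x. c) U"
  by (induction k arbitrary: c) auto

lemma Ck_on_add:
  assumes "open U" "Ck_on k f U" "Ck_on k g U"
  shows "Ck_on k (\<lambda>x. f x + g x) U"
  using assms(2,3)
proof (induction k arbitrary: f g)
  case 0
  then show ?case by (auto intro: continuous_intros)
next
  case (Suc k)
  show ?case
    by (rule Ck_on_SucI[OF assms(1) has_derivative_add])
      (use Suc in \<open>auto intro: Ck_on_Suc_has_derivative\<close>)
qed

lemma Ck_on_sum:
  assumes "open U" "\<And>i. i \<in> I \<Longrightarrow> Ck_on k (f i) U"
  shows "Ck_on k (\<lambda>x. \<Sum>i\<in>I. f i x) U"
  using assms(2)
  by (induction I rule: infinite_finite_induct) (auto intro: Ck_on_const Ck_on_add[OF assms(1)])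

lemma Ck_on_mult:
  fixes f g :: "'b::euclidean_space \<Rightarrow> real"
  assumes "open U" "Ck_on k f U" "Ck_on k g U"
  shows "Ck_on k (\<lambda>x. f x * g x) U"
  using assms(2,3)
proof (induction k arbitrary: f g)
  case 0
  then show ?case by (auto intro: continuous_intros)
next
  case (Suc k)
  show ?case
  proof (rule Ck_on_SucI[OF assms(1) has_derivative_mult])
    show "(f has_derivative frechet_derivative f (at x)) (at x)"
      "(g has_derivative frechet_derivative g (at x)) (at x)" if "x \<in> U" for x
      using Suc.prems that by (blast intro: Ck_on_Suc_has_derivative)+
    show "Ck_on k (\<lambda>x. f x * frechet_derivative g (at x) h + frechet_derivative f (at x) h * g x) U"
      for h
      using Suc.prems Ck_on_Suc_imp by (intro Ck_on_add[OF assms(1)] Suc.IH) auto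
  qed
qed

lemma Ck_on_uminus:
  fixes f :: "'b::euclidean_space \<Rightarrow> real"
  assumes "open U" "Ck_on k f U"
  shows "Ck_on k (\<lambda>x. - f x) U"
  using Ck_on_mult[OF assms(1) Ck_on_const[of _ "-1"] assms(2)] by simp

lemma Ck_on_diff:
  fixes f g :: "'b::euclidean_space \<Rightarrow> real"
  assumes "open U" "Ck_on k f U" "Ck_on k g U"
  shows "Ck_on k (\<lambda>x. f x - g x) U"
  using Ck_on_add[OF assms(1,2) Ck_on_uminus[OF assms(1,3)]] by simp

lemma Ck_on_power:
  fixes f :: "'b::euclidean_space \<Rightarrow> real"
  assumes "open U" "Ck_on k f U"
  shows "Ck_on k (\<lambda>x. f x ^ n) U"
  by (induction n) (auto intro: Ck_on_const Ck_on_mult[OF assms(1)] assms(2))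

lemma Ck_on_linear:
  assumes "bounded_linear f" "open U"
  shows "Ck_on k f U"
proof (cases k)
  case 0
  then show ?thesis
    using assms by (auto intro: linear_continuous_on)
next
  case (Suc j)
  show ?thesis
    unfolding Suc using assms
    by (intro Ck_on_SucI[of _ _ "\<lambda>_. f"] Ck_on_const) (auto intro: bounded_linear_imp_has_derivative)
qed

lemma has_derivative_compose_Basis:
  fixes F :: "'b::euclidean_space \<Rightarrow> 'c::real_normed_vector" and s :: "'d::euclidean_space \<Rightarrow> 'b"
  assumes F: "(F has_derivative F') (at (s x))"
    and s: "\<And>b. b \<in> Basis \<Longrightarrow> ((\<lambda>x. s x \<bullet> b) has_derivative s' b) (at x)"
  shows "((\<lambda>x. F (s x)) has_derivative (\<lambda>h. \<Sum>b\<in>Basis. s' b h *\<^sub>R F' b)) (at x)"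
proof -
  interpret bounded_linear F' using F by (rule has_derivative_bounded_linear)
  have "(s has_derivative (\<lambda>h. \<Sum>b\<in>Basis. s' b h *\<^sub>R b)) (at x)"
    unfolding has_derivative_componentwise_within[of s] using s by simp
  from diff_chain_at[OF this F] show ?thesis by (simp add: o_def sum scaleR)
qed

text \<open>In coordinates the chain rule gives a sum of products of real functions: derivatives of
  the components of \<open>s\<close>, and partial derivatives of \<open>F\<close> composed with
  \<open>s\<close>. The induction hypothesis applies to the latter because \<open>F\<close> is
  arbitrary in it.\<close>

lemma Ck_on_compose:
  fixes F :: "'b::euclidean_space \<Rightarrow> real" and s :: "'d::euclidean_space \<Rightarrow> 'b"
  assumes "open U" "s ` U \<subseteq> V"
    and "\<And>b. b \<in> Basis \<Longrightarrow> Ck_on k (\<lambda>x. s x \<bullet> b) U" "Ck_on k F V"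
  shows "Ck_on k (\<lambda>x. F (s x)) U"
  using assms(3,4)
proof (induction k arbitrary: F)
  case 0
  then have "continuous_on U s"
    using continuous_on_componentwise[of U s] by simp
  then show ?case
    using 0 assms(2) continuous_on_compose2[of V F U s] by simp
next
  case (Suc k)
  have s: "((\<lambda>x. s x \<bullet> b) has_derivative frechet_derivative (\<lambda>x. s x \<bullet> b) (at x)) (at x)"
    if "x \<in> U" "b \<in> Basis" for x b
    using Suc.prems(1) that by (blast intro: Ck_on_Suc_has_derivative)
  have F: "(F has_derivative frechet_derivative F (at (s x))) (at (s x))" if "x \<in> U" for x
    using Suc.prems(2) that assms(2) by (blast intro: Ck_on_Suc_has_derivative)
  have sk: "Ck_on k (\<lambda>x. s x \<bullet> b) U" "Ck_on k (\<lambda>x. frechet_derivative (\<lambda>x. s x \<bullet> b) (at x) h) U"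
    if "b \<in> Basis" for b h
    using Suc.prems(1)[OF that] Ck_on_Suc_imp by auto
  show ?case
  proof (rule Ck_on_SucI[OF assms(1)])
    show "((\<lambda>x. F (s x)) has_derivative (\<lambda>h. \<Sum>b\<in>Basis.
        frechet_derivative (\<lambda>x. s x \<bullet> b) (at x) h *\<^sub>R frechet_derivative F (at (s x)) b)) (at x)"
      if "x \<in> U" for x
      using has_derivative_compose_Basis[OF F s] that by blast
    show "Ck_on k (\<lambda>x. \<Sum>b\<in>Basis.
        frechet_derivative (\<lambda>x. s x \<bullet> b) (at x) h *\<^sub>R frechet_derivative F (at (s x)) b) U" for h
      unfolding real_scaleR_def
    proof (intro Ck_on_sum Ck_on_mult assms(1) sk)
      show "Ck_on k (\<lambda>x. frechet_derivative F (at (s x)) b) U" for b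
        using Suc.IH[of "\<lambda>x. frechet_derivative F (at x) b"] Suc.prems(2) sk(1) by simp
    qed
  qed
qed

section \<open>Smoothness of the radial projection and of radial extensions\<close>

lemma has_derivative_inverse_norm:
  fixes x :: "'b::euclidean_space"
  assumes "x \<noteq> 0"
  shows "((\<lambda>x. inverse (norm x)) has_derivative (\<lambda>h. - (h \<bullet> x) * inverse (norm x) ^ 3)) (at x)"
  using assms
  by (auto intro!: derivative_eq_intros has_derivative_norm
      simp: sgn_div_norm power3_eq_cube fun_eq_iff divide_simps)

text \<open>The derivative is a polynomial in the coordinates and in \<open>inverse (norm x)\<close>
  itself, so the induction on \<open>k\<close> closes.\<close>

lemma Ck_on_inverse_norm: "Ck_on k (\<lambda>x::'b::euclidean_space. inverse (norm x)) (- {0})"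
proof (induction k)
  case 0
  then show ?case by (auto intro!: continuous_intros)
next
  case (Suc k)
  have [simp]: "open (- {0::'b})" by auto
  show ?case
  proof (rule Ck_on_SucI)
    show "((\<lambda>x::'b. inverse (norm x)) has_derivative (\<lambda>h. - (h \<bullet> x) * inverse (norm x) ^ 3)) (at x)"
      if "x \<in> - {0}" for x
      using that has_derivative_inverse_norm[of x] by blast
    show "Ck_on k (\<lambda>x::'b. - (h \<bullet> x) * inverse (norm x) ^ 3) (- {0})" for h
      by (intro Ck_on_uminus Ck_on_mult Ck_on_power Suc Ck_on_linear bounded_linear_inner_right) auto
  qed simp
qed

lemma Ck_on_sgn: "Ck_on k (\<lambda>x::'b::euclidean_space. sgn x \<bullet> b) (- {0})"
proof -
  have "Ck_on k (\<lambda>x::'b. inverse (norm x) * (x \<bullet> b)) (- {0})"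
    by (intro Ck_on_mult Ck_on_inverse_norm Ck_on_linear bounded_linear_inner_left) auto
  then show ?thesis by (simp add: sgn_div_norm)
qed

lemma Ck_on_compose_sgn:
  fixes F :: "'b::euclidean_space \<Rightarrow> real"
  assumes "sphere 0 1 \<subseteq> V" "Ck_on k F V"
  shows "Ck_on k (\<lambda>x. F (sgn x)) (- {0})"
proof (rule Ck_on_compose[OF _ _ _ assms(2)])
  have "sgn x \<in> sphere 0 1" if "x \<noteq> 0" for x :: 'b
    using that by (simp add: norm_sgn)
  then show "sgn ` (- {0}) \<subseteq> V" using assms(1) by blast
qed (auto intro: Ck_on_sgn)

text \<open>Replaces the unspecified smooth extension by the one that is homogeneous of degree 0, on
  which \<open>sphere_deriv\<close> is built.\<close>

lemma smooth_on_sphere_compose_sgn: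
  fixes u :: "'b::euclidean_space \<Rightarrow> real"
  assumes "smooth_on_sphere u"
  shows "Ck_on k (\<lambda>x. u (sgn x)) (- {0})"
proof -
  from assms obtain V F where *: "open V" "sphere 0 1 \<subseteq> V" "\<And>k. Ck_on k F V"
    "\<And>z. z \<in> sphere 0 1 \<Longrightarrow> F z = u z"
    unfolding smooth_on_sphere_def by blast
  show ?thesis
    by (rule Ck_on_cong[OF _ _ Ck_on_compose_sgn[OF *(2,3)]]) (auto simp: norm_sgn *(4))
qed

section \<open>Integration on the sphere and the divergence theorem\<close>

lemma space_sphere_measure [simp]: "space sphere_measure = sphere (0::'b::euclidean_space) 1"
  and sets_sphere_measure [simp, measurable_cong]:
    "sets sphere_measure = sets (restrict_space borel (sphere (0::'b::euclidean_space) 1))"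
  by (simp_all add: sphere_measure_def space_restrict_space space_scale_measure)

lemma nn_integral_sphere_measure:
  fixes h :: "'b::euclidean_space \<Rightarrow> ennreal"
  assumes "h \<in> borel_measurable (restrict_space borel (sphere 0 1))"
  shows "integral\<^sup>N sphere_measure h =
    of_nat DIM('b) * (\<integral>\<^sup>+x\<in>cball 0 1 - {0}. h (sgn x) \<partial>lborel)"
  using assms unfolding sphere_measure_def
  by (simp add: nn_integral_scale_measure nn_integral_distr[OF sgn_measurable_sphere]
      nn_integral_restrict_space)

lemma finite_sphere_measure: "finite_measure (sphere_measure :: 'b::euclidean_space measure)"
proof
  have "emeasure (sphere_measure :: 'b measure) (sphere 0 1) = (\<integral>\<^sup>+x. 1 \<partial>(sphere_measure :: 'b measure))"
    by simp
  also have "\<dots> = of_nat DIM('b) * emeasure lborel (cball (0::'b) 1 - {0})"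
    by (subst nn_integral_sphere_measure) simp_all
  also have "\<dots> \<le> of_nat DIM('b) * emeasure lborel (cball (0::'b) 1)"
    by (intro mult_left_mono emeasure_mono) auto
  also have "\<dots> < \<infinity>"
    using emeasure_bounded_finite[of "cball (0::'b) 1"] by (simp add: ennreal_mult_less_top of_nat_less_top)
  finally show "emeasure (sphere_measure :: 'b measure) (space sphere_measure) \<noteq> \<infinity>" by simp
qed

interpretation sphere: finite_measure sphere_measure
  by (rule finite_sphere_measure)

lemma borel_measurable_sphere_continuous:
  fixes h :: "'b::euclidean_space \<Rightarrow> 'c::topological_space"
  assumes "continuous_on (sphere 0 1) h"
  shows "h \<in> borel_measurable (sphere_measure :: 'b measure)"
  using borel_measurable_continuous_on_restrict[OF assms]
  by (simp add: measurable_cong_sets[OF sets_sphere_measure refl])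

lemma integrable_sphere_continuous:
  fixes h :: "'b::euclidean_space \<Rightarrow> real"
  assumes "continuous_on (sphere 0 1) h"
  shows "integrable sphere_measure h"
proof -
  have "compact (h ` sphere 0 1)" using assms by (rule compact_continuous_image) simp
  then obtain B where "\<And>x. x \<in> sphere 0 1 \<Longrightarrow> norm (h x) \<le> B"
    by (meson bounded_iff compact_imp_bounded image_eqI)
  then show ?thesis
    using borel_measurable_sphere_continuous[OF assms]
    by (intro sphere.integrable_const_bound[of _ B] AE_I2) auto
qed

text \<open>Written as a constant density, the scaling factor becomes accessible to the Bochner
  integral and almost-everywhere rules for densities.\<close>

lemma sphere_measure_eq_density:
  "(sphere_measure :: 'b::euclidean_space measure) =
    density (distr (restrict_space lborel (cball 0 1 - {0})) (restrict_space borel (sphere 0 1)) sgn)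
      (\<lambda>_. of_nat DIM('b))"
  unfolding sphere_measure_def by (rule measure_eqI) (simp_all add: emeasure_density nn_integral_cmult)

lemma integral_sphere_measure:
  fixes h :: "'b::euclidean_space \<Rightarrow> real"
  assumes h: "continuous_on (sphere 0 1) h"
  shows "integral\<^sup>L sphere_measure h =
    real DIM('b) * (LINT x|lborel. indicator (cball 0 1 - {0}) x * h (sgn x))"
proof -
  let ?M = "restrict_space lborel (cball 0 1 - {0::'b})"
  let ?S = "restrict_space borel (sphere (0::'b) 1)"
  have hm: "h \<in> borel_measurable ?S"
    using h by (rule borel_measurable_continuous_on_restrict)
  show ?thesis
    unfolding sphere_measure_eq_density ennreal_of_nat_eq_real_of_nat using hm
    by (subst integral_density)
      (simp_all add: integral_distr[OF sgn_measurable_sphere] integral_restrict_space)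
qed

lemma integral_translate:
  fixes f :: "'b::euclidean_space \<Rightarrow> real"
  assumes [measurable]: "f \<in> borel_measurable borel"
  shows "(LINT x|lborel. f (x + a)) = integral\<^sup>L lborel f"
proof -
  have "integral\<^sup>L lborel f = integral\<^sup>L (distr lborel borel ((+) a)) f"
    by (simp add: lborel_distr_plus)
  also have "\<dots> = (LINT x|lborel. f (a + x))"
    by (rule integral_distr) auto
  finally show ?thesis by (simp add: add.commute)
qed

lemma directional_quotient_tendsto:
  fixes G :: "'b::euclidean_space \<Rightarrow> 'b"
  assumes "(G has_derivative G') (at x)"
  shows "(\<lambda>n. real (Suc n) * ((G (x + inverse (real (Suc n)) *\<^sub>R b) - G x) \<bullet> b)) \<longlonglongrightarrow> G' b \<bullet> b"
proof -
  interpret bounded_linear G' using assms by (rule has_derivative_bounded_linear)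
  have "((\<lambda>t. G (x + t *\<^sub>R b)) has_derivative (\<lambda>t. G' (t *\<^sub>R b))) (at 0)"
    by (rule has_derivative_compose[where f = "\<lambda>t. x + t *\<^sub>R b" and g = G])
      (auto intro!: derivative_eq_intros assms)
  then have "((\<lambda>t. G (x + t *\<^sub>R b) \<bullet> b) has_real_derivative (G' b \<bullet> b)) (at 0)"
    unfolding has_field_derivative_def
    by (auto intro!: derivative_eq_intros simp: scaleR inner_scaleR_left mult.commute)
  then have "((\<lambda>h. (G (x + h *\<^sub>R b) \<bullet> b - G x \<bullet> b) / h) \<longlongrightarrow> G' b \<bullet> b) (at 0)"
    by (simp add: DERIV_def)
  then have "(\<lambda>n. (G (x + inverse (real (Suc n)) *\<^sub>R b) \<bullet> b - G x \<bullet> b) / inverse (real (Suc n)))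
      \<longlonglongrightarrow> G' b \<bullet> b"
    by (rule filterlim_compose)
      (auto simp: filterlim_at LIMSEQ_inverse_real_of_nat simp del: of_nat_Suc)
  then show ?thesis by (simp add: inner_diff_left divide_inverse mult.commute del: of_nat_Suc)
qed

text \<open>The integral of each difference quotient vanishes by translation invariance.\<close>
lemma integral_divergence_eq_0:
  fixes G :: "'b::euclidean_space \<Rightarrow> 'b" and d :: "'b \<Rightarrow> real"
  assumes L: "\<And>x y. norm (G x - G y) \<le> L * norm (x - y)"
    and R: "\<And>x. norm x > R \<Longrightarrow> G x = 0"
    and d: "d \<in> borel_measurable borel"
    and deriv: "AE x in lborel. \<exists>G'. (G has_derivative G') (at x) \<and> (\<Sum>b\<in>Basis. G' b \<bullet> b) = d x"
  shows "integral\<^sup>L lborel d = 0"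
proof -
  have L0: "L \<ge> 0"
  proof -
    obtain b :: 'b where "b \<in> Basis" using nonempty_Basis by blast
    then show ?thesis using order_trans[OF norm_ge_zero L[of b 0]] by simp
  qed
  have "L-lipschitz_on UNIV G"
    by (rule lipschitz_onI) (use L L0 in \<open>auto simp: dist_norm\<close>)
  then have "continuous_on UNIV G" by (rule lipschitz_on_continuous_on)
  then have Gm [measurable]: "G \<in> borel_measurable borel"
    by (rule borel_measurable_continuous_onI)
  define q where "q n x = (\<Sum>b\<in>Basis.
    real (Suc n) * ((G (x + inverse (real (Suc n)) *\<^sub>R b) - G x) \<bullet> b))" for n x
  have Gi: "integrable lborel (\<lambda>x. G x \<bullet> b)" for b
  proof -
    have "compact ((\<lambda>x. G x \<bullet> b) ` cball 0 R)"
      by (intro compact_continuous_image continuous_intros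
          continuous_on_subset[OF \<open>continuous_on UNIV G\<close>]) auto
    then obtain B where "\<And>x. x \<in> cball 0 R \<Longrightarrow> norm (G x \<bullet> b) \<le> B"
      by (meson bounded_iff compact_imp_bounded image_eqI)
    then have B: "norm (G x \<bullet> b) \<le> norm (B * indicator (cball 0 R) x)" for x
      using R[of x] by (cases "norm x \<le> R") (auto simp: indicator_def intro: order_trans[OF _ abs_ge_self])
    show ?thesis
      by (rule Bochner_Integration.integrable_bound[of _ "\<lambda>x. B * indicator (cball 0 R) x"])
        (use B emeasure_bounded_finite[of "cball (0::'b) R"] in auto)
  qed
  have Gt: "integrable lborel (\<lambda>x. G (x + a) \<bullet> b)" for a b
  proof -
    have "integrable (distr lborel borel ((+) a)) (\<lambda>x. G x \<bullet> b)"
      using Gi by (simp add: lborel_distr_plus)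
    then show ?thesis by (subst (asm) integrable_distr_eq) (auto simp: add.commute)
  qed
  have "integral\<^sup>L lborel (q n) = 0" for n
  proof -
    have "integral\<^sup>L lborel (q n) = (\<Sum>b\<in>Basis. real (Suc n) *
        ((LINT x|lborel. G (x + inverse (real (Suc n)) *\<^sub>R b) \<bullet> b) - (LINT x|lborel. G x \<bullet> b)))"
      unfolding q_def inner_diff_left using Gi Gt
      by (simp add: Bochner_Integration.integral_sum Bochner_Integration.integral_diff
          del: of_nat_Suc)
    also have "\<dots> = 0"
      using integral_translate[of "\<lambda>x. G x \<bullet> _"] by (simp del: of_nat_Suc)
    finally show ?thesis .
  qed
  moreover have "(\<lambda>n. integral\<^sup>L lborel (q n)) \<longlonglongrightarrow> integral\<^sup>L lborel d"
  proof (rule integral_dominated_convergence)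
    \<comment> \<open>The Lipschitz bound controls each quotient by \<open>L\<close>. The increments
      have length at most 1, so all quotients vanish outside the ball of radius
      \<open>R + 1\<close>.\<close>
    let ?w = "\<lambda>x::'b. real DIM('b) * L * indicator (cball 0 (R + 1)) x"
    show "d \<in> borel_measurable lborel" using d by simp
    show "q n \<in> borel_measurable lborel" for n unfolding q_def by measurable
    show "integrable lborel ?w"
      using emeasure_bounded_finite[of "cball (0::'b) (R + 1)"] by auto
    show "AE x in lborel. norm (q n x) \<le> ?w x" for n
    proof (rule AE_I2)
      fix x :: 'b
      let ?t = "inverse (real (Suc n))"
      have t: "?t \<le> 1" "?t > 0" by (auto simp: field_simps)
      have "norm (real (Suc n) * ((G (x + ?t *\<^sub>R b) - G x) \<bullet> b)) \<le> L * indicator (cball 0 (R + 1)) x"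
        if b: "b \<in> Basis" for b
      proof (cases "norm x \<le> R + 1")
        case True
        have "\<bar>(G (x + ?t *\<^sub>R b) - G x) \<bullet> b\<bar> \<le> norm (G (x + ?t *\<^sub>R b) - G x)"
          using Basis_le_norm[OF b] .
        also have "\<dots> \<le> L * ?t"
          using L[of "x + ?t *\<^sub>R b" x] b t by simp
        finally have "real (Suc n) * \<bar>(G (x + ?t *\<^sub>R b) - G x) \<bullet> b\<bar> \<le> real (Suc n) * (L * ?t)"
          by (rule mult_left_mono) simp
        also have "\<dots> = L" by (simp del: of_nat_Suc)
        finally show ?thesis using True by (simp add: abs_mult del: of_nat_Suc)
      next
        case False
        have "norm x \<le> norm (x + ?t *\<^sub>R b) + norm (?t *\<^sub>R b)"
          by (metis add_diff_cancel_right' norm_triangle_ineq4)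
        then have "norm (x + ?t *\<^sub>R b) > R" using False b t by simp
        then show ?thesis using R[of x] R[of "x + ?t *\<^sub>R b"] False by simp
      qed
      then have "norm (q n x) \<le> (\<Sum>b\<in>(Basis::'b set). L * indicator (cball 0 (R + 1)) x)"
        unfolding q_def by (intro sum_norm_le) 
      then show "norm (q n x) \<le> ?w x" by (simp add: mult_ac)
    qed
    show "AE x in lborel. (\<lambda>n. q n x) \<longlonglongrightarrow> d x"
      using deriv
    proof eventually_elim
      case (elim x)
      then obtain G' where G': "(G has_derivative G') (at x)" "(\<Sum>b\<in>Basis. G' b \<bullet> b) = d x" by blast
      have "(\<lambda>n. q n x) \<longlonglongrightarrow> (\<Sum>b\<in>Basis. G' b \<bullet> b)"
        unfolding q_def by (intro tendsto_sum directional_quotient_tendsto G'(1))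
      then show ?case using G'(2) by simp
    qed
  qed
  ultimately show ?thesis by (simp add: LIMSEQ_const_iff)
qed

section \<open>Lipschitz bounds for cut-off homogeneous extensions of fields\<close>

lemma AE_norm_neq: "AE x in lborel. norm (x :: 'b::euclidean_space) \<noteq> r"
proof -
  have "sphere (0::'b) r \<in> null_sets lborel"
    using negligible_sphere[of "0::'b" r] by (simp add: negligible_iff_null_sets null_sets_completion_iff)
  then show ?thesis by (auto simp: null_sets_def intro!: AE_I[of _ _ "sphere 0 r"])
qed

text \<open>The map \<open>sgn\<close> is not Lipschitz near 0; the norm of the shorter vector is
  the weight that compensates. The proof rests on |x| (sgn x - sgn y) = (x - y) + (|y| - |x|) sgn y,
  where both summands have norm at most |x - y|.\<close>

lemma norm_sgn_diff_le:
  fixes x y :: "'b::euclidean_space"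
  assumes "norm x \<le> norm y"
  shows "norm x * norm (sgn x - sgn y) \<le> 2 * norm (x - y)"
proof (cases "y = 0 \<or> x = 0")
  case False
  have "norm x *\<^sub>R (sgn x - sgn y) = (x - y) + (norm y - norm x) *\<^sub>R sgn y"
    using False by (simp add: sgn_div_norm algebra_simps)
  then have "norm x * norm (sgn x - sgn y) = norm ((x - y) + (norm y - norm x) *\<^sub>R sgn y)"
    by (metis abs_norm_cancel norm_scaleR)
  also have "\<dots> \<le> norm (x - y) + norm ((norm y - norm x) *\<^sub>R sgn y)"
    by (rule norm_triangle_ineq)
  also have "norm ((norm y - norm x) *\<^sub>R sgn y) = norm y - norm x"
    using False assms by (simp add: norm_sgn)
  also have "\<dots> \<le> norm (x - y)" by (metis norm_minus_commute norm_triangle_ineq2)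
  finally show ?thesis by simp
qed (use assms in auto)

text \<open>A segment between two points of the sphere at distance at most 1 has each of its points
  within 1/2 of an end point, hence stays in the shell 1/2 \<le> |x| \<le> 1. On this compact set
  the derivative of the extension is bounded and the mean value inequality applies. Points further
  apart are covered by the bound on \<open>X\<close> itself.\<close>

lemma sphere_C1_lipschitz:
  fixes X :: "'b::euclidean_space \<Rightarrow> 'c::real_normed_vector"
  assumes "Ck_on 1 (\<lambda>x. X (sgn x)) (- {0})"
  obtains L where "L \<ge> 0"
    "\<And>z w. z \<in> sphere 0 1 \<Longrightarrow> w \<in> sphere 0 1 \<Longrightarrow> norm (X z - X w) \<le> L * norm (z - w)"
    "\<And>z. z \<in> sphere 0 1 \<Longrightarrow> norm (X z) \<le> L"
proof -
  define D where "D x = frechet_derivative (\<lambda>x. X (sgn x)) (at x)" for x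
  have der: "((\<lambda>x. X (sgn x)) has_derivative D x) (at x)" if "x \<noteq> 0" for x
    using assms that by (auto simp: D_def frechet_derivative_works)
  have cD: "continuous_on (- {0}) (\<lambda>x. D x h)" for h
    using assms by (simp add: D_def)
  have cX: "continuous_on (- {0}) (\<lambda>x. X (sgn x))"
    using Ck_on_Suc_imp[of 0 "\<lambda>x. X (sgn x)"] assms by simp
  define K where "K = cball (0::'b) 1 - ball 0 (1/2)"
  have K: "compact K" "K \<subseteq> - {0}" unfolding K_def by (auto intro: compact_diff)
  have "continuous_on K (\<lambda>x. \<Sum>b\<in>Basis. norm (D x b))"
    by (intro continuous_intros continuous_on_subset[OF cD K(2)])
  from continuous_on_compact_bound[OF K(1) this]
  obtain B where "\<And>x. x \<in> K \<Longrightarrow> norm (\<Sum>b\<in>Basis. norm (D x b)) \<le> B" by blast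
  then have B: "(\<Sum>b\<in>Basis. norm (D x b)) \<le> B" if "x \<in> K" for x
    using that abs_ge_self order_trans by fastforce
  from continuous_on_compact_bound[OF K(1) continuous_on_subset[OF cX K(2)]]
  obtain M where M: "\<And>x. x \<in> K \<Longrightarrow> norm (X (sgn x)) \<le> M" by blast
  have SK: "sphere 0 1 \<subseteq> K" unfolding K_def by auto
  have MS: "norm (X z) \<le> M" if "z \<in> sphere 0 1" for z
    using M[of z] SK that by (auto simp: sgn_div_norm)
  have on: "onorm (D x) \<le> B" if "x \<in> K" for x
  proof (rule onorm_le)
    fix h
    interpret D: bounded_linear "D x"
      using der[of x] K(2) that has_derivative_bounded_linear by blast
    have "norm (D x h) = norm (\<Sum>b\<in>Basis. (h \<bullet> b) *\<^sub>R D x b)"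
      by (subst euclidean_representation[of h, symmetric]) (simp only: D.sum D.scaleR)
    also have "\<dots> \<le> (\<Sum>b\<in>Basis. norm h * norm (D x b))"
      by (intro sum_norm_le) (simp add: mult_right_mono Basis_le_norm)
    also have "\<dots> \<le> B * norm h"
      using B[OF that] by (simp add: sum_distrib_left[symmetric] mult.commute[of B] mult_left_mono)
    finally show "norm (D x h) \<le> B * norm h" .
  qed
  \<comment> \<open>\<open>B\<close> serves close pairs. \<open>2 * M\<close> bounds every
    difference of values, hence serves pairs at distance more than 1.\<close>
  define L where "L = max 0 (max B (2 * M))"
  show ?thesis
  proof (rule that[of L])
    show "L \<ge> 0" by (simp add: L_def)
    fix z w :: 'b assume z: "z \<in> sphere 0 1" and w: "w \<in> sphere 0 1"
    show "norm (X z) \<le> L" using MS[OF z] norm_ge_zero[of "X z"] unfolding L_def by linarith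
    show "norm (X z - X w) \<le> L * norm (z - w)"
    proof (cases "norm (z - w) \<le> 1")
      case True
      have seg: "closed_segment z w \<subseteq> K"
      proof
        fix x assume x: "x \<in> closed_segment z w"
        have "norm (x - z) \<le> 1/2 \<or> norm (x - w) \<le> 1/2"
        proof -
          obtain t where t: "0 \<le> t" "t \<le> 1" "x = (1 - t) *\<^sub>R z + t *\<^sub>R w"
            using x by (auto simp: closed_segment_def)
          have "x - z = t *\<^sub>R (w - z)" "x - w = (1 - t) *\<^sub>R (z - w)"
            using t(3) by (simp_all add: algebra_simps)
          then have "norm (x - z) = t * norm (z - w)" "norm (x - w) = (1 - t) * norm (z - w)"
            using t by (simp_all add: norm_minus_commute)
          moreover have "t * norm (z - w) \<le> t" "(1 - t) * norm (z - w) \<le> 1 - t"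
            using True t mult_left_le[of "norm (z - w)" t] mult_left_le[of "norm (z - w)" "1 - t"]
            by auto
          ultimately show ?thesis by linarith
        qed
        then have "norm x \<ge> 1/2"
          using z w norm_triangle_ineq3[of x z] norm_triangle_ineq3[of x w] by auto
        moreover have "norm x \<le> 1"
          using closed_segment_subset[OF _ _ convex_cball, of z 0 1 w] x z w by auto
        ultimately show "x \<in> K" by (simp add: K_def)
      qed
      have "norm (X (sgn z) - X (sgn w)) \<le> B * norm (z - w)"
      proof (rule differentiable_bound[where f = "\<lambda>x. X (sgn x)" and S = "closed_segment z w"])
        show "((\<lambda>x. X (sgn x)) has_derivative D x) (at x within closed_segment z w)"
          if "x \<in> closed_segment z w" for x
        proof (rule has_derivative_at_withinI[OF der])
          show "x \<noteq> 0" using subsetD[OF seg that] K(2) by blast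
        qed
        show "onorm (D x) \<le> B" if "x \<in> closed_segment z w" for x
          by (rule on[OF subsetD[OF seg that]])
      qed simp_all
      also have "\<dots> \<le> L * norm (z - w)" unfolding L_def by (intro mult_right_mono) auto
      finally show ?thesis using z w by (simp add: sgn_div_norm)
    next
      case False
      have "norm (X z - X w) \<le> 2 * M"
        using norm_triangle_ineq4[of "X z" "X w"] MS[OF z] MS[OF w] by linarith
      also have "\<dots> \<le> L * 1" by (simp add: L_def)
      also have "\<dots> \<le> L * norm (z - w)" using False by (intro mult_left_mono) (auto simp: L_def)
      finally show ?thesis .
    qed
  qed
qed

text \<open>The condition \<open>p 0 = 0\<close> gives |p(r)| \<le> P r, which tames the jump of
  \<open>X (sgn x)\<close> at the origin. With |x| \<le> |y|, the difference is p(|x|) (X(sgn x) -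
  X(sgn y)) plus (p(|x|) - p(|y|)) X(sgn y); the former contributes 2 to the constant 3, by the
  weighted estimate for \<open>sgn\<close>, and the latter 1.\<close>

lemma radial_lipschitz:
  fixes X :: "'b::euclidean_space \<Rightarrow> 'c::real_normed_vector" and p :: "real \<Rightarrow> real"
  assumes L: "L \<ge> 0"
    "\<And>z w. z \<in> sphere 0 1 \<Longrightarrow> w \<in> sphere 0 1 \<Longrightarrow> norm (X z - X w) \<le> L * norm (z - w)"
    "\<And>z. z \<in> sphere 0 1 \<Longrightarrow> norm (X z) \<le> L"
    and p: "p 0 = 0" "P \<ge> 0" "\<And>r s. 0 \<le> r \<Longrightarrow> 0 \<le> s \<Longrightarrow> \<bar>p r - p s\<bar> \<le> P * \<bar>r - s\<bar>"
  shows "norm (p (norm x) *\<^sub>R X (sgn x) - p (norm y) *\<^sub>R X (sgn y)) \<le> 3 * P * L * norm (x - y)"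
proof -
  have *: "norm (p (norm x) *\<^sub>R X (sgn x) - p (norm y) *\<^sub>R X (sgn y)) \<le> 3 * P * L * norm (x - y)"
    if "norm x \<le> norm y" for x y :: 'b
  proof (cases "y = 0")
    case False
    have sy: "sgn y \<in> sphere 0 1" using False by (simp add: norm_sgn)
    have 1: "norm (p (norm x) *\<^sub>R (X (sgn x) - X (sgn y))) \<le> 2 * P * L * norm (x - y)"
    proof (cases "x = 0")
      case True
      then show ?thesis using p L by simp
    next
      case False
      then have sx: "sgn x \<in> sphere 0 1" by (simp add: norm_sgn)
      have "norm (p (norm x) *\<^sub>R (X (sgn x) - X (sgn y))) =
          \<bar>p (norm x)\<bar> * norm (X (sgn x) - X (sgn y))" by simp
      also have "\<dots> \<le> (P * norm x) * (L * norm (sgn x - sgn y))"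
        using p(3)[of "norm x" 0] p(1,2) L(2)[OF sx sy] by (intro mult_mono) auto
      also have "\<dots> = P * L * (norm x * norm (sgn x - sgn y))" by simp
      also have "\<dots> \<le> P * L * (2 * norm (x - y))"
        using p(2) L(1) norm_sgn_diff_le[OF that] by (intro mult_left_mono) auto
      finally show ?thesis by (simp add: mult_ac)
    qed
    have "norm ((p (norm x) - p (norm y)) *\<^sub>R X (sgn y)) \<le> (P * \<bar>norm x - norm y\<bar>) * L"
      using p(3)[of "norm x" "norm y"] p(2) L(3)[OF sy] by (simp del: real_norm_def, intro mult_mono) auto
    also have "\<dots> \<le> (P * norm (x - y)) * L"
      using p(2) L(1) norm_triangle_ineq3[of x y] by (intro mult_right_mono mult_left_mono) auto
    finally have 2: "norm ((p (norm x) - p (norm y)) *\<^sub>R X (sgn y)) \<le> P * L * norm (x - y)"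
      by (simp add: mult_ac)
    have "p (norm x) *\<^sub>R X (sgn x) - p (norm y) *\<^sub>R X (sgn y) =
      p (norm x) *\<^sub>R (X (sgn x) - X (sgn y)) + (p (norm x) - p (norm y)) *\<^sub>R X (sgn y)"
      by (simp add: algebra_simps)
    then show ?thesis using norm_triangle_mono[OF 1 2] by (simp add: mult_ac)
  qed (use that in auto)
  show ?thesis
    using *[of x y] *[of y x] by (cases "norm x \<le> norm y") (auto simp: norm_minus_commute)
qed

text \<open>
  \<open>ramp n r / r\<close> is a Lipschitz approximation of the indicator function of \<open>r \<le> 1\<close>. For a tangential field
  \<open>X\<close> the derivative of the cutoff does not contribute to the divergence of \<open>ramp n |x| X(x/|x|)\<close>.
\<close>
definition ramp :: "nat \<Rightarrow> real \<Rightarrow> real" where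
  "ramp n r = max 0 (min r (1 + real (Suc n) * (1 - r)))"

lemma ramp_lipschitz: "\<bar>ramp n r - ramp n s\<bar> \<le> real (Suc n) * \<bar>r - s\<bar>"
proof -
  have "\<bar>(1 + real (Suc n) * (1 - r)) - (1 + real (Suc n) * (1 - s))\<bar> = real (Suc n) * \<bar>r - s\<bar>"
  proof -
    have "(1 + real (Suc n) * (1 - r)) - (1 + real (Suc n) * (1 - s)) = real (Suc n) * (s - r)"
      by (simp add: algebra_simps)
    then show ?thesis by (simp only: abs_mult abs_of_nat abs_minus_commute)
  qed
  moreover have "\<bar>r - s\<bar> \<le> real (Suc n) * \<bar>r - s\<bar>"
    by (simp add: distrib_right)
  ultimately show ?thesis unfolding ramp_def by linarith
qed

lemma ramp_le: "r \<ge> 0 \<Longrightarrow> 0 \<le> ramp n r \<and> ramp n r \<le> r"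
  unfolding ramp_def by auto

lemma ramp_eq:
  assumes "0 \<le> r" "r \<le> 1"
  shows "ramp n r = r"
proof -
  have "0 \<le> real (Suc n) * (1 - r)" using assms by simp
  then have "min r (1 + real (Suc n) * (1 - r)) = r" using assms(2) by (intro min_absorb1) linarith
  then show ?thesis using assms(1) by (simp only: ramp_def max_absorb2)
qed

lemma ramp_eq_0: "r \<ge> 1 + 1 / real (Suc n) \<Longrightarrow> ramp n r = 0"
  unfolding ramp_def by (auto simp: field_simps)

text \<open>The excluded radii are the origin and the two kinks. The spheres with these radii are
  null sets, so the extended field is differentiable almost everywhere.\<close>

lemma ramp_differentiable:
  assumes "r > 0" "r \<noteq> 1" "r \<noteq> 1 + 1 / real (Suc n)"
  shows "\<exists>D. (ramp n has_real_derivative D) (at r)"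
proof -
  let ?l = "\<lambda>r. 1 + real (Suc n) * (1 - r)"
  consider "r < 1" | "1 < r" "r < 1 + 1 / real (Suc n)" | "r > 1 + 1 / real (Suc n)"
    using assms by linarith
  then show ?thesis
  proof cases
    case 1
    have "(ramp n has_real_derivative 1) (at r)"
      by (rule has_field_derivative_transform_within_open[where f = "\<lambda>r. r" and S = "{0<..<1}"])
        (use 1 assms ramp_eq in auto)
    then show ?thesis by blast
  next
    case 2
    have "(?l has_real_derivative - real (Suc n)) (at r)"
      by (auto intro!: derivative_eq_intros)
    then have "(ramp n has_real_derivative - real (Suc n)) (at r)"
    proof (rule has_field_derivative_transform_within_open[where S = "{1<..<1 + 1 / real (Suc n)}"])
      fix s assume s: "s \<in> {1<..<1 + 1 / real (Suc n)}"
      have "0 \<le> ?l s" using s by (simp add: field_simps)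
      moreover have "?l s \<le> s"
        using s mult_nonneg_nonpos[of "real (Suc n)" "1 - s"] by auto
      ultimately show "?l s = ramp n s" unfolding ramp_def by simp
    qed (use 2 in auto)
    then show ?thesis by blast
  next
    case 3
    have "(ramp n has_real_derivative 0) (at r)"
      by (rule has_field_derivative_transform_within_open[where f = "\<lambda>r. 0" and S = "{1 + 1 / real (Suc n)<..}"])
        (use 3 ramp_eq_0 in auto)
    then show ?thesis by blast
  qed
qed

text \<open>The extension is homogeneous of degree 0, so its derivative at \<open>x\<close> is the
  one at \<open>sgn x\<close> divided by |x|.\<close>

lemma sphere_deriv_scale:
  fixes X :: "'b::euclidean_space \<Rightarrow> 'c::real_normed_vector"
  assumes "x \<noteq> 0" "(\<lambda>x. X (sgn x)) differentiable at (sgn x)"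
  shows "((\<lambda>x. X (sgn x)) has_derivative (\<lambda>h. sphere_deriv X (sgn x) (h /\<^sub>R norm x))) (at x)"
proof -
  let ?c = "inverse (norm x)"
  have "((\<lambda>y. y /\<^sub>R norm x) has_derivative (\<lambda>h. h /\<^sub>R norm x)) (at x)"
    by (auto intro!: derivative_eq_intros)
  moreover have "((\<lambda>x. X (sgn x)) has_derivative sphere_deriv X (sgn x)) (at (x /\<^sub>R norm x))"
    using assms(2) by (simp add: sphere_deriv_def frechet_derivative_works sgn_div_norm)
  ultimately have "((\<lambda>y. X (sgn (y /\<^sub>R norm x))) has_derivative
      (\<lambda>h. sphere_deriv X (sgn x) (h /\<^sub>R norm x))) (at x)"
    by (rule has_derivative_compose)
  moreover have "sgn (y /\<^sub>R norm x) = sgn y" for y :: 'b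
    using assms(1) by (simp add: sgn_scaleR)
  ultimately show ?thesis by simp
qed

theorem sphere_divergence:
  fixes X :: "'b::euclidean_space \<Rightarrow> 'b"
  assumes X: "Ck_on 1 (\<lambda>x. X (sgn x)) (- {0})"
    and tangent: "\<And>z. z \<in> sphere 0 1 \<Longrightarrow> X z \<bullet> z = 0"
  shows "integral\<^sup>L sphere_measure (sphere_div X) = 0"
proof -
  obtain L where L: "L \<ge> 0"
    "\<And>z w. z \<in> sphere 0 1 \<Longrightarrow> w \<in> sphere 0 1 \<Longrightarrow> norm (X z - X w) \<le> L * norm (z - w)"
    "\<And>z. z \<in> sphere 0 1 \<Longrightarrow> norm (X z) \<le> L"
    using sphere_C1_lipschitz[OF X] by blast
  have cdiv: "continuous_on (- {0}) (sphere_div X)"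
    unfolding sphere_div_def sphere_deriv_def using X by (auto intro!: continuous_intros)
  have "continuous_on (- {0}) (\<lambda>x. sphere_div X (sgn x))"
    by (rule continuous_on_compose2[OF cdiv]) (auto intro!: continuous_intros simp: sgn_div_norm)
  then have mdiv: "(\<lambda>x. indicator (- {0}) x * sphere_div X (sgn x)) \<in> borel_measurable borel"
    using borel_measurable_continuous_on_indicator[of "- {0}" "\<lambda>x. sphere_div X (sgn x)"] by simp
  have "continuous_on (sphere 0 1) (sphere_div X)"
    by (rule continuous_on_subset[OF cdiv]) auto
  from continuous_on_compact_bound[OF compact_sphere this]
  obtain B where B: "\<And>z. z \<in> sphere 0 1 \<Longrightarrow> \<bar>sphere_div X z\<bar> \<le> B"
    unfolding real_norm_def by blast
  have B': "\<bar>indicator (- {0}) x * sphere_div X (sgn x)\<bar> \<le> \<bar>B\<bar>" for x :: 'b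
    using B[of "sgn x"] by (cases "x = 0") (auto simp: norm_sgn)
  \<comment> \<open>The divergence of the cut-off field off the kinks; the factor 1/|x| comes from
    the homogeneity of degree 0. The indicator removes the origin, where \<open>sgn x\<close> leaves
    the sphere.\<close>
  define d where "d n x = ramp n (norm x) / norm x * (indicator (- {0}) x * sphere_div X (sgn x))"
    for n and x :: 'b
  have dm [measurable]: "d n \<in> borel_measurable borel" for n
    unfolding d_def ramp_def using mdiv by measurable
  have "integral\<^sup>L lborel (d n) = 0" for n
  proof (rule integral_divergence_eq_0[where R = 2 and L = "3 * real (Suc n) * L"
        and G = "\<lambda>x. ramp n (norm x) *\<^sub>R X (sgn x)"])
    show "norm (ramp n (norm x) *\<^sub>R X (sgn x) - ramp n (norm y) *\<^sub>R X (sgn y)) \<le>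
        3 * real (Suc n) * L * norm (x - y)" for x y
      by (rule radial_lipschitz) (use L ramp_lipschitz ramp_eq[of 0 n] in \<open>auto simp del: of_nat_Suc\<close>)
    show "ramp n (norm x) *\<^sub>R X (sgn x) = 0" if "norm x > 2" for x
    proof -
      have "1 / real (Suc n) \<le> 1" by (simp add: field_simps)
      then have "ramp n (norm x) = 0" using that by (intro ramp_eq_0) linarith
      then show ?thesis by simp
    qed
    show "AE x in lborel. \<exists>G'. ((\<lambda>x. ramp n (norm x) *\<^sub>R X (sgn x)) has_derivative G') (at x) \<and>
        (\<Sum>b\<in>Basis. G' b \<bullet> b) = d n x"
      using AE_norm_neq[of 0] AE_norm_neq[of 1] AE_norm_neq[of "1 + 1 / real (Suc n)"]
    proof eventually_elim
      case (elim x)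
      then have x: "x \<noteq> 0" by auto
      obtain D where D: "(ramp n has_real_derivative D) (at (norm x))"
        using ramp_differentiable[of "norm x" n] elim by auto
      have sx: "sgn x \<in> sphere 0 1" using x by (simp add: norm_sgn)
      then have "sgn x \<noteq> 0" by auto
      then have dX: "(\<lambda>x. X (sgn x)) differentiable at (sgn x)" using X by simp
      interpret sd: bounded_linear "sphere_deriv X (sgn x)"
        unfolding sphere_deriv_def
        using dX by (auto simp: frechet_derivative_works intro: has_derivative_bounded_linear)
      have "((\<lambda>x. ramp n (norm x)) has_derivative (\<lambda>h. D * (h \<bullet> sgn x))) (at x)"
        using has_derivative_compose[OF has_derivative_norm[OF x] D[unfolded has_field_derivative_def]]
        by simp
      from has_derivative_scaleR[OF this sphere_deriv_scale[OF x dX]]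
      have "((\<lambda>x. ramp n (norm x) *\<^sub>R X (sgn x)) has_derivative
        (\<lambda>h. ramp n (norm x) *\<^sub>R sphere_deriv X (sgn x) (h /\<^sub>R norm x)
           + (D * (h \<bullet> sgn x)) *\<^sub>R X (sgn x))) (at x)" .
      moreover have "(\<Sum>b\<in>Basis. (ramp n (norm x) *\<^sub>R sphere_deriv X (sgn x) (b /\<^sub>R norm x)
           + (D * (b \<bullet> sgn x)) *\<^sub>R X (sgn x)) \<bullet> b) = d n x"
      proof -
        have "(\<Sum>b\<in>Basis. (D * (b \<bullet> sgn x)) *\<^sub>R X (sgn x) \<bullet> b) = D * (X (sgn x) \<bullet> sgn x)"
          by (subst (2) euclidean_inner) (simp add: sum_distrib_left mult_ac inner_commute)
        also have "\<dots> = 0" using tangent[OF sx] by simp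
        finally show ?thesis
          using x by (simp add: inner_add_left sum.distrib d_def sphere_div_def sum_distrib_left
              sd.scaleR divide_inverse mult_ac)
      qed
      ultimately show ?case by blast
    qed
  qed simp
  \<comment> \<open>The quotient of \<open>ramp n r\<close> by \<open>r\<close> tends to the
    indicator of r \<le> 1. The limit is an integral over the solid ball, which by the cone
    definition of \<open>sphere_measure\<close> is the sphere integral divided by the ambient
    dimension.\<close>
  moreover have "(\<lambda>n. integral\<^sup>L lborel (d n)) \<longlonglongrightarrow>
      (LINT x|lborel. indicator (cball 0 1 - {0}) x * sphere_div X (sgn x))"
  proof (rule integral_dominated_convergence[where w = "\<lambda>x. \<bar>B\<bar> * indicator (cball 0 2) x"])
    have "(\<lambda>x. indicator (cball 0 1 - {0}) x * sphere_div X (sgn x)) =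
        (\<lambda>x. indicator (cball 0 1) x * (indicator (- {0}) x * sphere_div X (sgn x)))"
      by (auto simp: indicator_def fun_eq_iff)
    then show "(\<lambda>x. indicator (cball 0 1 - {0}) x * sphere_div X (sgn x)) \<in> borel_measurable lborel"
      using mdiv by (auto intro!: borel_measurable_times borel_measurable_indicator)
    show "integrable lborel (\<lambda>x::'b. \<bar>B\<bar> * indicator (cball 0 2) x)"
      using emeasure_bounded_finite[of "cball (0::'b) 2"] by auto
    show "AE x in lborel. norm (d n x) \<le> \<bar>B\<bar> * indicator (cball 0 2) x" for n
    proof (rule AE_I2)
      fix x :: 'b
      show "norm (d n x) \<le> \<bar>B\<bar> * indicator (cball 0 2) x"
      proof (cases "norm x \<le> 2")
        case True
        have "norm (d n x) = \<bar>ramp n (norm x) / norm x\<bar> * \<bar>indicator (- {0}) x * sphere_div X (sgn x)\<bar>"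
          unfolding d_def by (simp only: real_norm_def abs_mult)
        also have "\<dots> \<le> 1 * \<bar>B\<bar>"
          using ramp_le[of "norm x" n] B'[of x] by (intro mult_mono) (auto simp: divide_simps)
        finally show ?thesis using True by simp
      next
        case False
        have "1 / real (Suc n) \<le> 1" by (simp add: field_simps)
        then have "ramp n (norm x) = 0" using False by (intro ramp_eq_0) linarith
        then show ?thesis by (simp add: d_def)
      qed
    qed
    show "AE x in lborel. (\<lambda>n. d n x) \<longlonglongrightarrow> indicator (cball 0 1 - {0}) x * sphere_div X (sgn x)"
    proof (rule AE_I2)
      fix x :: 'b
      show "(\<lambda>n. d n x) \<longlonglongrightarrow> indicator (cball 0 1 - {0}) x * sphere_div X (sgn x)"
      proof (cases "norm x \<le> 1")
        case True
        then show ?thesis using ramp_eq[of "norm x"] by (simp add: d_def indicator_def)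
      next
        case False
        then have "eventually (\<lambda>n. inverse (real (Suc n)) < norm x - 1) sequentially"
          using order_tendstoD(2)[OF LIMSEQ_inverse_real_of_nat] by simp
        then have "eventually (\<lambda>n. d n x = 0) sequentially"
          by eventually_elim (use ramp_eq_0[of _ "norm x"] in \<open>auto simp: d_def inverse_eq_divide\<close>)
        then show ?thesis using False by (simp add: tendsto_eventually)
      qed
    qed
  qed (use dm in auto)
  ultimately have "(LINT x|lborel. indicator (cball 0 1 - {0}) x * sphere_div X (sgn x)) = 0"
    by (simp add: LIMSEQ_const_iff)
  then show ?thesis
    by (subst integral_sphere_measure) (auto intro: continuous_on_subset[OF cdiv])
qed

section \<open>Green's identity and zonal moments\<close>

lemma Ck_on_bounded_linear:
  assumes "open U" "bounded_linear T" "Ck_on k f U"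
  shows "Ck_on k (\<lambda>x. T (f x)) U"
  using assms(3)
proof (induction k arbitrary: f)
  case 0
  then show ?case using bounded_linear.continuous_on[OF assms(2)] by simp
next
  case (Suc k)
  show ?case
  proof (rule Ck_on_SucI[OF assms(1)])
    show "((\<lambda>x. T (f x)) has_derivative (\<lambda>h. T (frechet_derivative f (at x) h))) (at x)"
      if "x \<in> U" for x
      using bounded_linear.has_derivative[OF assms(2) Ck_on_Suc_has_derivative[OF Suc.prems that]] .
    show "Ck_on k (\<lambda>x. T (frechet_derivative f (at x) h)) U" for h
      using Suc.prems by (intro Suc.IH) simp
  qed
qed

lemma Ck_on_componentwise:
  fixes f :: "'b::euclidean_space \<Rightarrow> 'c::euclidean_space"
  assumes "open U" "\<And>b. b \<in> Basis \<Longrightarrow> Ck_on k (\<lambda>x. f x \<bullet> b) U"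
  shows "Ck_on k f U"
proof -
  have "Ck_on k (\<lambda>x. \<Sum>b\<in>Basis. (f x \<bullet> b) *\<^sub>R b) U"
    by (intro Ck_on_sum Ck_on_bounded_linear[where T = "\<lambda>c. c *\<^sub>R _"] assms
        bounded_linear_scaleR_left)
  then show ?thesis by (simp add: euclidean_representation)
qed

section \<open>Rules for gradient and divergence on the sphere\<close>

lemma has_derivative_sphere_deriv:
  "(\<lambda>x. f (sgn x)) differentiable at z \<Longrightarrow> ((\<lambda>x. f (sgn x)) has_derivative sphere_deriv f z) (at z)"
  by (simp add: sphere_deriv_def frechet_derivative_works)

lemma sphere_derivI:
  "((\<lambda>x. f (sgn x)) has_derivative f') (at z) \<Longrightarrow> sphere_deriv f z = f'"
  unfolding sphere_deriv_def by (rule frechet_derivative_at[symmetric])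

lemma has_derivative_sgn_sphere:
  fixes z :: "'b::euclidean_space"
  assumes "z \<in> sphere 0 1"
  shows "(sgn has_derivative (\<lambda>h. h - (z \<bullet> h) *\<^sub>R z)) (at z)"
proof -
  have z: "z \<noteq> 0" "norm z = 1" using assms by auto
  have "((\<lambda>x. inverse (norm x) *\<^sub>R x) has_derivative
      (\<lambda>h. inverse (norm z) *\<^sub>R h + (- (h \<bullet> z) * inverse (norm z) ^ 3) *\<^sub>R z)) (at z)"
    by (rule has_derivative_scaleR[OF has_derivative_inverse_norm[OF z(1)] has_derivative_ident])
  then show ?thesis by (simp add: sgn_div_norm[abs_def] z(2) inner_commute)
qed

lemma sgn_sgn_vector: "sgn (sgn x) = sgn (x :: 'b::real_normed_vector)"
  by (cases "x = 0") (simp_all add: sgn_div_norm)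

text \<open>Since \<open>sgn\<close> is idempotent, one more \<open>sgn\<close> inside changes
  nothing, and its derivative at a point of the sphere is the orthogonal projection onto the tangent
  space. In particular the derivative in the direction \<open>z\<close> vanishes, so gradients are
  tangential.\<close>

lemma sphere_deriv_tangential:
  assumes "z \<in> sphere 0 1" "(\<lambda>x. f (sgn x)) differentiable at z"
  shows "sphere_deriv f z h = sphere_deriv f z (h - (z \<bullet> h) *\<^sub>R z)"
proof -
  have [simp]: "sgn z = z" using assms(1) by (simp add: sgn_div_norm)
  have "((\<lambda>x. f (sgn (sgn x))) has_derivative (\<lambda>h. sphere_deriv f z (h - (z \<bullet> h) *\<^sub>R z))) (at z)"
    by (rule has_derivative_compose[OF has_derivative_sgn_sphere[OF assms(1)], where g = "\<lambda>x. f (sgn x)"])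
      (use has_derivative_sphere_deriv[OF assms(2)] in simp)
  then have "sphere_deriv f z = (\<lambda>h. sphere_deriv f z (h - (z \<bullet> h) *\<^sub>R z))"
    unfolding sgn_sgn_vector by (rule sphere_derivI)
  then show ?thesis by metis
qed

lemma sphere_grad_inner:
  fixes u :: "'b::euclidean_space \<Rightarrow> real"
  assumes "(\<lambda>x. u (sgn x)) differentiable at z"
  shows "sphere_grad u z \<bullet> h = sphere_deriv u z h"
proof -
  interpret bounded_linear "sphere_deriv u z"
    using has_derivative_sphere_deriv[OF assms] by (rule has_derivative_bounded_linear)
  have "sphere_deriv u z h = sphere_deriv u z (\<Sum>b\<in>Basis. (h \<bullet> b) *\<^sub>R b)"
    by (simp add: euclidean_representation)
  also have "\<dots> = (\<Sum>b\<in>Basis. (h \<bullet> b) * sphere_deriv u z b)"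
    by (simp only: sum scaleR real_scaleR_def)
  finally show ?thesis
    by (simp add: sphere_grad_def inner_sum_left inner_commute[of h] mult.commute)
qed

lemma sphere_grad_tangential:
  fixes u :: "'b::euclidean_space \<Rightarrow> real"
  assumes "z \<in> sphere 0 1" "(\<lambda>x. u (sgn x)) differentiable at z"
  shows "sphere_grad u z \<bullet> z = 0"
proof -
  interpret bounded_linear "sphere_deriv u z"
    using has_derivative_sphere_deriv[OF assms(2)] by (rule has_derivative_bounded_linear)
  show ?thesis
    using sphere_deriv_tangential[OF assms, of z] assms(1)
    by (simp add: sphere_grad_inner[OF assms(2)] norm_eq_1 zero)
qed

lemma sphere_deriv_mult:
  fixes f g :: "'b::euclidean_space \<Rightarrow> real"
  assumes "z \<in> sphere 0 1" "(\<lambda>x. f (sgn x)) differentiable at z" "(\<lambda>x. g (sgn x)) differentiable at z"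
  shows "sphere_deriv (\<lambda>x. f x * g x) z h = f z * sphere_deriv g z h + sphere_deriv f z h * g z"
proof -
  have [simp]: "sgn z = z" using assms(1) by (simp add: sgn_div_norm)
  show ?thesis
    using sphere_derivI[of "\<lambda>x. f x * g x", OF has_derivative_mult[OF
          has_derivative_sphere_deriv[OF assms(2)] has_derivative_sphere_deriv[OF assms(3)]]] by simp
qed

lemma sphere_div_scaleR:
  fixes a :: "'b::euclidean_space \<Rightarrow> real" and V :: "'b \<Rightarrow> 'b"
  assumes "z \<in> sphere 0 1" "(\<lambda>x. a (sgn x)) differentiable at z" "(\<lambda>x. V (sgn x)) differentiable at z"
  shows "sphere_div (\<lambda>x. a x *\<^sub>R V x) z = sphere_deriv a z (V z) + a z * sphere_div V z"
proof -
  have [simp]: "sgn z = z" using assms(1) by (simp add: sgn_div_norm)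
  have "sphere_deriv (\<lambda>x. a x *\<^sub>R V x) z =
      (\<lambda>h. a z *\<^sub>R sphere_deriv V z h + sphere_deriv a z h *\<^sub>R V z)"
    using sphere_derivI[of "\<lambda>x. a x *\<^sub>R V x", OF has_derivative_scaleR[OF
          has_derivative_sphere_deriv[OF assms(2)] has_derivative_sphere_deriv[OF assms(3)]]] by simp
  then have "sphere_div (\<lambda>x. a x *\<^sub>R V x) z =
      a z * sphere_div V z + (\<Sum>b\<in>Basis. sphere_deriv a z b * (V z \<bullet> b))"
    by (simp add: sphere_div_def inner_add_left sum.distrib sum_distrib_left)
  also have "(\<Sum>b\<in>Basis. sphere_deriv a z b * (V z \<bullet> b)) = sphere_grad a z \<bullet> V z"
    by (simp add: sphere_grad_def inner_sum_left inner_commute[of "V z"])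
  also have "\<dots> = sphere_deriv a z (V z)" by (rule sphere_grad_inner[OF assms(2)])
  finally show ?thesis by simp
qed

lemma sphere_div_diff:
  fixes V W :: "'b::euclidean_space \<Rightarrow> 'b"
  assumes "(\<lambda>x. V (sgn x)) differentiable at z" "(\<lambda>x. W (sgn x)) differentiable at z"
  shows "sphere_div (\<lambda>x. V x - W x) z = sphere_div V z - sphere_div W z"
  using sphere_derivI[of "\<lambda>x. V x - W x", OF has_derivative_diff[OF
        has_derivative_sphere_deriv[OF assms(1)] has_derivative_sphere_deriv[OF assms(2)]]]
  by (simp add: sphere_div_def inner_diff_left sum_subtractf)

lemma has_derivative_inner_sgn:
  fixes e z :: "'b::euclidean_space"
  assumes "z \<in> sphere 0 1"
  shows "((\<lambda>x. e \<bullet> sgn x) has_derivative (\<lambda>h. (e - (e \<bullet> z) *\<^sub>R z) \<bullet> h)) (at z)"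
  by (rule derivative_eq_intros has_derivative_sgn_sphere[OF assms])+
    (auto simp: inner_diff_left inner_diff_right inner_commute mult.commute fun_eq_iff)

text \<open>The field is the gradient of the linear function given by \<open>e\<close>, so this is
  its Laplacian: linear functions are harmonics of degree 1 with eigenvalue
  \<open>DIM('b) - 1\<close>, the dimension of the sphere.\<close>

lemma sphere_div_projection:
  fixes e z :: "'b::euclidean_space"
  assumes z: "z \<in> sphere 0 1"
  shows "sphere_div (\<lambda>x. e - (e \<bullet> x) *\<^sub>R x) z = - (e \<bullet> z) * (real DIM('b) - 1)"
proof -
  let ?w = "e - (e \<bullet> z) *\<^sub>R z"
  have [simp]: "sgn z = z" using z by (simp add: sgn_div_norm)
  have zz: "z \<bullet> z = 1" using z by (simp add: norm_eq_1)
  have "sphere_deriv (\<lambda>x. e - (e \<bullet> x) *\<^sub>R x) z =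
      (\<lambda>h. 0 - ((e \<bullet> z) *\<^sub>R (h - (z \<bullet> h) *\<^sub>R z) + (?w \<bullet> h) *\<^sub>R z))"
    using sphere_derivI[of "\<lambda>x. e - (e \<bullet> x) *\<^sub>R x", OF has_derivative_diff[OF has_derivative_const
          has_derivative_scaleR[OF has_derivative_inner_sgn[OF z] has_derivative_sgn_sphere[OF z]]]]
    by simp
  then have "sphere_div (\<lambda>x. e - (e \<bullet> x) *\<^sub>R x) z =
      - (\<Sum>b\<in>Basis. (e \<bullet> z) * (b \<bullet> b) - (e \<bullet> z) * ((z \<bullet> b) * (z \<bullet> b)) + (?w \<bullet> b) * (z \<bullet> b))"
    unfolding sphere_div_def sum_negf[symmetric]
    by (intro sum.cong) (auto simp: inner_diff_left inner_add_left algebra_simps)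
  also have "\<dots> = - ((e \<bullet> z) * real DIM('b) - (e \<bullet> z) * (z \<bullet> z) + ?w \<bullet> z)"
    unfolding euclidean_inner[of z z] euclidean_inner[of ?w z]
    by (simp add: sum.distrib sum_subtractf sum_distrib_left)
  also have "\<dots> = - (e \<bullet> z) * (real DIM('b) - 1)"
    using zz by (simp add: inner_diff_left algebra_simps)
  finally show ?thesis .
qed

section \<open>Moments against powers of the zonal function\<close>

definition zonal :: "'b::euclidean_space \<Rightarrow> 'b \<Rightarrow> real" where
  "zonal e x = (1 + e \<bullet> x) / 2"

lemma has_derivative_zonal_power:
  fixes e z :: "'b::euclidean_space"
  assumes "z \<in> sphere 0 1"
  shows "((\<lambda>x. zonal e (sgn x) ^ k) has_derivative
    (\<lambda>h. real k * zonal e z ^ (k - 1) * ((e - (e \<bullet> z) *\<^sub>R z) \<bullet> h) / 2)) (at z)"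
proof -
  have [simp]: "sgn z = z" using assms by (simp add: sgn_div_norm)
  have "((\<lambda>x. zonal e (sgn x)) has_derivative (\<lambda>h. ((e - (e \<bullet> z) *\<^sub>R z) \<bullet> h) / 2)) (at z)"
    using has_derivative_mult_right[OF has_derivative_add[OF has_derivative_const[of 1]
          has_derivative_inner_sgn[OF assms, of e]], of "1/2"]
    by (simp add: zonal_def)
  from has_derivative_power[OF this, of k] show ?thesis by (simp add: mult_ac)
qed

text \<open>
  For \<open>f = (zonal e)\<^sup>k\<^sup>+\<^sup>1\<close> this is the field \<open>u \<nabla>f - f \<nabla>u\<close> of Green's second identity.
\<close>
definition green_field :: "('b::euclidean_space \<Rightarrow> real) \<Rightarrow> 'b \<Rightarrow> nat \<Rightarrow> 'b \<Rightarrow> 'b" where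
  "green_field u e k x = (u x * (real (Suc k) / 2 * zonal e x ^ k)) *\<^sub>R (e - (e \<bullet> x) *\<^sub>R x)
     - zonal e x ^ Suc k *\<^sub>R sphere_grad u x"

lemma Ck_on_sphere_grad:
  fixes u :: "'b::euclidean_space \<Rightarrow> real"
  assumes "smooth_on_sphere u"
  shows "Ck_on k (\<lambda>x. sphere_grad u (sgn x)) (- {0})"
proof (rule Ck_on_componentwise)
  fix b :: 'b assume b: "b \<in> Basis"
  have "Ck_on k (\<lambda>x. frechet_derivative (\<lambda>x. u (sgn x)) (at x) b) (- {0})"
    using smooth_on_sphere_compose_sgn[OF assms, of "Suc k"] by simp
  then have "Ck_on k (\<lambda>x. sphere_deriv u (sgn x) b) (- {0})"
    unfolding sphere_deriv_def by (rule Ck_on_compose_sgn[rotated]) auto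
  then show "Ck_on k (\<lambda>x. sphere_grad u (sgn x) \<bullet> b) (- {0})"
    using b by (simp add: sphere_grad_def)
qed auto

lemma Ck_on_zonal_power:
  fixes e :: "'b::euclidean_space"
  shows "Ck_on k (\<lambda>x. zonal e (sgn x) ^ j) (- {0})"
proof -
  have "Ck_on k (\<lambda>x. (1/2 + 1/2 * (sgn x \<bullet> e)) ^ j) (- {0})"
    by (intro Ck_on_power Ck_on_add Ck_on_mult Ck_on_const Ck_on_sgn) auto
  then show ?thesis by (simp add: zonal_def add_divide_distrib inner_commute)
qed

lemma Ck_on_projection:
  fixes e :: "'b::euclidean_space"
  shows "Ck_on k (\<lambda>x. e - (e \<bullet> sgn x) *\<^sub>R sgn x) (- {0})"
proof (rule Ck_on_componentwise)
  fix b :: 'b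
  have "Ck_on k (\<lambda>x. e \<bullet> b - (sgn x \<bullet> e) * (sgn x \<bullet> b)) (- {0})"
    by (intro Ck_on_diff Ck_on_mult Ck_on_const Ck_on_sgn) auto
  then show "Ck_on k (\<lambda>x. (e - (e \<bullet> sgn x) *\<^sub>R sgn x) \<bullet> b) (- {0})"
    by (simp add: inner_diff_left inner_diff_right inner_commute)
qed auto

lemma Ck_on_scaleR:
  fixes a :: "'b::euclidean_space \<Rightarrow> real" and V :: "'b \<Rightarrow> 'c::euclidean_space"
  assumes "open U" "Ck_on k a U" "Ck_on k V U"
  shows "Ck_on k (\<lambda>x. a x *\<^sub>R V x) U"
proof (rule Ck_on_componentwise[OF assms(1)])
  fix b :: 'c
  have "Ck_on k (\<lambda>x. V x \<bullet> b) U"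
    by (rule Ck_on_bounded_linear[OF assms(1) bounded_linear_inner_left assms(3)])
  then show "Ck_on k (\<lambda>x. (a x *\<^sub>R V x) \<bullet> b) U"
    using Ck_on_mult[OF assms(1,2)] by simp
qed

lemma Ck_on_green_field:
  fixes u :: "'b::euclidean_space \<Rightarrow> real"
  assumes "smooth_on_sphere u"
  shows "Ck_on j (\<lambda>x. green_field u e k (sgn x)) (- {0})"
proof -
  have *: "open (- {0::'b})" by auto
  have "Ck_on j (\<lambda>x. (u (sgn x) * (real (Suc k) / 2 * zonal e (sgn x) ^ k)) *\<^sub>R (e - (e \<bullet> sgn x) *\<^sub>R sgn x)
     + (- (zonal e (sgn x) ^ Suc k)) *\<^sub>R sphere_grad u (sgn x)) (- {0})"
    by (intro Ck_on_add Ck_on_scaleR Ck_on_mult Ck_on_uminus Ck_on_const Ck_on_zonal_power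
        Ck_on_projection Ck_on_sphere_grad smooth_on_sphere_compose_sgn assms *)
  then show ?thesis by (simp add: green_field_def)
qed

lemma Ck_on_1_differentiable: "Ck_on 1 f U \<Longrightarrow> x \<in> U \<Longrightarrow> f differentiable at x"
  by simp

text \<open>The product rule produces the inner product of grad u and grad f twice, for f the power
  \<open>Suc k\<close> of \<open>zonal e\<close>, with opposite signs. What remains is u times the
  Laplacian of f minus f times the Laplacian of u.\<close>

lemma sphere_div_green_field:
  fixes u :: "'b::euclidean_space \<Rightarrow> real"
  assumes u: "smooth_on_sphere u" and e: "norm e = 1" and z: "z \<in> sphere 0 1"
  shows "sphere_div (green_field u e k) z =
    u z * (real (Suc k) * (real k + (real DIM('b) - 1) / 2) * zonal e z ^ k
      - real (Suc k) * (real k + real DIM('b) - 1) * zonal e z ^ Suc k)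
    - zonal e z ^ Suc k * laplace_beltrami u z"
proof -
  let ?w = "e - (e \<bullet> z) *\<^sub>R z" and ?t = "zonal e z" and ?c = "real (Suc k) / 2"
  have z0: "z \<in> - {0}" using z by auto
  note d = Ck_on_1_differentiable[OF _ z0]
  have du: "(\<lambda>x. u (sgn x)) differentiable at z"
    using d[OF smooth_on_sphere_compose_sgn[OF u]] .
  have dz: "(\<lambda>x. zonal e (sgn x) ^ j) differentiable at z" for j
    using d[OF Ck_on_zonal_power] .
  have dcz: "(\<lambda>x. ?c * zonal e (sgn x) ^ k) differentiable at z"
    by (rule differentiable_mult[OF differentiable_const dz])
  have da: "(\<lambda>x. u (sgn x) * (?c * zonal e (sgn x) ^ k)) differentiable at z"
    using du dcz by (rule differentiable_mult)
  have dg: "(\<lambda>x. sphere_grad u (sgn x)) differentiable at z"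
    using d[OF Ck_on_sphere_grad[OF u]] .
  have dp: "(\<lambda>x. e - (e \<bullet> sgn x) *\<^sub>R sgn x) differentiable at z"
    using d[OF Ck_on_projection] .
  have sdz: "sphere_deriv (\<lambda>x. zonal e x ^ j) z h = real j * ?t ^ (j - 1) * (?w \<bullet> h) / 2" for j h
    using sphere_derivI[of "\<lambda>x. zonal e x ^ j", OF has_derivative_zonal_power[OF z]] by simp
  have sdcz: "sphere_deriv (\<lambda>x. ?c * zonal e x ^ k) z h = ?c * (real k * ?t ^ (k - 1) * (?w \<bullet> h) / 2)" for h
    using sphere_derivI[of "\<lambda>x. ?c * zonal e x ^ k",
        OF has_derivative_mult_right[OF has_derivative_zonal_power[OF z]]] by simp
  \<comment> \<open>The field \<open>?w\<close> is twice the gradient of \<open>zonal e\<close>.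
    That its squared length is a polynomial in \<open>zonal e\<close> is what closes the
    recursion.\<close>
  have ww: "?w \<bullet> ?w = 4 * ?t * (1 - ?t)"
    using e z by (simp add: zonal_def inner_diff_left inner_diff_right norm_eq_1 inner_commute
        field_simps power2_eq_square)
  have "sphere_div (green_field u e k) z =
      sphere_deriv (\<lambda>x. u x * (?c * zonal e x ^ k)) z ?w
      + u z * (?c * ?t ^ k) * (- (e \<bullet> z) * (real DIM('b) - 1))
      - (sphere_deriv (\<lambda>x. zonal e x ^ Suc k) z (sphere_grad u z) + ?t ^ Suc k * laplace_beltrami u z)"
    unfolding green_field_def[abs_def] laplace_beltrami_def
    by (subst sphere_div_diff)
      (use z da dp dz dg in \<open>simp_all add: sphere_div_scaleR sphere_div_projection differentiable_scaleR del: power_Suc\<close>)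
  also have "sphere_deriv (\<lambda>x. u x * (?c * zonal e x ^ k)) z ?w =
      u z * (?c * (real k * ?t ^ (k - 1) * (4 * ?t * (1 - ?t)) / 2)) + sphere_deriv u z ?w * (?c * ?t ^ k)"
    by (subst sphere_deriv_mult[OF z du dcz]) (simp only: sdcz ww)
  also have "sphere_deriv (\<lambda>x. zonal e x ^ Suc k) z (sphere_grad u z) =
      real (Suc k) * ?t ^ k * sphere_deriv u z ?w / 2"
    unfolding sdz by (simp add: inner_commute sphere_grad_inner[OF du])
  \<comment> \<open>For \<open>k = 0\<close> the exponent \<open>k - 1\<close> is truncated, but the
    factor \<open>real k\<close> makes both sides vanish.\<close>
  also have "real k * ?t ^ (k - 1) * (4 * ?t * (1 - ?t)) = 4 * real k * ?t ^ k * (1 - ?t)"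
    by (cases k) (simp_all add: algebra_simps)
  also have "e \<bullet> z = 2 * ?t - 1" by (simp add: zonal_def field_simps)
  finally show ?thesis by (simp add: field_simps)
qed

lemma integrable_zonal_moment:
  fixes u :: "'b::euclidean_space \<Rightarrow> real"
  assumes "continuous_on (sphere 0 1) u"
  shows "integrable sphere_measure (\<lambda>x. u x * zonal e x ^ k)"
  unfolding zonal_def by (intro integrable_sphere_continuous continuous_intros assms) auto

lemma smooth_on_sphere_continuous:
  assumes "smooth_on_sphere u"
  shows "continuous_on (sphere 0 1) u"
proof -
  from assms obtain V F where *: "sphere 0 1 \<subseteq> V" "\<And>k. Ck_on k F V"
    "\<And>z. z \<in> sphere 0 1 \<Longrightarrow> F z = u z"
    unfolding smooth_on_sphere_def by blast
  have "continuous_on V F" using *(2)[of 0] by simp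
  then have "continuous_on (sphere 0 1) F" using *(1) by (rule continuous_on_subset)
  then show ?thesis using *(3) by (rule continuous_on_eq)
qed

text \<open>After integration the divergence disappears and the eigenvalue equation replaces the
  Laplacian of \<open>u\<close>. The second identity is Green's identity with the constant 1; it
  supplies the start of the induction, since the first one only relates consecutive orders.\<close>

lemma zonal_moment_recursion:
  fixes u :: "'b::euclidean_space \<Rightarrow> real"
  assumes u: "smooth_on_sphere u" and e: "norm e = 1"
    and eig: "\<And>z. z \<in> sphere 0 1 \<Longrightarrow> - laplace_beltrami u z = \<mu> * u z"
  shows "(real (Suc k) * (real k + real DIM('b) - 1) - \<mu>) * (\<integral>x. u x * zonal e x ^ Suc k \<partial>sphere_measure) =
    real (Suc k) * (real k + (real DIM('b) - 1) / 2) * (\<integral>x. u x * zonal e x ^ k \<partial>sphere_measure)"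
    (is "?A * ?I = ?B * ?J")
    and "\<mu> * (\<integral>x. u x \<partial>sphere_measure) = 0"
proof -
  note int = integrable_zonal_moment[OF smooth_on_sphere_continuous[OF u], of e]
  have tang: "sphere_grad u z \<bullet> z = 0" if "z \<in> sphere 0 1" for z
    using that by (intro sphere_grad_tangential Ck_on_1_differentiable[OF smooth_on_sphere_compose_sgn[OF u]]) auto
  have "integral\<^sup>L sphere_measure (sphere_div (green_field u e k)) = 0"
    by (rule sphere_divergence[OF Ck_on_green_field[OF u]])
      (use tang in \<open>auto simp: green_field_def inner_diff_left norm_eq_1\<close>)
  also have "integral\<^sup>L sphere_measure (sphere_div (green_field u e k)) =
      (\<integral>x. ?B * (u x * zonal e x ^ k) - ?A * (u x * zonal e x ^ Suc k) \<partial>sphere_measure)"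
  proof (rule Bochner_Integration.integral_cong[OF refl])
    fix z :: 'b assume "z \<in> space sphere_measure"
    then have z: "z \<in> sphere 0 1" by simp
    have "laplace_beltrami u z = - \<mu> * u z" using eig[OF z] by simp
    then show "sphere_div (green_field u e k) z =
        ?B * (u z * zonal e z ^ k) - ?A * (u z * zonal e z ^ Suc k)"
      by (simp add: sphere_div_green_field[OF u e z] algebra_simps)
  qed
  also have "\<dots> = ?B * ?J - ?A * ?I"
    using int[of k] int[of "Suc k"]
    by (subst Bochner_Integration.integral_diff) (simp_all del: power_Suc)
  finally show "?A * ?I = ?B * ?J" by simp
  have "integral\<^sup>L sphere_measure (sphere_div (sphere_grad u)) = 0"
    by (rule sphere_divergence[OF Ck_on_sphere_grad[OF u] tang])
  also have "integral\<^sup>L sphere_measure (sphere_div (sphere_grad u)) = (\<integral>x. - \<mu> * u x \<partial>sphere_measure)"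
    by (rule Bochner_Integration.integral_cong[OF refl])
      (use eig in \<open>fastforce simp: laplace_beltrami_def\<close>)
  finally show "\<mu> * (\<integral>x. u x \<partial>sphere_measure) = 0" by simp
qed

section \<open>Riesz kernels and the eigenfunction property\<close>

lemma zonal_bounds:
  assumes "norm e = 1" "norm x = 1"
  shows "0 \<le> zonal e x" "zonal e x \<le> 1" "1 - zonal e x = (norm (e - x))\<^sup>2 / 4"
proof -
  have "\<bar>e \<bullet> x\<bar> \<le> 1" using Cauchy_Schwarz_ineq2[of e x] assms by simp
  then show "0 \<le> zonal e x" "zonal e x \<le> 1" by (auto simp: zonal_def)
  have "(norm (e - x))\<^sup>2 = 2 - 2 * (e \<bullet> x)"
    using assms by (simp add: power2_norm_eq_inner inner_diff_left inner_diff_right inner_commute norm_eq_1)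
  then show "1 - zonal e x = (norm (e - x))\<^sup>2 / 4" by (simp add: zonal_def field_simps)
qed

text \<open>
  In the recursion, the factor in front of the moment of order \<open>k + 1\<close> vanishes only for \<open>k + 1 = i\<close>. So the
  moments below \<open>i\<close> vanish and those above are universal multiples of the moment of order \<open>i\<close>.
\<close>
lemma zonal_moment_structure:
  fixes u :: "'b::euclidean_space \<Rightarrow> real"
  assumes u: "smooth_on_sphere u" and D: "DIM('b) \<ge> 2"
    and eig: "\<And>z. z \<in> sphere 0 1 \<Longrightarrow> - laplace_beltrami u z = real i * (real i + real DIM('b) - 2) * u z"
  obtains t where "\<And>e k. norm e = 1 \<Longrightarrow>
    (\<integral>x. u x * zonal e x ^ k \<partial>sphere_measure) = t k * (\<integral>x. u x * zonal e x ^ i \<partial>sphere_measure)"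
proof -
  define m where "m e k = (\<integral>x. u x * zonal e x ^ k \<partial>sphere_measure)" for e k
  \<comment> \<open>The eigenvalue of degree \<open>k\<close> on the unit sphere of the ambient
    space. It increases strictly from dimension 2 on, so the factor \<open>g (Suc k) - g i\<close>
    of the recursion has at most one zero.\<close>
  define g where "g k = real k * (real k + real DIM('b) - 2)" for k
  define B where "B k = real (Suc k) * (real k + (real DIM('b) - 1) / 2)" for k
  have g_less: "g j < g k" if "j < k" for j k
  proof -
    have "real j * (real j + real DIM('b) - 2) \<le> real j * (real k + real DIM('b) - 2)"
      using that D by (intro mult_left_mono) auto
    also have "\<dots> < real k * (real k + real DIM('b) - 2)"
      using that D by (intro mult_strict_right_mono) auto
    finally show ?thesis by (simp add: g_def)
  qed
  have rec: "(g (Suc k) - g i) * m e (Suc k) = B k * m e k" if "norm e = 1" for e k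
    using zonal_moment_recursion(1)[OF u that eig, of k]
    by (simp add: g_def B_def m_def algebra_simps)
  have below: "m e k = 0" if e: "norm e = 1" and "k < i" for e k
    using \<open>k < i\<close>
  proof (induction k)
    case 0
    then have "g i \<noteq> 0" using g_less[of 0 i] by (simp add: g_def[of 0])
    then show ?case
      using zonal_moment_recursion(2)[OF u e eig] unfolding m_def g_def by simp
  next
    case (Suc k)
    then have "g (Suc k) \<noteq> g i" using g_less[of "Suc k" i] by simp
    then show ?case using rec[OF e, of k] Suc by simp
  qed
  have "\<exists>c. \<forall>e. norm e = 1 \<longrightarrow> m e k = c * m e i" for k
  proof (cases "k < i")
    case True
    then show ?thesis using below by (intro exI[of _ 0]) simp
  next
    case False
    then have "i \<le> k" by simp
    then show ?thesis
    proof (induction k rule: dec_induct)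
      case base
      show ?case by (intro exI[of _ 1]) simp
    next
      case (step k)
      then obtain c where c: "\<And>e. norm e = 1 \<Longrightarrow> m e k = c * m e i" by blast
      have "g (Suc k) - g i \<noteq> 0" using g_less[of i "Suc k"] step by simp
      then have "m e (Suc k) = B k * c / (g (Suc k) - g i) * m e i" if "norm e = 1" for e
        using rec[OF that, of k] c[OF that] by (simp add: field_simps)
      then show ?case by blast
    qed
  qed
  then obtain t where "\<And>k e. norm e = 1 \<Longrightarrow> m e k = t k * m e i" by metis
  then show ?thesis using that unfolding m_def by blast
qed

lemma Ck_on_imp_smooth_on_sphere: "(\<And>k. Ck_on k f UNIV) \<Longrightarrow> smooth_on_sphere f"
  unfolding smooth_on_sphere_def by (intro exI[of _ UNIV] exI[of _ f]) auto

lemma laplace_beltrami_const: "laplace_beltrami (\<lambda>x. c) z = 0"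
  by (simp add: laplace_beltrami_def sphere_div_def sphere_grad_def sphere_deriv_def)

text \<open>By the case \<open>u = 1\<close>, the choice of the pole is irrelevant; rotations are not needed.\<close>
definition zonal_mass :: "'b::euclidean_space itself \<Rightarrow> nat \<Rightarrow> real" where
  "zonal_mass _ k = (\<integral>x. zonal (SOME b. b \<in> Basis) x ^ k \<partial>(sphere_measure :: 'b measure))"

lemma integral_zonal_power:
  fixes e :: "'b::euclidean_space"
  assumes "norm e = 1" "DIM('b) \<ge> 2"
  shows "(\<integral>x. zonal e x ^ k \<partial>sphere_measure) = zonal_mass TYPE('b) k"
proof -
  have "smooth_on_sphere (\<lambda>x::'b. 1::real)" by (intro Ck_on_imp_smooth_on_sphere Ck_on_const)
  \<comment> \<open>Constants have degree 0, and the reference moment of order 0 is the total mass,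
    in which the pole does not occur.\<close>
  from zonal_moment_structure[OF this assms(2), of 0]
  obtain t where t: "\<And>e::'b. \<And>k. norm e = 1 \<Longrightarrow> (\<integral>x. 1 * zonal e x ^ k \<partial>sphere_measure) =
      t k * (\<integral>x. 1 * zonal e x ^ 0 \<partial>sphere_measure)"
    by (auto simp: laplace_beltrami_const)
  have "norm (SOME b::'b. b \<in> Basis) = 1"
    using nonempty_Basis by (intro norm_Basis) (simp add: some_in_eq)
  with t[of "SOME b::'b. b \<in> Basis" k] t[OF assms(1), of k] show ?thesis
    by (simp add: zonal_mass_def)
qed

section \<open>Binomial expansion of the Riesz kernels\<close>

definition neg_binomial_coeff :: "real \<Rightarrow> nat \<Rightarrow> real" where
  "neg_binomial_coeff b k = pochhammer b k / fact k"

lemma neg_binomial_coeff_nonneg: "b \<ge> 0 \<Longrightarrow> neg_binomial_coeff b k \<ge> 0"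
  by (simp add: neg_binomial_coeff_def pochhammer_prod prod_nonneg)

text \<open>Newton's series for exponent \<open>- b\<close> at \<open>- t\<close>: the sign of the
  binomial coefficient cancels that of \<open>(- t) ^ k\<close>, so for b \<ge> 0 all terms are
  nonnegative.\<close>

lemma neg_binomial_sums:
  assumes "0 \<le> t" "t < 1"
  shows "(\<lambda>k. neg_binomial_coeff b k * t ^ k) sums (1 - t) powr (- b)"
proof -
  have "(\<lambda>k. (- b gchoose k) * (- t) ^ k) sums (1 + (- t)) powr (- b)"
    using assms by (intro gen_binomial_real) simp
  moreover have "(- b gchoose k) * (- t) ^ k = neg_binomial_coeff b k * t ^ k" for k
    by (cases "even k") (simp_all add: neg_binomial_coeff_def gbinomial_pochhammer)
  ultimately show ?thesis by simp
qed

lemma kernel_powr_eq: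
  assumes "norm e = 1" "norm x = 1" "x \<noteq> e"
  shows "(1 - zonal e x) powr (- b) = 4 powr b * norm (e - x) powr (- 2 * b)"
proof -
  have "norm (e - x) > 0" using assms by simp
  then have "((norm (e - x))\<^sup>2 / 4) powr (- b) = (norm (e - x))\<^sup>2 powr (- b) / 4 powr (- b)"
    by (simp add: powr_divide)
  also have "(norm (e - x))\<^sup>2 powr (- b) = norm (e - x) powr (- 2 * b)"
    by (simp add: powr_powr flip: powr_numeral)
  finally show ?thesis
    unfolding zonal_bounds(3)[OF assms(1,2)] by (simp add: powr_minus_divide)
qed

text \<open>The cone over a single point lies in a hyperplane through the origin. The normal
  \<open>y\<close> of such a hyperplane exists from dimension 2 on; in dimension 1 the two points of
  the sphere carry mass.\<close>

lemma AE_sphere_neq: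
  fixes e :: "'b::euclidean_space"
  assumes "DIM('b) \<ge> 2"
  shows "AE x in sphere_measure. x \<noteq> e"
proof -
  obtain y where y: "y \<noteq> 0" "orthogonal e y"
    using orthogonal_to_vector_exists[OF assms] by blast
  have "{x. y \<bullet> x = 0} \<in> null_sets lborel"
    using negligible_hyperplane[of y 0] y(1)
    by (simp add: negligible_iff_null_sets null_sets_completion_iff closed_hyperplane borel_closed)
  then have "AE x in lborel. y \<bullet> x \<noteq> 0"
    by (auto intro!: AE_I[of _ _ "{x. y \<bullet> x = 0}"] simp: null_sets_def)
  then have "AE x in lborel. x \<in> cball 0 1 - {0} \<longrightarrow> sgn x \<noteq> e"
  proof eventually_elim
    case (elim x)
    show ?case
    proof (intro impI notI)
      assume "x \<in> cball 0 1 - {0}" "sgn x = e"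
      then have "x = norm x *\<^sub>R e" by (auto simp: sgn_div_norm)
      then have "y \<bullet> x = norm x * (y \<bullet> e)" by (metis inner_scaleR_right)
      then show False using elim y(2) by (simp add: orthogonal_def inner_commute)
    qed
  qed
  then have "AE x in distr (restrict_space lborel (cball 0 1 - {0})) (restrict_space borel (sphere 0 1)) sgn. x \<noteq> e"
    by (subst AE_distr_iff[OF sgn_measurable_sphere]) 
      (auto simp: AE_restrict_space_iff sets_restrict_space space_restrict_space)
  then show ?thesis
    unfolding sphere_measure_eq_density by (subst AE_density) auto
qed

text \<open>The parameter \<open>b\<close> is half the order of the singularity, hence the exponent
  of the binomial series in \<open>zonal e\<close>. Values in \<open>ennreal\<close> keep the
  critical case, with mass \<infinity>, in the same framework.\<close>

definition riesz_mass :: "real \<Rightarrow> 'b::euclidean_space \<Rightarrow> ennreal" where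
  "riesz_mass b e = (\<integral>\<^sup>+x. ennreal (norm (e - x) powr (- 2 * b)) \<partial>sphere_measure)"

lemma borel_measurable_sphere:
  "f \<in> borel_measurable borel \<Longrightarrow> f \<in> borel_measurable (sphere_measure :: 'b::euclidean_space measure)"
  by (simp add: measurable_cong_sets[OF sets_sphere_measure refl] measurable_restrict_space1)

lemma zonal_measurable [measurable]: "zonal e \<in> borel_measurable sphere_measure"
  by (rule borel_measurable_sphere) (unfold zonal_def, measurable)

lemma norm_diff_measurable_sphere [measurable]:
  "(\<lambda>x. norm (e - x)) \<in> borel_measurable sphere_measure"
  by (rule borel_measurable_sphere) measurable

text \<open>Terms are nonnegative, so sum and integral commute even when both are infinite. The
  right-hand side is free of the pole, and its divergence in the critical case drives the
  elimination argument below.\<close>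

lemma riesz_mass_eq_suminf:
  fixes e :: "'b::euclidean_space"
  assumes e: "norm e = 1" and D: "DIM('b) \<ge> 2" and b: "b \<ge> 0"
  shows "ennreal (4 powr b) * riesz_mass b e =
    (\<Sum>k. ennreal (neg_binomial_coeff b k * zonal_mass TYPE('b) k))"
proof -
  let ?c = "neg_binomial_coeff b"
  have c: "?c k \<ge> 0" for k using neg_binomial_coeff_nonneg[OF b] .
  have moment: "(\<integral>\<^sup>+x. ennreal (?c k * zonal e x ^ k) \<partial>sphere_measure) =
      ennreal (?c k * zonal_mass TYPE('b) k)" for k
  proof -
    have "integrable sphere_measure (\<lambda>x. ?c k * zonal e x ^ k)"
      using integrable_zonal_moment[of "\<lambda>x. 1" e k] by simp
    moreover have "AE x in sphere_measure. 0 \<le> ?c k * zonal e x ^ k"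
      using c zonal_bounds(1)[OF e] by (intro AE_I2) simp
    ultimately show ?thesis
      by (subst nn_integral_eq_integral) (simp_all add: integral_zonal_power[OF e D])
  qed
  have "ennreal (4 powr b) * riesz_mass b e =
      (\<integral>\<^sup>+x. ennreal (4 powr b * norm (e - x) powr (- 2 * b)) \<partial>sphere_measure)"
    unfolding riesz_mass_def by (subst nn_integral_cmult[symmetric]) (auto simp: ennreal_mult)
  also have "\<dots> = (\<integral>\<^sup>+x. (\<Sum>k. ennreal (?c k * zonal e x ^ k)) \<partial>sphere_measure)"
  proof (rule nn_integral_cong_AE)
    show "AE x in sphere_measure. ennreal (4 powr b * norm (e - x) powr (- 2 * b)) =
        (\<Sum>k. ennreal (?c k * zonal e x ^ k))"
      using AE_sphere_neq[OF D, of e] AE_space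
    proof eventually_elim
      case (elim x)
      then have x: "norm x = 1" "x \<noteq> e" by auto
      then have "(norm (e - x))\<^sup>2 > 0" by simp
      then have "zonal e x < 1" using zonal_bounds(3)[OF e x(1)] by linarith
      then have s: "(\<lambda>k. ?c k * zonal e x ^ k) sums (4 powr b * norm (e - x) powr (- 2 * b))"
        using neg_binomial_sums[OF zonal_bounds(1)[OF e x(1)], of b] kernel_powr_eq[OF e x, of b] by simp
      show ?case
        by (rule suminf_ennreal_eq[OF _ s, symmetric]) (intro mult_nonneg_nonneg c zero_le_power zonal_bounds e x)
    qed
  qed
  also have "\<dots> = (\<Sum>k. \<integral>\<^sup>+x. ennreal (?c k * zonal e x ^ k) \<partial>sphere_measure)"
    by (rule nn_integral_suminf) measurable
  finally show ?thesis by (simp only: moment)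
qed

lemma riesz_mass_rotation:
  fixes e e' :: "'b::euclidean_space"
  assumes "norm e = 1" "norm e' = 1" "DIM('b) \<ge> 2" "b \<ge> 0"
  shows "riesz_mass b e = riesz_mass b e'"
proof -
  have "ennreal (4 powr b) * riesz_mass b e = ennreal (4 powr b) * riesz_mass b e'"
    using riesz_mass_eq_suminf[of e b] riesz_mass_eq_suminf[of e' b] assms by simp
  then show ?thesis by (simp add: ennreal_mult_cancel_left)
qed

lemma zonal_mass_nonneg:
  assumes "DIM('b::euclidean_space) \<ge> 2"
  shows "zonal_mass TYPE('b) k \<ge> 0"
proof -
  obtain e :: 'b where e: "norm e = 1" using nonempty_Basis norm_Basis by blast
  show ?thesis
    unfolding integral_zonal_power[OF e assms, symmetric]
    by (rule integral_nonneg_AE, rule AE_I2) (simp add: zonal_bounds[OF e])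
qed

text \<open>The Lipschitz bound for \<open>u\<close> on the sphere gains one power of the distance,
  which leaves the order \<open>n - 1\<close> in the kernel.\<close>

lemma integrable_riesz_difference:
  fixes u :: "'b::euclidean_space \<Rightarrow> real"
  assumes u: "smooth_on_sphere u" and e: "norm e = 1"
    and fin: "riesz_mass ((real n - 1) / 2) e < \<infinity>"
  shows "integrable sphere_measure (\<lambda>x. (u e - u x) / norm (e - x) ^ n)"
proof -
  obtain L where L: "L \<ge> 0"
    "\<And>z w. z \<in> sphere 0 1 \<Longrightarrow> w \<in> sphere 0 1 \<Longrightarrow> norm (u z - u w) \<le> L * norm (z - w)"
    by (rule sphere_C1_lipschitz[OF smooth_on_sphere_compose_sgn[OF u]]) (rule that)
  have um: "u \<in> borel_measurable sphere_measure"
    using borel_measurable_sphere_continuous[OF smooth_on_sphere_continuous[OF u]] .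
  have "integrable sphere_measure (\<lambda>x. norm (e - x) powr (- 2 * ((real n - 1) / 2)))"
    using fin by (intro integrableI_nonneg) (auto simp: riesz_mass_def)
  moreover have "- 2 * ((real n - 1) / 2) = 1 - real n" by simp
  ultimately have "integrable sphere_measure (\<lambda>x. norm (e - x) powr (1 - real n))"
    by (simp only:)
  then have i: "integrable sphere_measure (\<lambda>x. L * norm (e - x) powr (1 - real n))"
    by (rule integrable_mult_right)
  show ?thesis
  proof (rule Bochner_Integration.integrable_bound[OF i])
    show "(\<lambda>x. (u e - u x) / norm (e - x) ^ n) \<in> borel_measurable sphere_measure"
      using um by measurable
    show "AE x in sphere_measure. norm ((u e - u x) / norm (e - x) ^ n) \<le>
        norm (L * norm (e - x) powr (1 - real n))"
    proof (rule AE_I2)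
      fix x :: 'b assume "x \<in> space sphere_measure"
      then have "norm (u e - u x) \<le> L * norm (e - x)" using L(2)[of e x] e by simp
      then have "norm ((u e - u x) / norm (e - x) ^ n) \<le> L * norm (e - x) / norm (e - x) ^ n"
        by (simp add: norm_divide norm_power divide_right_mono)
      also have "\<dots> = L * norm (e - x) powr (1 - real n)"
        by (cases "x = e") (simp_all add: powr_diff powr_realpow)
      finally show "norm ((u e - u x) / norm (e - x) ^ n) \<le> norm (L * norm (e - x) powr (1 - real n))"
        by simp
    qed
  qed
qed

text \<open>Partial sums of the nonnegative series stay below the kernel, so the integrand with the
  full kernel dominates. This is where the integrability of the difference quotient enters; the
  kernel alone need not be integrable.\<close>

lemma truncated_kernel_tendsto:
  fixes u :: "'b::euclidean_space \<Rightarrow> real"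
  assumes u: "smooth_on_sphere u" and e: "norm e = 1"
    and fin: "riesz_mass ((real n - 1) / 2) e < \<infinity>"
  shows "(\<lambda>m. \<Sum>k<m. neg_binomial_coeff (real n / 2) k * (\<integral>x. (u e - u x) * zonal e x ^ k \<partial>sphere_measure))
    \<longlonglongrightarrow> 2 ^ n * (\<integral>x. (u e - u x) / norm (e - x) ^ n \<partial>sphere_measure)"
proof -
  let ?c = "neg_binomial_coeff (real n / 2)"
  have c: "?c k \<ge> 0" for k by (rule neg_binomial_coeff_nonneg) simp
  have cu: "continuous_on (sphere 0 1) (\<lambda>x. u e - u x)"
    by (intro continuous_intros smooth_on_sphere_continuous u)
  note int = integrable_zonal_moment[OF cu, of e]
  have i: "integrable sphere_measure (\<lambda>x. 2 ^ n * ((u e - u x) / norm (e - x) ^ n))"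
    using integrable_riesz_difference[OF u e fin] by (rule integrable_mult_right)
  have sums: "(\<lambda>k. ?c k * zonal e x ^ k) sums (2 ^ n / norm (e - x) ^ n)"
    if "norm x = 1" "x \<noteq> e" for x
  proof -
    have pos: "norm (e - x) > 0" using that by simp
    then have "zonal e x < 1" using zonal_bounds(3)[OF e that(1)] by (smt (verit) zero_less_divide_iff zero_less_power)
    moreover have "(1 - zonal e x) powr - (real n / 2) = 2 ^ n / norm (e - x) ^ n"
    proof -
      have "(4::real) powr (real n / 2) = 2 powr real n"
        using powr_powr[of 2 2 "real n / 2"] by simp
      then show ?thesis
        using kernel_powr_eq[OF e that, of "real n / 2"] pos
        by (simp add: powr_realpow powr_minus_divide)
    qed
    ultimately show ?thesis
      using neg_binomial_sums[of "zonal e x" "real n / 2"] zonal_bounds(1)[OF e that(1)] by simp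
  qed
  have "(\<lambda>m. \<integral>x. (\<Sum>k<m. ?c k * ((u e - u x) * zonal e x ^ k)) \<partial>sphere_measure)
      \<longlonglongrightarrow> (\<integral>x. 2 ^ n * ((u e - u x) / norm (e - x) ^ n) \<partial>sphere_measure)"
  proof (rule integral_dominated_convergence[OF _ _ integrable_norm[OF i]])
    show "(\<lambda>x. 2 ^ n * ((u e - u x) / norm (e - x) ^ n)) \<in> borel_measurable sphere_measure"
      using i by auto
    show "(\<lambda>x. \<Sum>k<m. ?c k * ((u e - u x) * zonal e x ^ k)) \<in> borel_measurable sphere_measure" for m
      using int by (intro borel_measurable_sum) auto
    have eq: "(\<Sum>k<m. ?c k * ((u e - u x) * zonal e x ^ k)) = (u e - u x) * (\<Sum>k<m. ?c k * zonal e x ^ k)"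
      for m x by (simp add: sum_distrib_left mult_ac)
    show "AE x in sphere_measure. (\<lambda>m. \<Sum>k<m. ?c k * ((u e - u x) * zonal e x ^ k))
        \<longlonglongrightarrow> 2 ^ n * ((u e - u x) / norm (e - x) ^ n)"
    proof (rule AE_I2)
      fix x :: 'b assume "x \<in> space sphere_measure"
      then have x: "norm x = 1" by simp
      show "(\<lambda>m. \<Sum>k<m. ?c k * ((u e - u x) * zonal e x ^ k)) \<longlonglongrightarrow> 2 ^ n * ((u e - u x) / norm (e - x) ^ n)"
      proof (cases "x = e")
        case False
        from tendsto_mult_left[OF sums[OF x False, unfolded sums_def], of "u e - u x"]
        show ?thesis unfolding eq by (simp add: mult.commute)
      qed simp
    qed
    show "AE x in sphere_measure. norm (\<Sum>k<m. ?c k * ((u e - u x) * zonal e x ^ k))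
        \<le> norm (2 ^ n * ((u e - u x) / norm (e - x) ^ n))" for m
    proof (rule AE_I2)
      fix x :: 'b assume "x \<in> space sphere_measure"
      then have x: "norm x = 1" by simp
      show "norm (\<Sum>k<m. ?c k * ((u e - u x) * zonal e x ^ k)) \<le> norm (2 ^ n * ((u e - u x) / norm (e - x) ^ n))"
      proof (cases "x = e")
        case False
        have nn: "0 \<le> ?c k * zonal e x ^ k" for k using c zonal_bounds(1)[OF e x] by simp
        have "(\<Sum>k<m. ?c k * zonal e x ^ k) \<le> 2 ^ n / norm (e - x) ^ n"
          using sum_le_suminf[OF sums_summable[OF sums[OF x False]], of "{..<m}"] nn
            sums_unique[OF sums[OF x False]] by simp
        moreover have "0 \<le> (\<Sum>k<m. ?c k * zonal e x ^ k)" using nn by (intro sum_nonneg) auto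
        ultimately have "\<bar>u e - u x\<bar> * \<bar>\<Sum>k<m. ?c k * zonal e x ^ k\<bar> \<le> \<bar>u e - u x\<bar> * (2 ^ n / norm (e - x) ^ n)"
          by (intro mult_left_mono) auto
        then show ?thesis unfolding eq by (simp add: abs_mult mult.commute)
      qed simp
    qed
  qed
  also have "(\<integral>x. 2 ^ n * ((u e - u x) / norm (e - x) ^ n) \<partial>sphere_measure) =
      2 ^ n * (\<integral>x. (u e - u x) / norm (e - x) ^ n \<partial>sphere_measure)"
    by (rule integral_mult_right_zero)
  finally show ?thesis
    using int by (simp add: Bochner_Integration.integral_sum)
qed

lemma riesz_difference_eigen:
  fixes u :: "'b::euclidean_space \<Rightarrow> real"
  assumes u: "smooth_on_sphere u" and D: "DIM('b) \<ge> 2"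
    and eig: "\<And>z. z \<in> sphere 0 1 \<Longrightarrow> - laplace_beltrami u z = real i * (real i + real DIM('b) - 2) * u z"
    and fin: "\<And>e::'b. norm e = 1 \<Longrightarrow> riesz_mass ((real n - 1) / 2) e < \<infinity>"
    and inf: "\<And>e::'b. norm e = 1 \<Longrightarrow> riesz_mass (real n / 2) e = \<infinity>"
  shows "\<exists>l. \<forall>e\<in>sphere 0 1. (\<integral>x. (u e - u x) / norm (e - x) ^ n \<partial>sphere_measure) = l * u e"
proof (cases "\<forall>e\<in>sphere 0 1. u e = 0")
  \<comment> \<open>For vanishing \<open>u\<close> every multiplier will do; otherwise a point
    \<open>w\<close> with \<open>u w\<close> nonzero normalizes the ratio of \<open>C\<close> to
    \<open>u\<close>.\<close>
  case True
  have "(\<integral>x. (u e - u x) / norm (e - x) ^ n \<partial>sphere_measure) = (\<integral>x. 0 \<partial>(sphere_measure::'b measure))"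
    if "e \<in> sphere 0 1" for e
    using True that by (intro Bochner_Integration.integral_cong) auto
  then show ?thesis using True by (intro exI[of _ 0]) simp
next
  case False
  then obtain w where w: "norm w = 1" "u w \<noteq> 0" by auto
  let ?c = "neg_binomial_coeff (real n / 2)" and ?M = "zonal_mass TYPE('b)"
  define C where "C e = (\<integral>x. u x * zonal e x ^ i \<partial>sphere_measure)" for e
  define \<Lambda> where "\<Lambda> e = (\<integral>x. (u e - u x) / norm (e - x) ^ n \<partial>sphere_measure)" for e
  obtain t where t: "\<And>e k. norm e = 1 \<Longrightarrow> (\<integral>x. u x * zonal e x ^ k \<partial>sphere_measure) = t k * C e"
    using zonal_moment_structure[OF u D eig] unfolding C_def by blast
  define a where "a m = (\<Sum>k<m. ?c k * ?M k)" for m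
  define b where "b m = (\<Sum>k<m. ?c k * t k)" for m
  have lim: "(\<lambda>m. u e * a m - C e * b m) \<longlonglongrightarrow> 2 ^ n * \<Lambda> e" if e: "norm e = 1" for e
  proof -
    have "(\<integral>x. (u e - u x) * zonal e x ^ k \<partial>sphere_measure) = u e * ?M k - t k * C e" for k
      using integrable_zonal_moment[OF smooth_on_sphere_continuous[OF u], of e k]
        integrable_zonal_moment[of "\<lambda>x. u e" e k] integral_zonal_power[OF e D, of k] t[OF e, of k]
      by (simp add: left_diff_distrib)
    then have "(\<Sum>k<m. ?c k * (\<integral>x. (u e - u x) * zonal e x ^ k \<partial>sphere_measure)) = u e * a m - C e * b m" for m
      by (simp add: a_def b_def sum_distrib_left right_diff_distrib sum_subtractf mult_ac)
    then show ?thesis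
      using truncated_kernel_tendsto[OF u e fin[OF e]] by (simp add: \<Lambda>_def)
  qed
  have a_top: "filterlim a at_top sequentially"
  proof -
    have nn: "0 \<le> ?c k * ?M k" for k
      using neg_binomial_coeff_nonneg zonal_mass_nonneg[OF D] by simp
    \<comment> \<open>The infinite critical mass enters here: with nonnegative terms it makes the
      partial sums \<open>a\<close> unbounded.\<close>
    have "(\<Sum>k. ennreal (?c k * ?M k)) = \<infinity>"
      using riesz_mass_eq_suminf[OF w(1) D, of "real n / 2"] inf[OF w(1)] by (simp add: ennreal_mult_top)
    then have "\<not> summable (\<lambda>k. ?c k * ?M k)"
      using suminf_ennreal_eq[of "\<lambda>k. ?c k * ?M k"] nn by (auto simp: summable_def)
    then have "\<exists>m. a m \<ge> Z" for Z
      using bounded_imp_summable[of "\<lambda>k. ?c k * ?M k" Z] nn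
      unfolding a_def lessThan_Suc_atMost[symmetric] by (meson linear)
    moreover have "incseq a" unfolding a_def by (intro incseq_SucI) (simp add: nn)
    ultimately show ?thesis
      unfolding filterlim_at_top eventually_sequentially by (meson incseqD order_trans)
  qed
  \<comment> \<open>Eliminating \<open>b\<close> from \<open>lim\<close> for \<open>e\<close> and \<open>w\<close> leaves \<open>(u e C w - u w C e) a m\<close>, which converges although \<open>a\<close> does not.\<close>
  have proportional: "u e * C w = u w * C e" if e: "norm e = 1" for e
  proof (rule ccontr)
    assume ne: "u e * C w \<noteq> u w * C e"
    have "(\<lambda>m. (u e * a m - C e * b m) * C w - (u w * a m - C w * b m) * C e)
        \<longlonglongrightarrow> 2 ^ n * \<Lambda> e * C w - 2 ^ n * \<Lambda> w * C e"
      by (intro tendsto_intros lim e w)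
    moreover have "(u e * a m - C e * b m) * C w - (u w * a m - C w * b m) * C e =
        (u e * C w - u w * C e) * a m" for m by (simp add: algebra_simps)
    ultimately have "(\<lambda>m. (u e * C w - u w * C e) * a m) \<longlonglongrightarrow> 2 ^ n * \<Lambda> e * C w - 2 ^ n * \<Lambda> w * C e"
      by simp
    from tendsto_mult_left[OF this, of "1 / (u e * C w - u w * C e)"]
    have "convergent a" using ne by (auto simp: convergent_def)
    then show False
      using a_top not_tendsto_and_filterlim_at_infinity[OF sequentially_bot]
        filterlim_at_top_imp_at_infinity[OF a_top] by (auto simp: convergent_def)
  qed
  \<comment> \<open>By proportionality, the convergent sequence for \<open>e\<close> is
    \<open>u e / u w\<close> times the one for \<open>w\<close>, so the limits have the same
    ratio.\<close>
  have "\<Lambda> e = \<Lambda> w / u w * u e" if e: "norm e = 1" for e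
  proof -
    have Ce: "C e = u e / u w * C w" using proportional[OF e] w by (simp add: field_simps)
    have "u e / u w * (u w * a m - C w * b m) = u e * a m - C e * b m" for m
      unfolding Ce using w by (simp add: field_simps)
    then have "(\<lambda>m. u e * a m - C e * b m) \<longlonglongrightarrow> u e / u w * (2 ^ n * \<Lambda> w)"
      using tendsto_mult_left[OF lim[OF w(1)], of "u e / u w"] by simp
    then have "u e / u w * (2 ^ n * \<Lambda> w) = 2 ^ n * \<Lambda> e"
      using LIMSEQ_unique lim[OF e] by blast
    then have "2 ^ n * \<Lambda> e = 2 ^ n * (\<Lambda> w / u w * u e)" by (simp add: mult_ac)
    then show ?thesis by (simp only: mult_cancel_left) simp
  qed
  then show ?thesis unfolding \<Lambda>_def by (intro exI[of _ "\<Lambda> w / u w"]) (simp add: \<Lambda>_def)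
qed

section \<open>The sphere measure in stereographic coordinates\<close>

text \<open>
  The cone over the sphere is parametrized by \<open>(y, s) \<mapsto> (s / \<phi>(y)) \<sigma>\<^sup>-\<^sup>1(y) = (s y, s / 2 - |s y|\<^sup>2 / (2 s))\<close>.
  This map is the composition of the scaling \<open>y \<mapsto> s y\<close> for fixed \<open>s\<close> with a one-dimensional substitution for fixed
  \<open>p = s y\<close>, so Fubini's theorem suffices for the change of variables.
\<close>
lemma lborel_eq_distr_difference:
  fixes r :: real
  assumes r: "r > 0"
  shows "lborel = distr (density lborel (\<lambda>s. indicator {0<..} s * ennreal (1/2 + r\<^sup>2 / (2 * s\<^sup>2))))
    borel (\<lambda>s. s / 2 - r\<^sup>2 / (2 * s))"
    (is "_ = distr (density lborel ?w) borel ?g")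
proof (rule lborel_eqI)
  fix l u :: real
  assume "\<And>b. b \<in> Basis \<Longrightarrow> l \<bullet> b \<le> u \<bullet> b"
  then have lu: "l \<le> u" by simp
  \<comment> \<open>The inverse of \<open>?g\<close> on the positive reals: the positive root of s^2
    - 2 q s - r^2 = 0. Completing the square below turns preimages of intervals under
    \<open>?g\<close> into intervals with end points \<open>h l\<close> and
    \<open>h u\<close>.\<close>
  define h where "h q = q + sqrt (q\<^sup>2 + r\<^sup>2)" for q
  have sq: "sqrt (q\<^sup>2 + r\<^sup>2) > \<bar>q\<bar>" for q
    using r by (metis add_strict_left_mono add.right_neutral real_sqrt_abs real_sqrt_less_mono zero_less_power)
  have h_pos: "h q > 0" for q using sq[of q] unfolding h_def by linarith
  have less_iff: "?g s < q \<longleftrightarrow> s < h q" "q < ?g s \<longleftrightarrow> h q < s" if s: "s > 0" for s q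
  proof -
    have g: "?g s = (s\<^sup>2 - r\<^sup>2) / (2 * s)" using s by (simp add: field_simps power2_eq_square)
    have "?g s < q \<longleftrightarrow> (s - q)\<^sup>2 < q\<^sup>2 + r\<^sup>2"
      using s unfolding g by (simp add: divide_less_eq power2_eq_square algebra_simps)
    also have "\<dots> \<longleftrightarrow> \<bar>s - q\<bar> < sqrt (q\<^sup>2 + r\<^sup>2)"
      by (metis real_sqrt_abs real_sqrt_less_iff)
    also have "\<dots> \<longleftrightarrow> s < h q" using s sq[of q] unfolding h_def by linarith
    finally show "?g s < q \<longleftrightarrow> s < h q" .
    have "q < ?g s \<longleftrightarrow> q\<^sup>2 + r\<^sup>2 < (s - q)\<^sup>2"
      using s unfolding g by (simp add: less_divide_eq power2_eq_square algebra_simps)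
    also have "\<dots> \<longleftrightarrow> sqrt (q\<^sup>2 + r\<^sup>2) < \<bar>s - q\<bar>"
      by (metis real_sqrt_abs real_sqrt_less_iff)
    also have "\<dots> \<longleftrightarrow> h q < s" using s sq[of q] unfolding h_def by linarith
    finally show "q < ?g s \<longleftrightarrow> h q < s" .
  qed
  have gh: "?g (h q) = q" for q
    using less_iff[OF h_pos, of q q] by linarith
  have h_le: "h l \<le> h u"
    using less_iff(1)[OF h_pos, of u l] gh[of u] lu by linarith
  have "emeasure (distr (density lborel ?w) borel ?g) (box l u) =
      (\<integral>\<^sup>+s. ?w s * indicator (?g -` box l u) s \<partial>lborel)"
    by (simp add: emeasure_distr emeasure_density measurable_sets_borel[of ?g borel])
  also have "\<dots> = (\<integral>\<^sup>+s\<in>{h l..h u}. ennreal (1/2 + r\<^sup>2 / (2 * s\<^sup>2)) \<partial>lborel)"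
  proof (rule nn_integral_cong_AE)
    show "AE s in lborel. ?w s * indicator (?g -` box l u) s =
        ennreal (1/2 + r\<^sup>2 / (2 * s\<^sup>2)) * indicator {h l..h u} s"
      using AE_lborel_singleton[of "h l"] AE_lborel_singleton[of "h u"]
    proof eventually_elim
      case (elim s)
      then show ?case
        using less_iff[of s] h_pos[of l] h_pos[of u]
        by (auto simp: indicator_def box_real)
    qed
  qed
  also have "\<dots> = ennreal (?g (h u) - ?g (h l))"
  proof (rule nn_integral_FTC_Icc[OF _ _ _ h_le])
    fix s assume "s \<in> {h l..h u}"
    then have s: "s > 0" using h_pos[of l] by auto
    then show "(?g has_real_derivative 1/2 + r\<^sup>2 / (2 * s\<^sup>2)) (at s)"
      by (auto intro!: derivative_eq_intros simp: field_simps power2_eq_square)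
    show "0 \<le> 1/2 + r\<^sup>2 / (2 * s\<^sup>2)" by simp
  qed simp
  finally show "emeasure (distr (density lborel ?w) borel ?g) (box l u) = ennreal (prod ((\<bullet>) (u - l)) Basis)"
    by (simp only: gh) simp
qed simp

lemma nn_integral_difference_substitution:
  fixes f :: "real \<Rightarrow> ennreal"
  assumes [measurable]: "f \<in> borel_measurable borel" and r: "r > 0"
  shows "integral\<^sup>N lborel f =
    (\<integral>\<^sup>+s. indicator {0<..} s * ennreal (1/2 + r\<^sup>2 / (2 * s\<^sup>2)) * f (s / 2 - r\<^sup>2 / (2 * s)) \<partial>lborel)"
  by (subst lborel_eq_distr_difference[OF r])
    (simp add: nn_integral_distr nn_integral_density)

lemma nn_integral_lborel_scale:
  fixes f :: "'a::euclidean_space \<Rightarrow> ennreal"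
  assumes [measurable]: "f \<in> borel_measurable borel" and c: "c > 0"
  shows "integral\<^sup>N lborel f = ennreal (c ^ DIM('a)) * (\<integral>\<^sup>+x. f (c *\<^sub>R x) \<partial>lborel)"
  using c by (subst lborel_affine[of c 0])
    (simp_all add: nn_integral_distr nn_integral_density nn_integral_cmult)

lemma conf_factor_pos: "conf_factor x > 0"
  unfolding conf_factor_def by (simp add: add_pos_nonneg)

lemma conf_factor_measurable [measurable]: "conf_factor \<in> borel_measurable borel"
  unfolding conf_factor_def by measurable

lemma norm_stereo_inv: "norm (stereo_inv x) = 1"
  using stereo_inv_in_sphere[of x] by simp

lemma stereo_inv_measurable [measurable]:
  "stereo_inv \<in> measurable borel (restrict_space borel (sphere 0 1))"
proof (rule measurable_restrict_space2)
  show "stereo_inv \<in> borel_measurable borel" unfolding stereo_inv_def by measurable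
qed (use stereo_inv_in_sphere in auto)

text \<open>On the left the two substitutions are visible: a scaling, then a last coordinate
  depending on \<open>s\<close> and the norm of the first. On the right the cone is: the point lies
  over \<open>stereo_inv y\<close> at height \<open>s / conf_factor y\<close>, so membership in the
  solid cone amounts to s \<le> \<phi>(y).\<close>

lemma cone_point_eq:
  fixes y :: "'a::euclidean_space"
  shows "(s *\<^sub>R y, s / 2 - (norm (s *\<^sub>R y))\<^sup>2 / (2 * s)) = (s / conf_factor y) *\<^sub>R stereo_inv y"
proof (cases "s = 0")
  case False
  have pos: "1 + (norm y)\<^sup>2 \<noteq> 0" by (metis add_pos_nonneg less_irrefl zero_le_power2 zero_less_one)
  then have "(s / conf_factor y) * (2 / (1 + (norm y)\<^sup>2)) = s"
    by (simp add: conf_factor_def)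
  moreover have "s / conf_factor y * ((1 - (norm y)\<^sup>2) / (1 + (norm y)\<^sup>2)) = s / 2 - (norm (s *\<^sub>R y))\<^sup>2 / (2 * s)"
    using pos False by (simp add: conf_factor_def power_mult_distrib field_simps power2_eq_square[of s])
  ultimately show ?thesis by (simp add: stereo_inv_def)
qed (simp add: zero_prod_def)

lemma nn_integral_power_Ioc:
  assumes "c > 0"
  shows "(\<integral>\<^sup>+s. indicator {0<..c} s * ennreal (s ^ n) \<partial>lborel) = ennreal (c ^ Suc n / real (Suc n))"
proof -
  have "(\<integral>\<^sup>+s. indicator {0<..c} s * ennreal (s ^ n) \<partial>lborel) =
      (\<integral>\<^sup>+s\<in>{0..c}. ennreal (s ^ n) \<partial>lborel)"
    by (rule nn_integral_cong_AE) (use AE_lborel_singleton[of 0] in \<open>eventually_elim, auto simp: indicator_def\<close>)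
  also have "\<dots> = ennreal (c ^ Suc n / real (Suc n) - 0 ^ Suc n / real (Suc n))"
    using assms
    by (intro nn_integral_FTC_Icc) (auto intro!: derivative_eq_intros simp del: of_nat_Suc power_Suc)
  finally show ?thesis by simp
qed

text \<open>The scaling contributes s^N and the last coordinate 1/\<phi>(y). Integrating over 0 < s
  \<le> \<phi>(y) gives \<phi>(y)^N / (N + 1), and the factor N + 1 in the definition of the sphere
  measure cancels the denominator.\<close>

lemma emeasure_sphere_stereo:
  fixes A :: "('a::euclidean_space \<times> real) set"
  assumes A: "A \<in> sets (restrict_space borel (sphere 0 1))"
  shows "emeasure sphere_measure A =
    (\<integral>\<^sup>+y. indicator A (stereo_inv y) * ennreal (conf_factor y ^ DIM('a)) \<partial>lborel)"
proof -
  let ?N = "DIM('a)"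
  have [measurable]: "Measurable.pred borel (\<lambda>y. stereo_inv y \<in> A)"
    using measurable_sets[OF stereo_inv_measurable A] by (simp add: pred_def vimage_def)
  define C where "C = sgn -` A \<inter> (cball 0 1 - {0 :: 'a \<times> real})"
  have C [measurable]: "C \<in> sets borel"
    using measurable_sets[OF sgn_measurable_sphere A]
    by (auto simp: C_def space_restrict_space sets_restrict_space)
  \<comment> \<open>The integrand after the one-dimensional substitution in the last coordinate,
    before the scaling of the first one.\<close>
  define W :: "'a \<Rightarrow> real \<Rightarrow> ennreal" where
    "W p s = indicator {0<..} s * ennreal (1/2 + (norm p)\<^sup>2 / (2 * s\<^sup>2)) *
      indicator C (p, s / 2 - (norm p)\<^sup>2 / (2 * s))" for p s
  have W [measurable]: "(\<lambda>(p, s). W p s) \<in> borel_measurable (borel \<Otimes>\<^sub>M borel)"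
    unfolding W_def by measurable
  \<comment> \<open>At p = s y the Jacobian of the one-dimensional substitution becomes 1/\<phi>(y),
    free of \<open>s\<close>, and the cone turns into a product condition on \<open>y\<close> and
    \<open>s\<close>.\<close>
  have W_scaled: "ennreal (s ^ ?N) * W (s *\<^sub>R y) s =
      indicator A (stereo_inv y) * ennreal (1 / conf_factor y) *
        (indicator {0<..conf_factor y} s * ennreal (s ^ ?N))" for y s
  proof (cases "s > 0")
    case True
    have cf: "conf_factor y > 0" by (rule conf_factor_pos)
    have weight: "1/2 + (norm (s *\<^sub>R y))\<^sup>2 / (2 * s\<^sup>2) = 1 / conf_factor y"
      using True by (simp add: conf_factor_def power_mult_distrib field_simps)
    have mem: "(s *\<^sub>R y, s / 2 - (norm (s *\<^sub>R y))\<^sup>2 / (2 * s)) \<in> C \<longleftrightarrow>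
        stereo_inv y \<in> A \<and> s \<le> conf_factor y"
    proof -
      have "stereo_inv y \<noteq> 0" using norm_stereo_inv[of y] by auto
      moreover have "sgn ((s / conf_factor y) *\<^sub>R stereo_inv y) = stereo_inv y"
        using True cf by (simp add: sgn_scaleR sgn_div_norm[of "stereo_inv y"] norm_stereo_inv)
      ultimately show ?thesis
        unfolding cone_point_eq C_def using True cf by (auto simp: norm_stereo_inv)
    qed
    show ?thesis unfolding W_def weight indicator_def mem using True by (auto simp: mult_ac)
  qed (simp add: W_def)
  have "emeasure sphere_measure A = of_nat (Suc ?N) * (\<integral>\<^sup>+x. indicator C x \<partial>lborel)"
  proof -
    have "emeasure sphere_measure A = (\<integral>\<^sup>+x. indicator A x \<partial>sphere_measure)"
      using A by simp
    also have "\<dots> = of_nat DIM('a \<times> real) * (\<integral>\<^sup>+x\<in>cball 0 1 - {0}. indicator A (sgn x) \<partial>lborel)"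
      using A by (intro nn_integral_sphere_measure) simp
    also have "(\<integral>\<^sup>+x\<in>cball 0 1 - {0}. indicator A (sgn x) \<partial>lborel) = (\<integral>\<^sup>+x. indicator C x \<partial>lborel)"
      by (rule nn_integral_cong) (auto simp: C_def indicator_def)
    finally show ?thesis by simp
  qed
  also have "(\<integral>\<^sup>+x. indicator C x \<partial>lborel) = (\<integral>\<^sup>+p. \<integral>\<^sup>+q. indicator C (p, q) \<partial>lborel \<partial>(lborel :: 'a measure))"
    unfolding lborel_prod[symmetric] by (subst lborel.nn_integral_fst) (simp_all add: lborel_prod)
  also have "\<dots> = (\<integral>\<^sup>+p. \<integral>\<^sup>+s. W p s \<partial>lborel \<partial>lborel)"
  proof (rule nn_integral_cong_AE)
    show "AE p in lborel. (\<integral>\<^sup>+q. indicator C (p, q) \<partial>lborel) = (\<integral>\<^sup>+s. W p s \<partial>lborel)"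
      \<comment> \<open>The substitution requires a positive \<open>r\<close>, here the norm of
        \<open>p\<close>.\<close>
      using AE_norm_neq[of 0]
    proof eventually_elim
      case (elim p)
      then show ?case
        unfolding W_def by (intro nn_integral_difference_substitution) simp_all
    qed
  qed
  also have "\<dots> = (\<integral>\<^sup>+s. \<integral>\<^sup>+p. W p s \<partial>lborel \<partial>lborel)"
    by (rule lborel_pair.Fubini'[symmetric]) simp
  also have "\<dots> = (\<integral>\<^sup>+s. \<integral>\<^sup>+y. ennreal (s ^ ?N) * W (s *\<^sub>R y) s \<partial>lborel \<partial>lborel)"
  proof (rule nn_integral_cong)
    fix s :: real
    show "(\<integral>\<^sup>+p. W p s \<partial>lborel) = (\<integral>\<^sup>+y. ennreal (s ^ ?N) * W (s *\<^sub>R y) s \<partial>lborel)"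
    proof (cases "s > 0")
      case True
      have [measurable]: "(\<lambda>p. W p s) \<in> borel_measurable borel" unfolding W_def by measurable
      show ?thesis
        by (subst nn_integral_lborel_scale[OF _ True]) (simp_all add: nn_integral_cmult)
    qed (simp add: W_def)
  qed
  also have "\<dots> = (\<integral>\<^sup>+y. \<integral>\<^sup>+s. ennreal (s ^ ?N) * W (s *\<^sub>R y) s \<partial>lborel \<partial>lborel)"
    by (rule lborel_pair.Fubini') (simp add: W_def, measurable)
  also have "\<dots> = (\<integral>\<^sup>+y. indicator A (stereo_inv y) * ennreal (1 / conf_factor y) *
      ennreal (conf_factor y ^ Suc ?N / real (Suc ?N)) \<partial>lborel)"
    unfolding W_scaled
  proof (rule nn_integral_cong)
    fix y :: 'a
    show "(\<integral>\<^sup>+s. indicator A (stereo_inv y) * ennreal (1 / conf_factor y) *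
        (indicator {0<..conf_factor y} s * ennreal (s ^ ?N)) \<partial>lborel) =
      indicator A (stereo_inv y) * ennreal (1 / conf_factor y) *
        ennreal (conf_factor y ^ Suc ?N / real (Suc ?N))"
      unfolding nn_integral_power_Ioc[OF conf_factor_pos, symmetric]
      by (rule nn_integral_cmult) measurable
  qed
  also have "\<dots> = (\<integral>\<^sup>+y. ennreal (1 / real (Suc ?N)) * (indicator A (stereo_inv y) * ennreal (conf_factor y ^ ?N)) \<partial>lborel)"
  proof (rule nn_integral_cong)
    fix y :: 'a
    have "ennreal (1 / conf_factor y) * ennreal (conf_factor y ^ Suc ?N / real (Suc ?N)) =
        ennreal (1 / real (Suc ?N)) * ennreal (conf_factor y ^ ?N)"
      using conf_factor_pos[of y] by (simp add: ennreal_mult[symmetric] del: of_nat_Suc)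
    then show "indicator A (stereo_inv y) * ennreal (1 / conf_factor y) *
        ennreal (conf_factor y ^ Suc ?N / real (Suc ?N)) =
      ennreal (1 / real (Suc ?N)) * (indicator A (stereo_inv y) * ennreal (conf_factor y ^ ?N))"
      by (simp only: mult.assoc mult.left_commute)
  qed
  also have "\<dots> = ennreal (1 / real (Suc ?N)) * (\<integral>\<^sup>+y. indicator A (stereo_inv y) * ennreal (conf_factor y ^ ?N) \<partial>lborel)"
    by (rule nn_integral_cmult) measurable
  also have "of_nat (Suc ?N) * (ennreal (1 / real (Suc ?N)) * X) = X" for X :: ennreal
  proof -
    have "of_nat (Suc ?N) * ennreal (1 / real (Suc ?N)) = 1"
      by (simp add: ennreal_of_nat_eq_real_of_nat ennreal_mult[symmetric] del: of_nat_Suc)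
    then show ?thesis by (simp only: mult.assoc[symmetric] mult_1)
  qed
  finally show ?thesis .
qed

theorem sphere_measure_stereo:
  "(sphere_measure :: ('a::euclidean_space \<times> real) measure) =
    distr (density lborel (\<lambda>y. ennreal (conf_factor y ^ DIM('a)))) (restrict_space borel (sphere 0 1)) stereo_inv"
proof (rule measure_eqI)
  fix A :: "('a \<times> real) set"
  assume "A \<in> sets sphere_measure"
  then have A: "A \<in> sets (restrict_space borel (sphere 0 1))" by simp
  have "stereo_inv -` A \<in> sets borel" using measurable_sets[OF stereo_inv_measurable A] by simp
  then show "emeasure sphere_measure A = emeasure (distr (density lborel (\<lambda>y. ennreal (conf_factor y ^ DIM('a))))
      (restrict_space borel (sphere 0 1)) stereo_inv) A"
    using A by (simp add: emeasure_sphere_stereo emeasure_distr emeasure_density mult.commute indicator_def)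
qed simp

section \<open>Values of the Riesz integrals\<close>

lemma nn_integral_gaussian_real:
  assumes t: "t > 0"
  shows "(\<integral>\<^sup>+x. ennreal (exp (- t * x\<^sup>2)) \<partial>lborel) = ennreal (sqrt (pi / t))"
proof -
  define \<sigma> where "\<sigma> = sqrt (1 / (2 * t))"
  have s: "\<sigma> > 0" "\<sigma>\<^sup>2 = 1 / (2 * t)" using t by (simp_all add: \<sigma>_def)
  have "exp (- t * x\<^sup>2) = sqrt (pi / t) * normal_density 0 \<sigma> x" for x
    using t by (simp add: normal_density_def s(2) real_sqrt_divide)
  then have "(\<integral>\<^sup>+x. ennreal (exp (- t * x\<^sup>2)) \<partial>lborel) =
      (\<integral>\<^sup>+x. ennreal (sqrt (pi / t)) * ennreal (normal_density 0 \<sigma> x) \<partial>lborel)"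
    using t by (simp add: ennreal_mult)
  also have "\<dots> = ennreal (sqrt (pi / t)) * (\<integral>\<^sup>+x. ennreal (normal_density 0 \<sigma> x) \<partial>lborel)"
    by (rule nn_integral_cmult) simp
  also have "(\<integral>\<^sup>+x. ennreal (normal_density 0 \<sigma> x) \<partial>lborel) = 1"
    using s(1) by (subst nn_integral_eq_integral) simp_all
  finally show ?thesis by simp
qed

lemma nn_integral_gaussian:
  assumes t: "t > 0"
  shows "(\<integral>\<^sup>+x. ennreal (exp (- t * (norm x)\<^sup>2)) \<partial>(lborel :: 'a::euclidean_space measure)) =
    ennreal ((pi / t) powr (real DIM('a) / 2))"
proof -
  have "exp (- t * (norm x)\<^sup>2) = (\<Prod>b\<in>Basis. exp (- t * (x \<bullet> b)\<^sup>2))" for x :: 'a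
    unfolding power2_norm_eq_inner euclidean_inner[of x x]
    by (simp add: exp_sum[symmetric] sum_distrib_left power2_eq_square sum_negf)
  then have "(\<integral>\<^sup>+x. ennreal (exp (- t * (norm x)\<^sup>2)) \<partial>(lborel :: 'a measure)) =
      (\<integral>\<^sup>+x. (\<Prod>b\<in>Basis. ennreal (exp (- t * (x \<bullet> b)\<^sup>2))) \<partial>(lborel :: 'a measure))"
    by (simp add: prod_ennreal)
  also have "\<dots> = (\<Prod>b\<in>(Basis::'a set). \<integral>\<^sup>+x. ennreal (exp (- t * x\<^sup>2)) \<partial>lborel)"
    by (rule nn_integral_lborel_prod) simp_all
  also have "\<dots> = ennreal (sqrt (pi / t) ^ DIM('a))"
    unfolding nn_integral_gaussian_real[OF t] using t by (simp add: ennreal_power)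
  also have "sqrt (pi / t) ^ DIM('a) = (pi / t) powr (real DIM('a) / 2)"
    using t by (simp add: powr_half_sqrt[symmetric] powr_powr flip: powr_realpow)
  finally show ?thesis .
qed

lemma nn_integral_Gamma_scale:
  assumes a: "a > 0" and c: "c > 0"
  shows "(\<integral>\<^sup>+t. indicator {0<..} t * ennreal (t powr (a - 1) * exp (- c * t)) \<partial>lborel) =
    ennreal (Gamma a * c powr (- a))"
proof -
  have "ennreal (Gamma a) = (\<integral>\<^sup>+t. ennreal (indicator {0..} t * t powr (a - 1) / exp t) \<partial>lborel)"
    by (rule Gamma_conv_nn_integral_real[OF a])
  also have "\<dots> = ennreal c * (\<integral>\<^sup>+t. ennreal (indicator {0..} (0 + c * t) * (0 + c * t) powr (a - 1) / exp (0 + c * t)) \<partial>lborel)"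
    using c by (subst nn_integral_real_affine[of _ c 0]) simp_all
  also have "\<dots> = ennreal c * (\<integral>\<^sup>+t. ennreal (c powr (a - 1)) *
      (indicator {0<..} t * ennreal (t powr (a - 1) * exp (- c * t))) \<partial>lborel)"
  proof (intro arg_cong2[where f = "(*)"] refl nn_integral_cong)
    fix t :: real
    show "ennreal (indicator {0..} (0 + c * t) * (0 + c * t) powr (a - 1) / exp (0 + c * t)) =
      ennreal (c powr (a - 1)) * (indicator {0<..} t * ennreal (t powr (a - 1) * exp (- c * t)))"
      using c by (cases "t > 0"; cases "t = 0")
        (auto simp: indicator_def ennreal_mult[symmetric] powr_mult exp_minus divide_inverse zero_le_mult_iff mult_ac)
  qed
  also have "\<dots> = ennreal c * (ennreal (c powr (a - 1)) *
      (\<integral>\<^sup>+t. indicator {0<..} t * ennreal (t powr (a - 1) * exp (- c * t)) \<partial>lborel))"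
    by (subst nn_integral_cmult) simp_all
  also have "\<dots> = ennreal (c powr a) * (\<integral>\<^sup>+t. indicator {0<..} t * ennreal (t powr (a - 1) * exp (- c * t)) \<partial>lborel)"
    using c by (simp add: mult.assoc[symmetric] ennreal_mult[symmetric] powr_diff)
  finally have "ennreal (c powr (- a)) * ennreal (Gamma a) = ennreal (c powr (- a)) *
      (ennreal (c powr a) * (\<integral>\<^sup>+t. indicator {0<..} t * ennreal (t powr (a - 1) * exp (- c * t)) \<partial>lborel))"
    by (rule arg_cong)
  also have "\<dots> = (\<integral>\<^sup>+t. indicator {0<..} t * ennreal (t powr (a - 1) * exp (- c * t)) \<partial>lborel)"
    using c by (simp add: mult.assoc[symmetric] ennreal_mult[symmetric] flip: powr_add)
  finally show ?thesis using c a by (simp add: ennreal_mult[symmetric] mult.commute Gamma_real_nonneg)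
qed

text \<open>Write \<open>(1 + |y|\<^sup>2)\<^sup>-\<^sup>a\<close> as a Gamma integral and integrate the Gaussian in \<open>y\<close> first.\<close>
lemma nn_integral_bessel_weight:
  assumes a: "a > 0"
  shows "ennreal (Gamma a) * (\<integral>\<^sup>+y. ennreal ((1 + (norm y)\<^sup>2) powr (- a)) \<partial>(lborel :: 'a::euclidean_space measure)) =
    ennreal (pi powr (real DIM('a) / 2)) *
      (\<integral>\<^sup>+t. indicator {0<..} t * ennreal (t powr (a - real DIM('a) / 2 - 1) * exp (- t)) \<partial>lborel)"
proof -
  let ?N = "real DIM('a) / 2"
  have pos: "1 + (norm y)\<^sup>2 > 0" for y :: 'a by (simp add: add_pos_nonneg)
  define H where "H y t = indicator {0<..} t * ennreal (t powr (a - 1) * exp (- (1 + (norm y)\<^sup>2) * t))"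
    for y :: 'a and t :: real
  have "ennreal (Gamma a) * (\<integral>\<^sup>+y. ennreal ((1 + (norm y)\<^sup>2) powr (- a)) \<partial>(lborel :: 'a measure)) =
      (\<integral>\<^sup>+y. \<integral>\<^sup>+t. H y t \<partial>lborel \<partial>(lborel :: 'a measure))"
    unfolding H_def nn_integral_Gamma_scale[OF a pos]
    using a by (subst nn_integral_cmult[symmetric]) (simp_all add: ennreal_mult)
  also have "\<dots> = (\<integral>\<^sup>+t. \<integral>\<^sup>+y. H y t \<partial>(lborel :: 'a measure) \<partial>lborel)"
    by (rule lborel_pair.Fubini'[symmetric]) (simp add: H_def, measurable)
  also have "\<dots> = (\<integral>\<^sup>+t. ennreal (pi powr ?N) *
      (indicator {0<..} t * ennreal (t powr (a - ?N - 1) * exp (- t))) \<partial>lborel)"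
  proof (rule nn_integral_cong)
    fix t :: real
    show "(\<integral>\<^sup>+y. H y t \<partial>(lborel :: 'a measure)) =
        ennreal (pi powr ?N) * (indicator {0<..} t * ennreal (t powr (a - ?N - 1) * exp (- t)))"
    proof (cases "t > 0")
      case True
      have "H y t = ennreal (t powr (a - 1) * exp (- t)) * ennreal (exp (- t * (norm y)\<^sup>2))" for y :: 'a
        using True by (simp add: H_def ennreal_mult[symmetric] algebra_simps flip: exp_add)
      then have "(\<integral>\<^sup>+y. H y t \<partial>(lborel :: 'a measure)) =
          ennreal (t powr (a - 1) * exp (- t)) * ennreal ((pi / t) powr ?N)"
        using nn_integral_gaussian[OF True, where ?'a = 'a] by (simp add: nn_integral_cmult)
      also have "\<dots> = ennreal (pi powr ?N) * ennreal (t powr (a - ?N - 1) * exp (- t))"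
      proof -
        have "t powr (a - 1) = t powr (a - ?N - 1) * t powr ?N" by (simp flip: powr_add)
        then show ?thesis using True by (simp add: ennreal_mult[symmetric] powr_divide)
      qed
      finally show ?thesis using True by simp
    qed (simp add: H_def)
  qed
  also have "\<dots> = ennreal (pi powr ?N) *
      (\<integral>\<^sup>+t. indicator {0<..} t * ennreal (t powr (a - ?N - 1) * exp (- t)) \<partial>lborel)"
    by (rule nn_integral_cmult) simp
  finally show ?thesis .
qed

lemma nn_integral_bessel_weight_finite:
  assumes a: "a > real DIM('a::euclidean_space) / 2"
  shows "(\<integral>\<^sup>+y. ennreal ((1 + (norm y)\<^sup>2) powr (- a)) \<partial>(lborel :: 'a measure)) =
    ennreal (pi powr (real DIM('a) / 2) * Gamma (a - real DIM('a) / 2) / Gamma a)"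
proof -
  let ?N = "real DIM('a) / 2" and ?J = "\<integral>\<^sup>+y. ennreal ((1 + (norm y)\<^sup>2) powr (- a)) \<partial>(lborel :: 'a measure)"
  have a0: "a > 0" using a by (smt (verit) divide_nonneg_nonneg of_nat_0_le_iff)
  have G: "Gamma a > 0" "Gamma (a - ?N) > 0" using a a0 by (auto intro: Gamma_real_pos)
  have "ennreal (Gamma a) * ?J = ennreal (pi powr ?N) * ennreal (Gamma (a - ?N))"
    using nn_integral_bessel_weight[OF a0, where ?'a = 'a] nn_integral_Gamma_scale[of "a - ?N" 1] a
    by simp
  then have "ennreal (1 / Gamma a) * (ennreal (Gamma a) * ?J) =
      ennreal (1 / Gamma a) * ennreal (pi powr ?N * Gamma (a - ?N))"
    using G by (simp add: ennreal_mult)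
  moreover have "ennreal (1 / Gamma a) * (ennreal (Gamma a) * X) = X" for X
    using G by (simp add: mult.assoc[symmetric] ennreal_mult[symmetric])
  moreover have "ennreal (1 / Gamma a) * ennreal (pi powr ?N * Gamma (a - ?N)) =
      ennreal (pi powr ?N * Gamma (a - ?N) / Gamma a)"
    using G by (simp add: ennreal_mult[symmetric])
  ultimately show ?thesis by simp
qed

text \<open>At a = N/2 the remaining Gamma integral has exponent -1 and diverges logarithmically at
  0: its part over the interval from exp(-n) to 1 is at least n/e.\<close>

lemma nn_integral_bessel_weight_critical:
  "(\<integral>\<^sup>+y. ennreal ((1 + (norm y)\<^sup>2) powr (- (real DIM('a) / 2))) \<partial>(lborel :: 'a::euclidean_space measure)) = \<infinity>"
  (is "?J = _")
proof -
  let ?I = "\<integral>\<^sup>+t. indicator {0<..} t * ennreal (t powr (- 1) * exp (- t)) \<partial>lborel"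
  have "ennreal (real n * exp (- 1)) \<le> ?I" for n
  proof -
    have "ennreal (exp (- 1) * ln 1 - exp (- 1) * ln (exp (- real n))) =
        (\<integral>\<^sup>+t\<in>{exp (- real n)..1}. ennreal (exp (- 1) / t) \<partial>lborel)"
    proof (rule nn_integral_FTC_Icc[symmetric])
      fix t assume "t \<in> {exp (- real n)..1}"
      then have "t > 0" by (meson atLeastAtMost_iff exp_gt_zero less_le_trans)
      then show "((\<lambda>t. exp (- 1) * ln t) has_real_derivative exp (- 1) / t) (at t)" "0 \<le> exp (- 1) / t"
        by (auto intro!: derivative_eq_intros)
    qed simp_all
    also have "\<dots> \<le> ?I"
    proof (rule nn_integral_mono)
      fix t :: real
      show "ennreal (exp (- 1) / t) * indicator {exp (- real n)..1} t \<le>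
          indicator {0<..} t * ennreal (t powr (- 1) * exp (- t))"
      proof (cases "t \<in> {exp (- real n)..1}")
        case True
        then have t: "t > 0" "t \<le> 1" by (auto intro: less_le_trans[OF exp_gt_zero])
        then have "exp (- 1) / t \<le> t powr (- 1) * exp (- t)"
          by (simp add: powr_minus_divide divide_simps)
        then show ?thesis using True t by (simp add: ennreal_leI)
      qed simp
    qed
    finally show ?thesis by (simp add: mult.commute)
  qed
  then have I: "?I = \<infinity>"
  proof (cases ?I)
    case (real r)
    obtain n where "r / exp (- 1) < real n" using reals_Archimedean2 by blast
    then have "r < real n * exp (- 1)" by (simp add: divide_less_eq)
    moreover have "real n * exp (- 1) \<le> r"
      using \<open>\<And>n. ennreal (real n * exp (- 1)) \<le> ?I\<close>[of n] real by simp
    ultimately show ?thesis by simp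
  qed simp
  have "ennreal (Gamma (real DIM('a) / 2)) * ?J = ennreal (pi powr (real DIM('a) / 2)) * ?I"
    using nn_integral_bessel_weight[of "real DIM('a) / 2", where ?'a = 'a] by simp
  also have "\<dots> = \<infinity>" unfolding I by (simp add: ennreal_mult_top)
  finally show ?thesis
    by (metis ennreal_mult_eq_top_iff ennreal_neq_top infinity_ennreal_def)
qed

lemma nn_integral_sphere_stereo:
  fixes h :: "'a::euclidean_space \<times> real \<Rightarrow> ennreal"
  assumes "h \<in> borel_measurable (restrict_space borel (sphere 0 1))"
  shows "integral\<^sup>N sphere_measure h = (\<integral>\<^sup>+y. ennreal (conf_factor y ^ DIM('a)) * h (stereo_inv y) \<partial>lborel)"
proof -
  have "(\<lambda>y. h (stereo_inv y)) \<in> borel_measurable borel"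
    using measurable_compose[OF stereo_inv_measurable assms] .
  then show ?thesis
    unfolding sphere_measure_stereo using assms
    by (simp add: nn_integral_distr nn_integral_density)
qed

text \<open>At the south pole, the distance to \<open>\<sigma>\<^sup>-\<^sup>1(y)\<close> depends on \<open>|y|\<close> only.\<close>
lemma riesz_mass_eq:
  fixes e :: "'a::euclidean_space \<times> real"
  assumes e: "norm e = 1" and b: "b \<ge> 0"
  shows "riesz_mass b e = ennreal (2 ^ DIM('a) * 4 powr (- b)) *
    (\<integral>\<^sup>+y. ennreal ((1 + (norm y)\<^sup>2) powr (- (real DIM('a) - b))) \<partial>(lborel :: 'a measure))"
proof -
  let ?s = "(0, - 1) :: 'a \<times> real"
  have D: "DIM('a \<times> real) \<ge> 2" by (simp add: Suc_leI)
  have dist: "(norm (?s - stereo_inv y))\<^sup>2 = 4 / (1 + (norm y)\<^sup>2)" for y :: 'a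
  proof -
    have pos: "1 + (norm y)\<^sup>2 \<noteq> 0" by (metis add_pos_nonneg less_irrefl zero_le_power2 zero_less_one)
    have "(norm (?s - stereo_inv y))\<^sup>2 = (norm ?s)\<^sup>2 + (norm (stereo_inv y))\<^sup>2 - 2 * (?s \<bullet> stereo_inv y)"
      by (simp add: power2_norm_eq_inner inner_diff_left inner_diff_right inner_commute)
    also have "\<dots> = 2 + 2 * ((1 - (norm y)\<^sup>2) / (1 + (norm y)\<^sup>2))"
    proof -
      have "?s \<bullet> stereo_inv y = - ((1 - (norm y)\<^sup>2) / (1 + (norm y)\<^sup>2))"
        by (simp add: stereo_inv_def minus_divide_left)
      then show ?thesis by (simp add: norm_stereo_inv norm_Pair)
    qed
    also have "\<dots> = 4 / (1 + (norm y)\<^sup>2)" using pos by (simp add: field_simps)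
    finally show ?thesis .
  qed
  have "riesz_mass b e = riesz_mass b ?s"
    by (rule riesz_mass_rotation[OF e _ D b]) (simp add: norm_Pair)
  also have "\<dots> = (\<integral>\<^sup>+y. ennreal (conf_factor y ^ DIM('a)) * ennreal (norm (?s - stereo_inv y) powr (- 2 * b)) \<partial>lborel)"
    unfolding riesz_mass_def by (rule nn_integral_sphere_stereo) (intro measurable_restrict_space1, measurable)
  also have "\<dots> = (\<integral>\<^sup>+y. ennreal (2 ^ DIM('a) * 4 powr (- b)) *
      ennreal ((1 + (norm y)\<^sup>2) powr (- (real DIM('a) - b))) \<partial>(lborel :: 'a measure))"
  proof (rule nn_integral_cong)
    fix y :: 'a
    have pos: "1 + (norm y)\<^sup>2 > 0" by (simp add: add_pos_nonneg)
    have "norm (?s - stereo_inv y) powr (- 2 * b) = ((norm (?s - stereo_inv y))\<^sup>2) powr (- b)"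
      by (simp add: powr_powr flip: powr_numeral)
    also have "\<dots> = 4 powr (- b) * (1 + (norm y)\<^sup>2) powr b"
      unfolding dist using pos by (simp add: powr_divide powr_minus_divide)
    finally have 1: "norm (?s - stereo_inv y) powr (- 2 * b) = 4 powr (- b) * (1 + (norm y)\<^sup>2) powr b" .
    have 2: "conf_factor y ^ DIM('a) = 2 ^ DIM('a) * (1 + (norm y)\<^sup>2) powr (- real DIM('a))"
      using pos by (simp add: conf_factor_def power_divide powr_minus_divide powr_realpow)
    have 3: "(1 + (norm y)\<^sup>2) powr (- (real DIM('a) - b)) =
        (1 + (norm y)\<^sup>2) powr (- real DIM('a)) * (1 + (norm y)\<^sup>2) powr b"
      by (simp flip: powr_add)
    show "ennreal (conf_factor y ^ DIM('a)) * ennreal (norm (?s - stereo_inv y) powr (- 2 * b)) =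
      ennreal (2 ^ DIM('a) * 4 powr (- b)) * ennreal ((1 + (norm y)\<^sup>2) powr (- (real DIM('a) - b)))"
      unfolding 1 2 3 by (simp add: ennreal_mult[symmetric] mult_ac)
  qed
  also have "\<dots> = ennreal (2 ^ DIM('a) * 4 powr (- b)) *
      (\<integral>\<^sup>+y. ennreal ((1 + (norm y)\<^sup>2) powr (- (real DIM('a) - b))) \<partial>(lborel :: 'a measure))"
    by (rule nn_integral_cmult) simp
  finally show ?thesis .
qed

text \<open>The integral of |e - \<zeta>|^(s-N) over the N-sphere for 0 < s \<le> 1. The pole of
  \<open>Gamma (s / 2)\<close> at 0 reflects the infinite mass of the critical kernel.\<close>

definition riesz_value :: "nat \<Rightarrow> real \<Rightarrow> real" where
  "riesz_value N s = 2 powr s * pi powr (real N / 2) * Gamma (s / 2) / Gamma ((real N + s) / 2)"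

lemma riesz_mass_subcritical:
  fixes e :: "'a::euclidean_space \<times> real"
  assumes "norm e = 1" "0 < s" "s \<le> 1"
  shows "riesz_mass ((real DIM('a) - s) / 2) e = ennreal (riesz_value DIM('a) s)"
proof -
  let ?N = "real DIM('a)"
  have N: "?N \<ge> 1" by (simp add: Suc_leI)
  have half: "?N - (?N - s) / 2 = (?N + s) / 2" "(?N + s) / 2 - ?N / 2 = s / 2" by (simp_all add: field_simps)
  have const: "2 ^ DIM('a) * 4 powr (- ((?N - s) / 2)) = 2 powr s"
  proof -
    have "(4::real) powr (- ((?N - s) / 2)) = (2 powr 2) powr (- ((?N - s) / 2))" by simp
    also have "2 * - ((?N - s) / 2) = s - ?N" by (simp add: field_simps)
    then have "(2 powr 2) powr (- ((?N - s) / 2)) = (2::real) powr (s - ?N)"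
      unfolding powr_powr by (rule arg_cong)
    finally show ?thesis by (simp add: powr_diff powr_realpow)
  qed
  have "riesz_mass ((?N - s) / 2) e = ennreal (2 powr s) *
      (\<integral>\<^sup>+y. ennreal ((1 + (norm y)\<^sup>2) powr (- ((?N + s) / 2))) \<partial>(lborel :: 'a measure))"
    using riesz_mass_eq[OF assms(1), of "(?N - s) / 2"] assms N unfolding half const by simp
  also have "\<dots> = ennreal (2 powr s) * ennreal (pi powr (?N / 2) * Gamma (s / 2) / Gamma ((?N + s) / 2))"
    using assms by (subst nn_integral_bessel_weight_finite) (simp_all add: half(2))
  also have "\<dots> = ennreal (riesz_value DIM('a) s)"
    using assms by (subst ennreal_mult[symmetric])
      (auto simp: riesz_value_def mult_ac intro!: divide_nonneg_nonneg mult_nonneg_nonneg Gamma_real_nonneg)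
  finally show ?thesis .
qed

text \<open>For b = N/2 the exponent N - b of the weight is again N/2, the borderline of
  integrability on the Euclidean space.\<close>

lemma riesz_mass_critical:
  fixes e :: "'a::euclidean_space \<times> real"
  assumes "norm e = 1"
  shows "riesz_mass (real DIM('a) / 2) e = \<infinity>"
proof -
  have "real DIM('a) - real DIM('a) / 2 = real DIM('a) / 2" by (simp add: field_simps)
  then show ?thesis
    using assms by (subst riesz_mass_eq)
      (simp_all add: nn_integral_bessel_weight_critical[simplified] ennreal_mult_top)
qed

section \<open>Pullback of the Riesz kernels to the Euclidean space\<close>

lemma norm_stereo_inv_diff:
  fixes x y :: "'a::euclidean_space"
  shows "(norm (stereo_inv x - stereo_inv y))\<^sup>2 = conf_factor x * conf_factor y * (norm (x - y))\<^sup>2"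
proof -
  define p q where "p = 1 + (norm x)\<^sup>2" and "q = 1 + (norm y)\<^sup>2"
  have pq: "p > 0" "q > 0" by (simp_all add: p_def q_def add_pos_nonneg)
  have nx: "1 + (norm x)\<^sup>2 = p" "1 - (norm x)\<^sup>2 = 2 - p" "1 + (norm y)\<^sup>2 = q" "1 - (norm y)\<^sup>2 = 2 - q"
    by (simp_all add: p_def q_def)
  have "(norm (stereo_inv x - stereo_inv y))\<^sup>2 =
      (norm (stereo_inv x))\<^sup>2 + (norm (stereo_inv y))\<^sup>2 - 2 * (stereo_inv x \<bullet> stereo_inv y)"
    by (simp add: power2_norm_eq_inner inner_diff_left inner_diff_right inner_commute)
  also have "\<dots> = 2 - 2 * (2 / p * (2 / q * (x \<bullet> y)) + (2 - p) / p * ((2 - q) / q))"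
  proof -
    have "stereo_inv x \<bullet> stereo_inv y = 2 / p * (2 / q * (x \<bullet> y)) + (2 - p) / p * ((2 - q) / q)"
      unfolding stereo_inv_def nx by simp
    then show ?thesis by (simp add: norm_stereo_inv)
  qed
  also have "\<dots> = 2 / p * (2 / q) * (p - 1 + (q - 1) - 2 * (x \<bullet> y))"
  proof -
    \<comment> \<open>These are the conformal factors of \<open>x\<close> and \<open>y\<close>. The
      relations P p = 2 and Q q = 2 turn the claim into a polynomial identity.\<close>
    define P Q where "P = 2 / p" and "Q = 2 / q"
    have PQ: "P * p = 2" "Q * q = 2" using pq by (simp_all add: P_def Q_def)
    have 1: "P * Q * (p - 1 + (q - 1) - 2 * c) = 2 * Q + P * 2 - 2 * (P * Q) - 2 * (P * Q) * c" for c
    proof -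
      have "P * Q * (p - 1 + (q - 1) - 2 * c) = (P * p) * Q + P * (Q * q) - 2 * (P * Q) - 2 * (P * Q) * c"
        by (simp add: algebra_simps)
      then show ?thesis by (simp only: PQ)
    qed
    have 2: "(2 - p) / p = P - 1" "(2 - q) / q = Q - 1"
      using pq by (simp_all add: P_def Q_def diff_divide_distrib)
    show ?thesis
      unfolding 2 P_def[symmetric] Q_def[symmetric] 1 by (simp add: algebra_simps)
  qed
  also have "p - 1 + (q - 1) - 2 * (x \<bullet> y) = (norm (x - y))\<^sup>2"
    by (simp add: p_def q_def power2_norm_eq_inner inner_diff_left inner_diff_right inner_commute)
  finally show ?thesis by (simp add: conf_factor_def p_def q_def)
qed

lemma norm_stereo_inv_diff_powr:
  "norm (stereo_inv x - stereo_inv y) powr c =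
    conf_factor x powr (c / 2) * conf_factor y powr (c / 2) * norm (x - y) powr c"
proof -
  have sq: "t powr c = (t\<^sup>2) powr (c / 2)" if "t \<ge> 0" for t :: real
    using that by (simp add: powr_powr flip: powr_numeral)
  show ?thesis
    using conf_factor_pos[of x] conf_factor_pos[of y]
    by (simp add: sq norm_stereo_inv_diff powr_mult)
qed

text \<open>Pullback of the Riesz mass at \<open>stereo_inv x\<close>. The Jacobian \<phi>(y)^N
  meets the kernel factor (\<phi>(x) \<phi>(y))^((s-N)/2), which leaves the weight
  \<phi>(y)^((N+s)/2) inside and \<phi>(x)^((s-N)/2) in front.\<close>

lemma nn_integral_conformal_riesz:
  fixes x :: "'a::euclidean_space"
  assumes s: "0 < s" "s \<le> 1"
  shows "(\<integral>\<^sup>+y. ennreal (conf_factor y powr ((real DIM('a) + s) / 2) * norm (x - y) powr (s - real DIM('a))) \<partial>lborel) =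
    ennreal (conf_factor x powr ((real DIM('a) - s) / 2) * riesz_value DIM('a) s)"
proof -
  let ?N = "real DIM('a)"
  let ?h = "\<lambda>y. conf_factor y powr ((?N + s) / 2) * norm (x - y) powr (s - ?N)"
  have cf: "conf_factor y > 0" for y :: 'a by (rule conf_factor_pos)
  have half: "- 2 * ((?N - s) / 2) = s - ?N" by (simp add: field_simps)
  have "ennreal (riesz_value DIM('a) s) = riesz_mass ((?N - s) / 2) (stereo_inv x)"
    by (rule riesz_mass_subcritical[symmetric]) (use s in \<open>auto simp: norm_stereo_inv\<close>)
  also have "\<dots> = (\<integral>\<^sup>+y. ennreal (conf_factor y ^ DIM('a)) *
      ennreal (norm (stereo_inv x - stereo_inv y) powr (s - ?N)) \<partial>lborel)"
    unfolding riesz_mass_def half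
    by (rule nn_integral_sphere_stereo) (intro measurable_restrict_space1, measurable)
  also have "\<dots> = (\<integral>\<^sup>+y. ennreal (conf_factor x powr ((s - ?N) / 2)) * ennreal (?h y) \<partial>lborel)"
  proof (rule nn_integral_cong)
    fix y :: 'a
    have "conf_factor y powr ((?N + s) / 2) = conf_factor y ^ DIM('a) * conf_factor y powr ((s - ?N) / 2)"
    proof -
      have half': "(?N + s) / 2 = ?N + (s - ?N) / 2" by (simp add: field_simps)
      show ?thesis unfolding half' powr_add using cf[of y] by (simp add: powr_realpow)
    qed
    then show "ennreal (conf_factor y ^ DIM('a)) * ennreal (norm (stereo_inv x - stereo_inv y) powr (s - ?N)) =
        ennreal (conf_factor x powr ((s - ?N) / 2)) * ennreal (?h y)"
      using cf[of x] cf[of y] by (simp add: norm_stereo_inv_diff_powr ennreal_mult[symmetric] mult_ac)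
  qed
  also have "\<dots> = ennreal (conf_factor x powr ((s - ?N) / 2)) * (\<integral>\<^sup>+y. ennreal (?h y) \<partial>lborel)"
    by (rule nn_integral_cmult) simp
  finally have "ennreal (conf_factor x powr ((?N - s) / 2)) * ennreal (riesz_value DIM('a) s) =
      ennreal (conf_factor x powr ((?N - s) / 2)) *
        (ennreal (conf_factor x powr ((s - ?N) / 2)) * (\<integral>\<^sup>+y. ennreal (?h y) \<partial>lborel))"
    by (rule arg_cong)
  also have "\<dots> = (\<integral>\<^sup>+y. ennreal (?h y) \<partial>lborel)"
  proof -
    have "conf_factor x powr ((?N - s) / 2) * conf_factor x powr ((s - ?N) / 2) = 1"
    proof -
      have "(?N - s) / 2 + (s - ?N) / 2 = 0" by (simp add: field_simps)
      then show ?thesis using cf[of x] by (simp flip: powr_add)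
    qed
    then have "ennreal (conf_factor x powr ((?N - s) / 2)) * ennreal (conf_factor x powr ((s - ?N) / 2)) = 1"
      by (simp add: ennreal_mult[symmetric])
    then show ?thesis by (simp only: mult.assoc[symmetric] mult_1)
  qed
  finally show ?thesis by (simp add: ennreal_mult')
qed

text \<open>Layer-cake argument: with \<alpha> = N - s and 0 < |x - y| < 1, the kernel is 1 plus the
  integral of \<alpha> r^(-\<alpha>-1) over r from |x - y| to 1. Fubini's theorem reduces everything
  to volumes of balls, and V + \<alpha> V / s = N V / s for V the volume of the unit ball.\<close>

lemma nn_integral_ball_powr:
  fixes x :: "'a::euclidean_space"
  assumes s: "0 < s" "s \<le> real DIM('a)"
  shows "(\<integral>\<^sup>+y. indicator (ball x 1) y * ennreal (norm (x - y) powr (s - real DIM('a))) \<partial>lborel) =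
    ennreal (real DIM('a) * unit_ball_vol (real DIM('a)) / s)"
proof -
  let ?N = "real DIM('a)" and ?V = "unit_ball_vol (real DIM('a))"
  define \<alpha> where "\<alpha> = ?N - s"
  have \<alpha>: "\<alpha> \<ge> 0" using s by (simp add: \<alpha>_def)
  have V: "?V \<ge> 0" by (simp add: unit_ball_vol_def Gamma_real_nonneg)
  \<comment> \<open>Integrated in \<open>r\<close> this is the excess of the kernel over 1 on the
    ball; integrated in \<open>y\<close> it is a multiple of the volume of the ball of radius
    \<open>r\<close>.\<close>
  define K where "K y r = indicator {0<..1} r * ennreal (\<alpha> * r powr (- \<alpha> - 1)) * indicator (ball x r) y"
    for y :: 'a and r :: real
  have K_eq: "K y r = (if 0 < r \<and> r \<le> 1 \<and> dist x y < r then ennreal (\<alpha> * r powr (- \<alpha> - 1)) else 0)" for y r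
    by (auto simp: K_def indicator_def)
  have K_meas: "(\<lambda>(y, r). K y r) \<in> borel_measurable (borel \<Otimes>\<^sub>M borel)"
    unfolding K_eq by measurable
  have "(\<integral>\<^sup>+y. indicator (ball x 1) y * ennreal (norm (x - y) powr (s - ?N)) \<partial>lborel) =
      (\<integral>\<^sup>+y. indicator (ball x 1) y + (\<integral>\<^sup>+r. K y r \<partial>lborel) \<partial>lborel)"
  proof (rule nn_integral_cong_AE)
    show "AE y in lborel. indicator (ball x 1) y * ennreal (norm (x - y) powr (s - ?N)) =
        indicator (ball x 1) y + (\<integral>\<^sup>+r. K y r \<partial>lborel)"
      using AE_lborel_singleton[of x]
    proof eventually_elim
      case (elim y)
      define \<rho> where "\<rho> = norm (x - y)"
      have \<rho>: "\<rho> > 0" using elim by (simp add: \<rho>_def)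
      have dist: "dist x y = \<rho>" by (simp add: \<rho>_def dist_norm)
      show ?case
      proof (cases "\<rho> < 1")
        case True
        have "(\<integral>\<^sup>+r. K y r \<partial>lborel) = (\<integral>\<^sup>+r\<in>{\<rho>..1}. ennreal (\<alpha> * r powr (- \<alpha> - 1)) \<partial>lborel)"
        proof (rule nn_integral_cong_AE)
          show "AE r in lborel. K y r = ennreal (\<alpha> * r powr (- \<alpha> - 1)) * indicator {\<rho>..1} r"
            using AE_lborel_singleton[of \<rho>]
            by eventually_elim (use \<rho> in \<open>auto simp: K_eq indicator_def dist\<close>)
        qed
        also have "\<dots> = ennreal (- (1 powr (- \<alpha>)) - - (\<rho> powr (- \<alpha>)))"
        proof (rule nn_integral_FTC_Icc)
          fix r assume "r \<in> {\<rho>..1}"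
          then have "r > 0" using \<rho> by auto
          then show "((\<lambda>r. - (r powr (- \<alpha>))) has_real_derivative \<alpha> * r powr (- \<alpha> - 1)) (at r)"
            by (auto intro!: derivative_eq_intros)
          show "0 \<le> \<alpha> * r powr (- \<alpha> - 1)" using \<alpha> by simp
        qed (use True in auto)
        finally have "1 + (\<integral>\<^sup>+r. K y r \<partial>lborel) = ennreal 1 + ennreal (\<rho> powr (- \<alpha>) - 1)" by simp
        also have "\<dots> = ennreal (\<rho> powr (- \<alpha>))"
        proof -
          have "1 \<le> \<rho> powr (- \<alpha>)" using \<rho> True \<alpha> powr_mono2[of \<alpha> \<rho> 1] by (simp add: powr_minus_divide)
          then show ?thesis by (subst ennreal_plus[symmetric]) auto
        qed
        finally show ?thesis using True by (simp add: \<alpha>_def \<rho>_def dist_norm)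
      next
        case False
        then have "K y r = 0" for r by (auto simp: K_eq \<rho>_def dist_norm)
        then show ?thesis using False by (simp add: \<rho>_def dist_norm)
      qed
    qed
  qed
  also have "\<dots> = (\<integral>\<^sup>+y. indicator (ball x 1) y \<partial>lborel) + (\<integral>\<^sup>+y. \<integral>\<^sup>+r. K y r \<partial>lborel \<partial>lborel)"
    using K_meas
    by (intro nn_integral_add lborel.borel_measurable_nn_integral) (auto intro!: borel_measurable_indicator)
  also have "(\<integral>\<^sup>+y. \<integral>\<^sup>+r. K y r \<partial>lborel \<partial>lborel) = (\<integral>\<^sup>+r. \<integral>\<^sup>+y. K y r \<partial>lborel \<partial>lborel)"
    using K_meas by (intro lborel_pair.Fubini'[symmetric]) simp
  also have "\<dots> = (\<integral>\<^sup>+r. ennreal (indicator {0..1} r * (\<alpha> * ?V * r powr (s - 1))) \<partial>lborel)"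
  proof (rule nn_integral_cong_AE)
    show "AE r in lborel. (\<integral>\<^sup>+y. K y r \<partial>lborel) = ennreal (indicator {0..1} r * (\<alpha> * ?V * r powr (s - 1)))"
      using AE_lborel_singleton[of 0]
    proof eventually_elim
      case (elim r)
      show ?case
      proof (cases "0 < r \<and> r \<le> 1")
        case True
        have "(\<integral>\<^sup>+y. K y r \<partial>lborel) = ennreal (\<alpha> * r powr (- \<alpha> - 1)) * (\<integral>\<^sup>+y. indicator (ball x r) y \<partial>lborel)"
        proof -
          have "K y r = ennreal (\<alpha> * r powr (- \<alpha> - 1)) * indicator (ball x r) y" for y
            unfolding K_def using True by simp
          then show ?thesis by (simp only:) (rule nn_integral_cmult, auto intro!: borel_measurable_indicator)
        qed
        also have "\<dots> = ennreal (\<alpha> * r powr (- \<alpha> - 1)) * ennreal (?V * r ^ DIM('a))"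
          using True emeasure_ball[of r x] by simp
        also have "\<dots> = ennreal (\<alpha> * ?V * r powr (s - 1))"
        proof -
          have "r powr (- \<alpha> - 1) * r ^ DIM('a) = r powr (s - 1)"
            using True by (simp add: \<alpha>_def flip: powr_realpow powr_add)
          then show ?thesis using \<alpha> V True by (simp add: ennreal_mult[symmetric] mult_ac)
        qed
        finally show ?thesis using True by (simp add: indicator_def)
      next
        case False
        then have "K y r = 0" for y by (auto simp: K_eq)
        then show ?thesis using False elim by (auto simp: indicator_def)
      qed
    qed
  qed
  also have "\<dots> = ennreal (\<alpha> * ?V * (1 powr (s - 1 + 1) / (s - 1 + 1)))"
    using has_integral_mult_right[OF has_integral_powr_from_0[of "s - 1" 1], of "\<alpha> * ?V"] s \<alpha> V
    by (intro nn_integral_has_integral_lebesgue) auto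
  also have "(\<integral>\<^sup>+y. indicator (ball x 1) y \<partial>lborel) = ennreal ?V"
    using emeasure_ball[of 1 x] by simp
  also have "ennreal ?V + ennreal (\<alpha> * ?V * (1 powr (s - 1 + 1) / (s - 1 + 1))) = ennreal (?N * ?V / s)"
    using s V \<alpha> by (subst ennreal_plus[symmetric]) (auto simp: \<alpha>_def field_simps)
  finally show ?thesis .
qed

section \<open>Estimates for the conformal factor\<close>

lemma powr_neg_one_plus_diff:
  fixes p q a :: real
  assumes "a \<ge> 0" "p \<ge> 0" "q \<ge> 0"
  shows "\<bar>(1 + p) powr (- a) - (1 + q) powr (- a)\<bar> \<le> a * \<bar>p - q\<bar>"
proof -
  have "norm ((1 + p) powr (- a) - (1 + q) powr (- a)) \<le> a * norm (p - q)"
  proof (rule field_differentiable_bound[where S = "{0..}" and f' = "\<lambda>t. - a * (1 + t) powr (- a - 1)"])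
    fix t :: real assume t: "t \<in> {0..}"
    then show "((\<lambda>t. (1 + t) powr (- a)) has_field_derivative - a * (1 + t) powr (- a - 1)) (at t within {0..})"
      by (auto intro!: derivative_eq_intros)
    have "(1 + t) powr (- a - 1) \<le> (1 + t) powr 0"
      using t assms(1) by (intro powr_mono) auto
    then show "norm (- a * (1 + t) powr (- a - 1)) \<le> a"
      using t assms(1) by (simp add: abs_mult mult_left_le)
  qed (use assms in auto)
  then show ?thesis by simp
qed

text \<open>The constant depends on the upper bound \<open>A\<close> but not on the exponent
  \<open>a\<close>, which is what makes the later domination uniform in \<open>s\<close>.\<close>

lemma conf_factor_powr_lipschitz:
  fixes x y :: "'a::euclidean_space"
  assumes a: "0 \<le> a" "a \<le> A" and xy: "norm (x - y) \<le> 1"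
  shows "\<bar>conf_factor y powr a - conf_factor x powr a\<bar> \<le> 2 powr A * A * (2 * norm x + 1) * norm (x - y)"
proof -
  have cf: "conf_factor z powr a = 2 powr a * (1 + (norm z)\<^sup>2) powr (- a)" for z :: 'a
    by (simp add: conf_factor_def powr_divide powr_minus_divide)
  have "\<bar>conf_factor y powr a - conf_factor x powr a\<bar> =
      2 powr a * \<bar>(1 + (norm y)\<^sup>2) powr (- a) - (1 + (norm x)\<^sup>2) powr (- a)\<bar>"
    unfolding cf by (simp add: abs_mult flip: right_diff_distrib)
  also have "\<dots> \<le> 2 powr A * (A * \<bar>(norm y)\<^sup>2 - (norm x)\<^sup>2\<bar>)"
  proof (rule mult_mono)
    show "2 powr a \<le> 2 powr A" using a by simp
    have "\<bar>(1 + (norm y)\<^sup>2) powr (- a) - (1 + (norm x)\<^sup>2) powr (- a)\<bar> \<le> a * \<bar>(norm y)\<^sup>2 - (norm x)\<^sup>2\<bar>"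
      using a by (intro powr_neg_one_plus_diff) auto
    also have "\<dots> \<le> A * \<bar>(norm y)\<^sup>2 - (norm x)\<^sup>2\<bar>" using a by (intro mult_right_mono) auto
    finally show "\<bar>(1 + (norm y)\<^sup>2) powr (- a) - (1 + (norm x)\<^sup>2) powr (- a)\<bar> \<le> A * \<bar>(norm y)\<^sup>2 - (norm x)\<^sup>2\<bar>" .
  qed auto
  also have "\<dots> \<le> 2 powr A * (A * ((2 * norm x + 1) * norm (x - y)))"
  proof (intro mult_left_mono)
    have "\<bar>(norm y)\<^sup>2 - (norm x)\<^sup>2\<bar> = (norm y + norm x) * \<bar>norm y - norm x\<bar>"
      by (simp add: power2_eq_square abs_mult square_diff_square_factored)
    also have "\<dots> \<le> (2 * norm x + 1) * norm (x - y)"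
      using norm_triangle_ineq3[of y x] xy norm_triangle_ineq2[of y x]
      by (intro mult_mono) (auto simp: norm_minus_commute)
    finally show "\<bar>(norm y)\<^sup>2 - (norm x)\<^sup>2\<bar> \<le> (2 * norm x + 1) * norm (x - y)" .
  qed (use a in auto)
  finally show ?thesis by (simp add: mult_ac)
qed

text \<open>Away from \<open>x\<close>, the decay of \<phi>(y) is no faster than |x - y|^(-2), with
  a constant depending on \<open>x\<close> only. Thus the negative powers of the product that occur
  outside the unit ball stay bounded.\<close>

lemma conf_factor_dist_lower:
  fixes x y :: "'a::euclidean_space"
  assumes "norm (x - y) \<ge> 1"
  shows "2 / (3 + 2 * (norm x)\<^sup>2) \<le> conf_factor y * (norm (x - y))\<^sup>2"
proof -
  define r where "r = norm (x - y)"
  have r: "r \<ge> 1" using assms by (simp add: r_def)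
  then have r2: "r\<^sup>2 \<ge> 1" by simp
  have "norm y \<le> norm x + r"
    unfolding r_def using norm_triangle_ineq4[of x "x - y"] by simp
  then have "(norm y)\<^sup>2 \<le> (norm x + r)\<^sup>2" by (intro power_mono) auto
  also have "\<dots> \<le> 2 * (norm x)\<^sup>2 + 2 * r\<^sup>2"
    using zero_le_power2[of "norm x - r"] by (simp add: power2_eq_square algebra_simps)
  finally have "1 + (norm y)\<^sup>2 \<le> 1 * r\<^sup>2 + 2 * (norm x)\<^sup>2 * r\<^sup>2 + 2 * r\<^sup>2"
    using r2 mult_left_mono[OF r2, of "2 * (norm x)\<^sup>2"] by simp
  then have "1 + (norm y)\<^sup>2 \<le> (3 + 2 * (norm x)\<^sup>2) * r\<^sup>2" by (simp add: algebra_simps)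
  moreover have "3 + 2 * (norm x)\<^sup>2 > 0" "1 + (norm y)\<^sup>2 > 0" by (simp_all add: add_pos_nonneg)
  ultimately show ?thesis by (simp add: conf_factor_def r_def[symmetric] divide_simps mult_ac)
qed

section \<open>Conformal covariance of the logarithmic Laplacian\<close>

text \<open>
  For \<open>s > 0\<close> both parts are integrable with known integrals. The exponent of \<open>\<phi>(x)\<close> is chosen such that the
  singularities at \<open>x\<close> cancel uniformly in \<open>s\<close>, which allows passing to \<open>s = 0\<close>.
\<close>
definition conf_defect :: "'a::euclidean_space \<Rightarrow> real \<Rightarrow> 'a \<Rightarrow> real" where
  "conf_defect x s y = (conf_factor y powr ((real DIM('a) + s) / 2)
      - conf_factor x powr ((real DIM('a) + s) / 2) * indicator (ball x 1) y)
    * norm (x - y) powr (s - real DIM('a))"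

lemma conf_defect_measurable [measurable]: "conf_defect x s \<in> borel_measurable borel"
proof -
  have "conf_defect x s = (\<lambda>y. (conf_factor y powr ((real DIM('a) + s) / 2)
      - conf_factor x powr ((real DIM('a) + s) / 2) * (if dist x y < 1 then 1 else 0))
    * norm (x - y) powr (s - real DIM('a)))"
    by (auto simp: conf_defect_def indicator_def fun_eq_iff)
  then show ?thesis by simp
qed

lemma riesz_value_nonneg: "s > 0 \<Longrightarrow> riesz_value N s \<ge> 0"
  unfolding riesz_value_def
  by (intro divide_nonneg_nonneg mult_nonneg_nonneg Gamma_real_nonneg) (auto intro: add_nonneg_pos)

lemma has_bochner_integral_conformal_riesz:
  fixes x :: "'a::euclidean_space"
  assumes s: "0 < s" "s \<le> 1"
  shows "has_bochner_integral lborel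
    (\<lambda>y. conf_factor y powr ((real DIM('a) + s) / 2) * norm (x - y) powr (s - real DIM('a)))
    (conf_factor x powr ((real DIM('a) - s) / 2) * riesz_value DIM('a) s)"
  using nn_integral_conformal_riesz[OF s, of x] riesz_value_nonneg[of s "DIM('a)"] s
  by (intro has_bochner_integral_nn_integral) auto

lemma has_bochner_integral_ball_powr:
  fixes x :: "'a::euclidean_space"
  assumes s: "0 < s" "s \<le> 1"
  shows "has_bochner_integral lborel (\<lambda>y. indicator (ball x 1) y * norm (x - y) powr (s - real DIM('a)))
    (real DIM('a) * unit_ball_vol (real DIM('a)) / s)"
proof -
  have N: "real DIM('a) \<ge> 1" by (simp add: Suc_leI)
  have "(\<integral>\<^sup>+y. ennreal (indicator (ball x 1) y * norm (x - y) powr (s - real DIM('a))) \<partial>lborel) =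
      ennreal (real DIM('a) * unit_ball_vol (real DIM('a)) / s)"
    using nn_integral_ball_powr[of s x] s N by (simp add: ennreal_mult' ennreal_indicator)
  then show ?thesis
    using s by (intro has_bochner_integral_nn_integral)
      (auto intro!: borel_measurable_times borel_measurable_indicator mult_nonneg_nonneg
        simp: unit_ball_vol_def Gamma_real_nonneg)
qed

lemma has_bochner_integral_conf_defect:
  fixes x :: "'a::euclidean_space"
  assumes s: "0 < s" "s \<le> 1"
  shows "has_bochner_integral lborel (conf_defect x s)
    (conf_factor x powr ((real DIM('a) - s) / 2) * riesz_value DIM('a) s
      - conf_factor x powr ((real DIM('a) + s) / 2) * (real DIM('a) * unit_ball_vol (real DIM('a)) / s))"
proof -
  let ?c = "conf_factor x powr ((real DIM('a) + s) / 2)"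
  have "has_bochner_integral lborel
    (\<lambda>y. conf_factor y powr ((real DIM('a) + s) / 2) * norm (x - y) powr (s - real DIM('a))
      - ?c * (indicator (ball x 1) y * norm (x - y) powr (s - real DIM('a))))
    (conf_factor x powr ((real DIM('a) - s) / 2) * riesz_value DIM('a) s
      - ?c * (real DIM('a) * unit_ball_vol (real DIM('a)) / s))"
    by (intro has_bochner_integral_diff has_bochner_integral_mult_right
        has_bochner_integral_conformal_riesz has_bochner_integral_ball_powr s)
  then show ?thesis by (simp add: conf_defect_def[abs_def] left_diff_distrib mult.assoc)
qed

text \<open>The majorant consists of the two kernels at s = 1, whose integrals are known. Inside the
  ball the Lipschitz bound turns the order N into N - 1. Outside, the integrand is its value at s =
  1 times \<rho>^(s-1), where \<rho> = sqrt(\<phi>(y)) |x - y| is bounded below.\<close>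

lemma conf_defect_bound:
  fixes x :: "'a::euclidean_space"
  obtains C where "C \<ge> 0"
    "\<And>s y. 0 \<le> s \<Longrightarrow> s \<le> 1 \<Longrightarrow> \<bar>conf_defect x s y\<bar> \<le> C * (indicator (ball x 1) y * norm (x - y) powr (1 - real DIM('a))
      + conf_factor y powr ((real DIM('a) + 1) / 2) * norm (x - y) powr (1 - real DIM('a)))"
proof -
  let ?N = "real DIM('a)"
  define A where "A = (?N + 1) / 2"
  define C1 where "C1 = 2 powr A * A * (2 * norm x + 1)"
  define c where "c = 2 / (3 + 2 * (norm x)\<^sup>2)"
  have c: "c > 0" unfolding c_def by (simp add: add_pos_nonneg)
  \<comment> \<open>The summand 1 bounds \<rho>^(s-1) for \<rho> \<ge> 1, and
    \<open>1 / sqrt c\<close> bounds it for smaller \<rho>.\<close>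
  define C2 where "C2 = 1 + 1 / sqrt c"
  have C1: "C1 \<ge> 0" unfolding C1_def A_def by simp
  have C2: "C2 \<ge> 0" unfolding C2_def using c by simp
  show ?thesis
  proof (rule that[of "C1 + C2"])
    show "C1 + C2 \<ge> 0" using C1 C2 by simp
    fix s :: real and y :: 'a
    assume s: "0 \<le> s" "s \<le> 1"
    let ?a = "(?N + s) / 2" and ?r = "norm (x - y)"
    let ?g = "?r powr (1 - ?N)" and ?h = "conf_factor y powr ((?N + 1) / 2)"
    have cf: "conf_factor y > 0" by (rule conf_factor_pos)
    show "\<bar>conf_defect x s y\<bar> \<le> (C1 + C2) * (indicator (ball x 1) y * ?g + ?h * ?g)"
    proof (cases "?r < 1")
      case True
      show ?thesis
      proof (cases "x = y")
        case False
        then have r: "?r > 0" by simp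
        have "\<bar>conf_defect x s y\<bar> = \<bar>conf_factor y powr ?a - conf_factor x powr ?a\<bar> * ?r powr (s - ?N)"
          using True by (simp add: conf_defect_def abs_mult dist_norm)
        also have "\<dots> \<le> (C1 * ?r) * ?r powr (- ?N)"
        proof (rule mult_mono)
          show "\<bar>conf_factor y powr ?a - conf_factor x powr ?a\<bar> \<le> C1 * ?r"
            unfolding C1_def using s True by (intro conf_factor_powr_lipschitz) (auto simp: A_def)
          show "?r powr (s - ?N) \<le> ?r powr (- ?N)"
            using r True s by (intro powr_mono') auto
        qed (use C1 in auto)
        also have "\<dots> = C1 * ?g" using r by (simp add: powr_diff powr_minus_divide)
        also have "\<dots> \<le> (C1 + C2) * (?g + ?h * ?g)"
          using C1 C2 by (intro mult_mono) auto
        finally show ?thesis using True by (simp add: dist_norm)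
      qed (use C1 C2 in \<open>simp add: conf_defect_def\<close>)
    next
      case False
      then have r: "?r \<ge> 1" by simp
      define \<rho> where "\<rho> = sqrt (conf_factor y) * ?r"
      have \<rho>: "\<rho> > 0" unfolding \<rho>_def using cf r by (intro mult_pos_pos) auto
      have "sqrt c \<le> \<rho>"
        unfolding \<rho>_def c_def using conf_factor_dist_lower[OF r]
        by (metis real_sqrt_le_mono real_sqrt_mult real_sqrt_abs abs_norm_cancel)
      have bound: "\<rho> powr (s - 1) \<le> C2"
      proof (cases "\<rho> \<ge> 1")
        case True
        then have "\<rho> powr (s - 1) \<le> \<rho> powr 0" using s by (intro powr_mono) auto
        moreover have "0 \<le> 1 / sqrt c" using c by simp
        moreover have "\<rho> powr 0 = 1" using \<rho> by simp
        ultimately show ?thesis unfolding C2_def by linarith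
      next
        case False
        then have "\<rho> powr (s - 1) \<le> \<rho> powr (- 1)" using s \<rho> by (intro powr_mono') auto
        also have "\<dots> = 1 / \<rho>" using \<rho> by (simp add: powr_minus_divide)
        also have "\<dots> \<le> 1 / sqrt c" using \<open>sqrt c \<le> \<rho>\<close> c by (intro divide_left_mono) (auto simp: \<rho>)
        finally show ?thesis unfolding C2_def by simp
      qed
      have "\<bar>conf_defect x s y\<bar> = conf_factor y powr ?a * ?r powr (s - ?N)"
        using False by (simp add: conf_defect_def dist_norm)
      also have "\<dots> = (?h * ?g) * \<rho> powr (s - 1)"
      proof -
        have "\<rho> powr (s - 1) = conf_factor y powr ((s - 1) / 2) * ?r powr (s - 1)"
          unfolding \<rho>_def using cf r by (simp add: powr_mult powr_powr flip: powr_half_sqrt)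
        moreover have "?h * conf_factor y powr ((s - 1) / 2) = conf_factor y powr ?a"
        proof -
          have "(?N + 1) / 2 + (s - 1) / 2 = ?a" by (simp add: field_simps)
          then show ?thesis by (simp only: flip: powr_add)
        qed
        moreover have "?g * ?r powr (s - 1) = ?r powr (s - ?N)"
          by (simp flip: powr_add)
        ultimately show ?thesis by (metis mult.assoc mult.left_commute)
      qed
      also have "\<dots> \<le> (?h * ?g) * C2"
        using bound by (intro mult_left_mono) auto
      also have "\<dots> \<le> (C1 + C2) * (?h * ?g)"
        using C1 by (simp add: distrib_right mult.commute)
      finally show ?thesis using False by (simp add: dist_norm)
    qed
  qed
qed

text \<open>The majorant is independent of \<open>s\<close>, so it yields integrability at s = 0 as
  well as domination. The sequence 1/(n+1) stays in the range 0 < s \<le> 1 of the explicit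
  integrals.\<close>

lemma conf_defect_integral_tendsto:
  fixes x :: "'a::euclidean_space"
  shows "integrable lborel (conf_defect x 0)"
    and "(\<lambda>n. integral\<^sup>L lborel (conf_defect x (inverse (real (Suc n))))) \<longlonglongrightarrow> integral\<^sup>L lborel (conf_defect x 0)"
proof -
  let ?N = "real DIM('a)"
  obtain C where C: "C \<ge> 0"
    "\<And>s y. 0 \<le> s \<Longrightarrow> s \<le> 1 \<Longrightarrow> \<bar>conf_defect x s y\<bar> \<le> C * (indicator (ball x 1) y * norm (x - y) powr (1 - ?N)
      + conf_factor y powr ((?N + 1) / 2) * norm (x - y) powr (1 - ?N))"
    by (rule conf_defect_bound) (rule that)
  let ?w = "\<lambda>y. C * (indicator (ball x 1) y * norm (x - y) powr (1 - ?N)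
      + conf_factor y powr ((?N + 1) / 2) * norm (x - y) powr (1 - ?N))"
  have w: "integrable lborel ?w"
    using has_bochner_integral_ball_powr[of 1 x] has_bochner_integral_conformal_riesz[of 1 x]
    by (intro integrable_mult_right Bochner_Integration.integrable_add) (auto dest: integrable.intros)
  show "integrable lborel (conf_defect x 0)"
    by (rule Bochner_Integration.integrable_bound[OF w])
      (use C(2)[of 0] in \<open>auto intro!: AE_I2 order_trans[OF _ abs_ge_self]\<close>)
  show "(\<lambda>n. integral\<^sup>L lborel (conf_defect x (inverse (real (Suc n))))) \<longlonglongrightarrow> integral\<^sup>L lborel (conf_defect x 0)"
  proof (rule integral_dominated_convergence[OF _ _ w])
    show "AE y in lborel. norm (conf_defect x (inverse (real (Suc n))) y) \<le> ?w y" for n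
      using C(2)[of "inverse (real (Suc n))"] by (intro AE_I2) (simp add: inverse_le_1_iff)
    show "AE y in lborel. (\<lambda>n. conf_defect x (inverse (real (Suc n))) y) \<longlonglongrightarrow> conf_defect x 0 y"
      using AE_lborel_singleton[of x]
    proof eventually_elim
      case (elim y)
      have cf: "conf_factor x \<noteq> 0" "conf_factor y \<noteq> 0"
        using conf_factor_pos[of x] conf_factor_pos[of y] by simp_all
      have "((\<lambda>s. conf_defect x s y) \<longlongrightarrow> conf_defect x 0 y) (at 0)"
        unfolding conf_defect_def using elim cf by (intro tendsto_intros) auto
      moreover have "filterlim (\<lambda>n. inverse (real (Suc n))) (at 0) sequentially"
        by (auto simp: filterlim_at LIMSEQ_inverse_real_of_nat simp del: of_nat_Suc)
      ultimately show ?case by (rule filterlim_compose)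
    qed
  qed auto
qed

text \<open>After multiplication by the constant c_N, both pieces of the explicit integral blow up
  like (2/s) \<phi>(x)^(N/2) as s tends to 0. These poles cancel, and the limit is a derivative at
  0; the digamma values come from differentiating the Gamma quotient, the logarithms from the powers
  of 2 and \<phi>(x).\<close>

lemma conf_defect_integral:
  fixes x :: "'a::euclidean_space"
  shows "c_const DIM('a) * integral\<^sup>L lborel (conf_defect x 0) =
    conf_factor x powr (real DIM('a) / 2) *
      (2 * ln 2 - euler_mascheroni - Digamma (real DIM('a) / 2) - 2 * ln (conf_factor x))"
proof -
  let ?N = "real DIM('a)" and ?p = "conf_factor x"
  have N: "?N > 0" by simp
  have p: "?p > 0" by (rule conf_factor_pos)
  have G: "Gamma (?N / 2) > 0" using N by (intro Gamma_real_pos) simp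
  have nn: "x \<notin> \<int>\<^sub>\<le>\<^sub>0" if "x > 0" for x :: real
    using that by (auto elim!: nonpos_Ints_cases)
  \<comment> \<open>The common factor 2/s has been taken out, by
    \<open>Gamma (s / 2) = 2 / s * Gamma (1 + s / 2)\<close> in the first piece. The remainder is
    regular at 0 and vanishes there, so 2 f(s)/s tends to 2 f'(0).\<close>
  define f where "f s = ?p powr ((?N - s) / 2) * (2 powr s * Gamma (?N / 2) * Gamma (1 + s / 2) / Gamma ((?N + s) / 2))
    - ?p powr ((?N + s) / 2)" for s
  have scaled: "c_const DIM('a) * integral\<^sup>L lborel (conf_defect x s) = 2 * (f s / s)" if s: "0 < s" "s \<le> 1" for s
  proof -
    have pi: "pi powr (- (?N / 2)) * pi powr (?N / 2) = 1" by (simp flip: powr_add)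
    have "Gamma (1 + s / 2) = s / 2 * Gamma (s / 2)"
      using s Gamma_plus1[OF nn[of "s / 2"]] by (simp add: add.commute)
    then have G1: "Gamma (s / 2) = 2 / s * Gamma (1 + s / 2)" using s by (simp add: field_simps)
    have R: "c_const DIM('a) * riesz_value DIM('a) s = 2 / s * (2 powr s * Gamma (?N / 2) * Gamma (1 + s / 2) / Gamma ((?N + s) / 2))"
    proof -
      have "c_const DIM('a) * riesz_value DIM('a) s = (pi powr (- (?N / 2)) * pi powr (?N / 2)) *
          (Gamma (?N / 2) * 2 powr s * Gamma (s / 2) / Gamma ((?N + s) / 2))"
        unfolding c_const_def riesz_value_def by (simp add: mult_ac)
      then show ?thesis unfolding pi G1 by (simp add: mult_ac)
    qed
    \<comment> \<open>The product of c_N with the surface area of the unit sphere in the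
      N-dimensional space; it is the residue that matches the one of the Gamma factor.\<close>
    have V: "c_const DIM('a) * (?N * unit_ball_vol ?N) = 2"
    proof -
      have GN: "Gamma (?N / 2 + 1) = ?N / 2 * Gamma (?N / 2)"
        using N by (intro Gamma_plus1 nn) simp
      have "c_const DIM('a) * (?N * unit_ball_vol ?N) = (pi powr (- (?N / 2)) * pi powr (?N / 2)) *
          (?N * Gamma (?N / 2) / (?N / 2 * Gamma (?N / 2)))"
        unfolding c_const_def unit_ball_vol_def GN by (simp add: mult_ac)
      also have "?N * Gamma (?N / 2) / (?N / 2 * Gamma (?N / 2)) = 2"
        using G N by (simp del: Gamma_real_pos)
      finally show ?thesis unfolding pi by simp
    qed
    have I: "integral\<^sup>L lborel (conf_defect x s) = ?p powr ((?N - s) / 2) * riesz_value DIM('a) s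
      - ?p powr ((?N + s) / 2) * (?N * unit_ball_vol ?N / s)"
      using has_bochner_integral_conf_defect[OF s, of x] by (rule has_bochner_integral_integral_eq)
    have "c_const DIM('a) * integral\<^sup>L lborel (conf_defect x s) =
        ?p powr ((?N - s) / 2) * (c_const DIM('a) * riesz_value DIM('a) s)
        - ?p powr ((?N + s) / 2) * (c_const DIM('a) * (?N * unit_ball_vol ?N) / s)"
      unfolding I by (simp add: right_diff_distrib mult_ac)
    also have "\<dots> = ?p powr ((?N - s) / 2) * (2 / s * (2 powr s * Gamma (?N / 2) * Gamma (1 + s / 2) / Gamma ((?N + s) / 2)))
        - ?p powr ((?N + s) / 2) * (2 / s)"
      unfolding R V ..
    also have "\<dots> = 2 * (f s / s)"
      unfolding f_def by (simp add: diff_divide_distrib right_diff_distrib mult_ac)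
    finally show ?thesis .
  qed
  define g where "g = Gamma (?N / 2)"
  have g: "g \<noteq> 0" using G unfolding g_def by linarith
  have f0: "f 0 = 0" using g by (simp add: f_def g_def[symmetric])
  let ?d = "?p powr (?N / 2) * (ln 2 + Digamma 1 / 2 - Digamma (?N / 2) / 2 - ln ?p)"
  have d1: "((\<lambda>s. ?p powr ((?N - s) / 2)) has_real_derivative - (?p powr (?N / 2) * ln ?p / 2)) (at 0)"
    using p by (auto intro!: derivative_eq_intros)
  have d2: "((\<lambda>s::real. 2 powr s * g) has_real_derivative ln 2 * g) (at 0)"
    by (auto intro!: derivative_eq_intros)
  have d3: "((\<lambda>s::real. Gamma (1 + s / 2)) has_real_derivative Digamma 1 / 2) (at 0)"
    using nn[of 1] by (auto intro!: derivative_eq_intros)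
  have d4: "((\<lambda>s. Gamma ((?N + s) / 2)) has_real_derivative g * Digamma (?N / 2) / 2) (at 0)"
    using nn[of "?N / 2"] N by (auto intro!: derivative_eq_intros simp: g_def)
  have d5: "((\<lambda>s. ?p powr ((?N + s) / 2)) has_real_derivative ?p powr (?N / 2) * ln ?p / 2) (at 0)"
    using p by (auto intro!: derivative_eq_intros)
  have d6: "((\<lambda>s. 2 powr s * g * Gamma (1 + s / 2) / Gamma ((?N + s) / 2)) has_real_derivative
      ln 2 + Digamma 1 / 2 - Digamma (?N / 2) / 2) (at 0)"
    by (rule DERIV_cong[OF DERIV_divide[OF DERIV_mult[OF d2 d3] d4]])
      (use g in \<open>simp_all add: g_def[symmetric] field_simps del: Digamma_1\<close>)
  have "(f has_real_derivative ?d) (at 0)"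
    unfolding f_def[abs_def] g_def[symmetric]
    by (rule DERIV_cong[OF DERIV_diff[OF DERIV_mult[OF d1 d6] d5]])
      (use g in \<open>simp add: g_def[symmetric] field_simps del: Digamma_1\<close>)
  then have "((\<lambda>h. f h / h) \<longlongrightarrow> ?d) (at 0)"
    using f0 by (simp add: DERIV_def)
  moreover have "filterlim (\<lambda>n. inverse (real (Suc n))) (at 0) sequentially"
    by (auto simp: filterlim_at LIMSEQ_inverse_real_of_nat simp del: of_nat_Suc)
  ultimately have "(\<lambda>n. f (inverse (real (Suc n))) / inverse (real (Suc n))) \<longlonglongrightarrow> ?d"
    by (rule filterlim_compose)
  then have "(\<lambda>n. 2 * (f (inverse (real (Suc n))) / inverse (real (Suc n)))) \<longlonglongrightarrow> 2 * ?d"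
    by (rule tendsto_mult_left)
  then have "(\<lambda>n. c_const DIM('a) * integral\<^sup>L lborel (conf_defect x (inverse (real (Suc n))))) \<longlonglongrightarrow> 2 * ?d"
    by (subst scaled) (simp_all add: inverse_le_1_iff del: of_nat_Suc)
  moreover have "(\<lambda>n. c_const DIM('a) * integral\<^sup>L lborel (conf_defect x (inverse (real (Suc n))))) \<longlonglongrightarrow>
      c_const DIM('a) * integral\<^sup>L lborel (conf_defect x 0)"
    by (intro tendsto_mult_left conf_defect_integral_tendsto)
  ultimately have "c_const DIM('a) * integral\<^sup>L lborel (conf_defect x 0) = 2 * ?d"
    using LIMSEQ_unique by blast
  then show ?thesis by (simp add: Digamma_1 algebra_simps)
qed

section \<open>Transfer of the operator from the sphere\<close>

lemma sphere_integral_stereo: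
  fixes h :: "'a::euclidean_space \<times> real \<Rightarrow> real"
  assumes h: "h \<in> borel_measurable sphere_measure"
  shows "integrable sphere_measure h \<longleftrightarrow> integrable lborel (\<lambda>y. conf_factor y ^ DIM('a) * h (stereo_inv y))"
    and "integral\<^sup>L sphere_measure h = (LINT y|lborel. conf_factor y ^ DIM('a) * h (stereo_inv y))"
proof -
  have hm: "h \<in> borel_measurable (restrict_space borel (sphere 0 1))"
    using h by (simp add: measurable_cong_sets[OF sets_sphere_measure refl])
  have hs: "(\<lambda>y. h (stereo_inv y)) \<in> borel_measurable borel"
    using measurable_compose[OF stereo_inv_measurable hm] .
  have nn: "AE y in lborel. 0 \<le> conf_factor (y :: 'a) ^ DIM('a)"
    using conf_factor_pos by (intro AE_I2 zero_le_power) (rule less_imp_le)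
  show "integrable sphere_measure h \<longleftrightarrow> integrable lborel (\<lambda>y. conf_factor y ^ DIM('a) * h (stereo_inv y))"
    unfolding sphere_measure_stereo using hm hs nn
    by (subst integrable_distr_eq) (simp_all add: integrable_density)
  show "integral\<^sup>L sphere_measure h = (LINT y|lborel. conf_factor y ^ DIM('a) * h (stereo_inv y))"
    unfolding sphere_measure_stereo using hm hs nn
    by (subst integral_distr) (simp_all add: integral_density)
qed

lemma riesz_mass_finite:
  fixes e :: "'a::euclidean_space \<times> real"
  shows "norm e = 1 \<Longrightarrow> riesz_mass ((real DIM('a) - 1) / 2) e < \<infinity>"
  by (simp add: riesz_mass_subcritical)

text \<open>The Jacobian \<phi>(y)^N against the kernel factor (\<phi>(x) \<phi>(y))^(-N/2) leaves
  \<phi>(y)^(N/2) in the integrand and \<phi>(x)^(-N/2) in front; multiplying by \<phi>(x)^(N/2)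
  gives the stated value.\<close>

lemma conformal_difference_integral:
  fixes u :: "'a::euclidean_space \<times> real \<Rightarrow> real"
  assumes u: "smooth_on_sphere u"
  shows "has_bochner_integral lborel
    (\<lambda>y. (u (stereo_inv x) - u (stereo_inv y)) * conf_factor y powr (real DIM('a) / 2) / norm (x - y) ^ DIM('a))
    (conf_factor x powr (real DIM('a) / 2) *
      (\<integral>\<zeta>. (u (stereo_inv x) - u \<zeta>) / norm (stereo_inv x - \<zeta>) ^ DIM('a) \<partial>sphere_measure))"
proof -
  let ?N = "real DIM('a)" and ?z = "stereo_inv x"
  let ?h = "\<lambda>\<zeta>. (u ?z - u \<zeta>) / norm (?z - \<zeta>) ^ DIM('a)"
  let ?E = "\<lambda>y. (u ?z - u (stereo_inv y)) * conf_factor y powr (?N / 2) / norm (x - y) ^ DIM('a)"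
  have cf: "conf_factor y > 0" for y :: 'a by (rule conf_factor_pos)
  have i: "integrable sphere_measure ?h"
    by (rule integrable_riesz_difference[OF u norm_stereo_inv riesz_mass_finite[OF norm_stereo_inv]])
  have eq: "conf_factor y ^ DIM('a) * ?h (stereo_inv y) = ?E y / conf_factor x powr (?N / 2)" for y
  proof -
    have "norm (?z - stereo_inv y) ^ DIM('a) =
        conf_factor x powr (?N / 2) * conf_factor y powr (?N / 2) * norm (x - y) ^ DIM('a)"
      using norm_stereo_inv_diff_powr[of x y ?N] by (simp add: powr_realpow')
    moreover have "conf_factor y ^ DIM('a) = conf_factor y powr (?N / 2) * conf_factor y powr (?N / 2)"
      using cf[of y] by (simp add: powr_realpow flip: powr_add)
    ultimately show ?thesis using cf[of x] cf[of y] by (simp add: mult_ac)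
  qed
  have "integrable lborel (\<lambda>y. ?E y / conf_factor x powr (?N / 2))"
    using i sphere_integral_stereo(1)[OF borel_measurable_integrable[OF i]] unfolding eq by blast
  then have "has_bochner_integral lborel (\<lambda>y. conf_factor x powr (?N / 2) * (?E y / conf_factor x powr (?N / 2)))
      (conf_factor x powr (?N / 2) * (LINT y|lborel. ?E y / conf_factor x powr (?N / 2)))"
    by (intro has_bochner_integral_mult_right has_bochner_integral_integrable)
  moreover have "(LINT y|lborel. ?E y / conf_factor x powr (?N / 2)) = integral\<^sup>L sphere_measure ?h"
    using sphere_integral_stereo(2)[OF borel_measurable_integrable[OF i]] unfolding eq by simp
  moreover have "conf_factor x powr (?N / 2) * (?E y / conf_factor x powr (?N / 2)) = ?E y" for y
    using cf[of x] by simp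
  ultimately show ?thesis by simp
qed

text \<open>Conformal covariance holds for every smooth \<open>u\<close>. The harmonic enters only
  when the intertwined operator is replaced by its eigenvalue.\<close>

theorem log_laplacian_iota:
  fixes u :: "'a::euclidean_space \<times> real \<Rightarrow> real"
  assumes u: "smooth_on_sphere u"
  shows "log_laplacian (iota u) x =
    conf_factor x powr (real DIM('a) / 2) * conf_log_laplacian u (stereo_inv x) + 2 * ln (conf_factor x) * iota u x"
proof -
  let ?N = "real DIM('a)" and ?c = "c_const DIM('a)" and ?B = "ball x 1"
  define U where "U y = u (stereo_inv y)" for y :: 'a
  define w where "w y = conf_factor y powr (?N / 2)" for y :: 'a
  define I where "I = (\<integral>\<zeta>. (u (stereo_inv x) - u \<zeta>) / norm (stereo_inv x - \<zeta>) ^ DIM('a) \<partial>sphere_measure)"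
  define E where "E y = (U x - U y) * w y / norm (x - y) ^ DIM('a)" for y
  \<comment> \<open>The integrand of both Euclidean integrals at once, with the sign of the outer
    one included. It splits into two integrable functions, although v(x) - v(y) and v(y) are
    integrated over different regions.\<close>
  define T where "T y = E y - U x * conf_defect x 0 y" for y
  have v: "iota u y = w y * U y" for y by (simp add: iota_def w_def U_def)
  have E: "has_bochner_integral lborel E (w x * I)"
    using conformal_difference_integral[OF u, of x] by (simp add: E_def[abs_def] U_def w_def I_def)
  have T: "has_bochner_integral lborel T (w x * I - U x * integral\<^sup>L lborel (conf_defect x 0))"
    unfolding T_def[abs_def]
    by (intro has_bochner_integral_diff E has_bochner_integral_mult_right has_bochner_integral_integrable
        conf_defect_integral_tendsto(1))
  have T_eq: "T y = (indicator ?B y * iota u x - iota u y) / norm (x - y) ^ DIM('a)" for y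
  proof -
    have "conf_defect x 0 y = (w y - w x * indicator ?B y) / norm (x - y) ^ DIM('a)"
      by (simp add: conf_defect_def w_def powr_minus_divide powr_realpow')
    then show ?thesis
      by (simp add: T_def E_def v diff_divide_distrib[symmetric] algebra_simps)
  qed
  have Ti: "integrable lborel T" using T by (rule integrable.intros)
  have split: "integral\<^sup>L lborel T = (LINT y:?B|lborel. T y) + (LINT y:- ?B|lborel. T y)"
  proof -
    have "integral\<^sup>L lborel T = (LINT y|lborel. indicator ?B y * T y + indicator (- ?B) y * T y)"
      by (rule Bochner_Integration.integral_cong) (auto simp: indicator_def)
    also have "\<dots> = (LINT y|lborel. indicator ?B y * T y) + (LINT y|lborel. indicator (- ?B) y * T y)"
      using integrable_mult_indicator[OF _ Ti, of ?B] integrable_mult_indicator[OF _ Ti, of "- ?B"]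
      by (intro Bochner_Integration.integral_add) auto
    finally show ?thesis unfolding set_lebesgue_integral_def real_scaleR_def .
  qed
  have "(LINT y:?B|lborel. (iota u x - iota u y) / norm (x - y) ^ DIM('a)) = (LINT y:?B|lborel. T y)"
    unfolding set_lebesgue_integral_def
    by (rule Bochner_Integration.integral_cong) (auto simp: T_eq indicator_def)
  moreover have "(LINT y:- ?B|lborel. iota u y / norm (x - y) ^ DIM('a)) = - (LINT y:- ?B|lborel. T y)"
    unfolding set_lebesgue_integral_def Bochner_Integration.integral_minus[symmetric]
    by (rule Bochner_Integration.integral_cong) (auto simp: T_eq indicator_def)
  ultimately have "log_laplacian (iota u) x = ?c * integral\<^sup>L lborel T + rho_const DIM('a) * iota u x"
    unfolding log_laplacian_def split by (simp add: distrib_left)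
  also have "integral\<^sup>L lborel T = w x * I - U x * integral\<^sup>L lborel (conf_defect x 0)"
    using T by (rule has_bochner_integral_integral_eq)
  also have "?c * \<dots> = w x * (?c * I) - U x * (?c * integral\<^sup>L lborel (conf_defect x 0))"
    by (simp add: algebra_simps)
  finally show ?thesis
    unfolding conf_defect_integral conf_log_laplacian_def v I_def rho_const_def A_const_def
      w_def[symmetric] U_def[symmetric]
    by (simp add: algebra_simps)
qed

theorem corollary1p4:
  fixes u :: "(real ^ 'n) \<times> real \<Rightarrow> real" and v :: "real ^ 'n \<Rightarrow> real"
  assumes "spherical_harmonic u"
    and "v = iota u"
  shows "\<exists>l::real.
      (\<forall>z\<in>sphere 0 1. conf_log_laplacian u z = l * u z) \<and>
      (\<forall>x. log_laplacian v x + v x * ln (conf_factor x powr (-2)) = l * v x)"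
proof -
  let ?N = "DIM(real ^ 'n)" and ?D = "DIM((real ^ 'n) \<times> real)"
  have D: "?D = Suc ?N" by (simp only: DIM_prod DIM_real)
  have D2: "?D \<ge> 2" unfolding D by (simp add: Suc_leI)
  have u: "smooth_on_sphere u" using assms(1) by (simp add: spherical_harmonic_def)
  obtain i :: nat where i: "\<And>z. z \<in> sphere 0 1 \<Longrightarrow> - laplace_beltrami u z = real i * (real i + real ?N - 1) * u z"
    using assms(1) unfolding spherical_harmonic_def by blast
  \<comment> \<open>The sphere has dimension N in an ambient space of dimension N + 1, so the
    ambient form i (i + D - 2) of the eigenvalue, with D = N + 1, is i (i + N - 1).\<close>
  have shift: "real i + real ?D - 2 = real i + real ?N - 1" unfolding D by simp
  have "\<exists>l. \<forall>e\<in>sphere 0 1. (\<integral>x. (u e - u x) / norm (e - x) ^ ?N \<partial>sphere_measure) = l * u e"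
    by (rule riesz_difference_eigen[OF u D2, of i])
      (use i in \<open>auto simp only: shift riesz_mass_finite riesz_mass_critical\<close>)
  then obtain l where l: "\<And>e. e \<in> sphere 0 1 \<Longrightarrow>
      (\<integral>x. (u e - u x) / norm (e - x) ^ ?N \<partial>sphere_measure) = l * u e" by blast
  define m where "m = c_const ?N * l + A_const ?N"
  have P: "conf_log_laplacian u z = m * u z" if "z \<in> sphere 0 1" for z
    unfolding conf_log_laplacian_def l[OF that] m_def by (simp add: algebra_simps)
  \<comment> \<open>The logarithm equals -2 ln \<phi>(x) and cancels the additive term of the
    covariance formula; the eigenfunction property is then used at the point
    \<sigma>^(-1)(x).\<close>
  have "log_laplacian v x + v x * ln (conf_factor x powr (-2)) = m * v x" for x
    using P[OF stereo_inv_in_sphere, of x] conf_factor_pos[of x]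
    by (simp add: assms(2) log_laplacian_iota[OF u] ln_powr) (simp add: iota_def)
  with P show ?thesis by blast
qed

end
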